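(* Let $M$ be a smooth compact manifold and $\mathbf{A}$ a Weil algebra, and let $M^{\mathbf{A}}$ be the Weil bundle of $M$. 1. If $M$ is connected, then so is $M^{\mathbf{A}}$. 2. If $M$ is path-connected, then so is $M^{\mathbf{A}}$. 3. If $M$ is simply connected, then so is $M^{\mathbf{A}}$.
   Context: A Weil algebra is a finite-dimensional, commutative, associative, unital $\mathbb{R}$-algebra $\mathbf{A}=\mathbb{R}\oplus\mathcal{A}$, where $\mathcal{A}$ is a maximal ideal with $\mathcal{A}^{k+1}=0$ for some $k\ge 1$. For a smooth manifold $M$ and $x\in M$, $M^{\mathbf{A}}_x$ is the set of $\mathbb{R}$-algebra morphisms $\xi:C^\infty(M)\to\mathbf{A}$ with $\mathrm{pr}_{\mathbb{R}}\circ\xi=\mathrm{ev}_x$, where $\mathrm{ev}_x(f)=f(x)$ and $\mathrm{pr}_{\mathbb{R}}:\mathbf{A}\to\mathbb{R}$ is the projection along $\mathcal{A}$. The Weil bundle is $M^{\mathbf{A}}=\bigcup_{x\in M}M^{\mathbf{A}}_x$, with projection $\pi_{\mathbf{A}}:M^{\mathbf{A}}\to M$ sending $\xi\in M^{\mathbf{A}}_x$ to $x$. It is a smooth manifold: for a chart $(U,\phi_1,\dots,\phi_m)$ of $M$ and a basis $\alpha_1=1_{\mathbf{A}},\alpha_2,\dots,\alpha_l$ of $\mathbf{A}$, write $\xi(\phi_i)=\sum_j x_{ij}(\xi)\alpha_j$; the functions $x_{ij}$ form a chart on $\pi_{\mathbf{A}}^{-1}(U)$. $M^{\mathbf{A}}$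 carries its manifold topology. *)

theory Defs
  imports "HOL-Analysis.Analysis"
begin

section \<open>Smooth functions on open subsets of Euclidean space\<close>

text \<open>
  Points of \<open>\<real>\<^sup>n\<close> are the elements of \<^term>\<open>topspace (Euclidean_space n)\<close>, i.e. functions
  \<open>nat \<Rightarrow> real\<close> vanishing from index \<open>n\<close> on, with coordinates indexed by \<open>0, \<dots>, n - 1\<close>.
  This covers \<open>n = 0\<close>, which the class \<^class>\<open>euclidean_space\<close> does not.
  The predicates below are meant for open \<open>S\<close>: then the curve \<open>t \<mapsto> x(i := t)\<close> stays in \<open>S\<close>
  near \<open>t = x i\<close>, and \<open>D i\<close> is the \<open>i\<close>-th partial derivative, uniquely determined on \<open>S\<close>.
\<close>

primrec Ck_on :: "nat \<Rightarrow> nat \<Rightarrow> (nat \<Rightarrow> real) set \<Rightarrow> ((nat \<Rightarrow> real) \<Rightarrow> real) \<Rightarrow> bool" where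
  "Ck_on n 0 S f \<longleftrightarrow> continuous_map (subtopology (Euclidean_space n) S) euclideanreal f"
| "Ck_on n (Suc k) S f \<longleftrightarrow>
     continuous_map (subtopology (Euclidean_space n) S) euclideanreal f \<and>
     (\<exists>D. \<forall>i<n. (\<forall>x\<in>S. ((\<lambda>t. f (x(i := t))) has_real_derivative D i x) (at (x i))) \<and>
                Ck_on n k S (D i))"

definition smooth_on :: "nat \<Rightarrow> (nat \<Rightarrow> real) set \<Rightarrow> ((nat \<Rightarrow> real) \<Rightarrow> real) \<Rightarrow> bool" where
  "smooth_on n S f \<longleftrightarrow> (\<forall>k. Ck_on n k S f)"

section \<open>Smooth manifolds\<close>

type_synonym 'p chart = "'p set \<times> ('p \<Rightarrow> nat \<Rightarrow> real)"

definition is_chart :: "nat \<Rightarrow> 'p topology \<Rightarrow> 'p chart \<Rightarrow> bool" where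
  "is_chart n X c \<longleftrightarrow> (case c of (U, \<phi>) \<Rightarrow>
     openin X U \<and> openin (Euclidean_space n) (\<phi> ` U) \<and>
     homeomorphic_map (subtopology X U) (subtopology (Euclidean_space n) (\<phi> ` U)) \<phi>)"

definition smooth_transition :: "nat \<Rightarrow> 'p chart \<Rightarrow> 'p chart \<Rightarrow> bool" where
  "smooth_transition n c d \<longleftrightarrow> (case (c, d) of ((U, \<phi>), (V, \<psi>)) \<Rightarrow>
     \<forall>i<n. smooth_on n (\<phi> ` (U \<inter> V)) (\<lambda>y. \<psi> (inv_into U \<phi> y) i))"

text \<open>
  \<open>C\<close> may be any smooth atlas; it is not required to be maximal. A maximal atlas is a special
  case, and an atlas yields the same smooth functions as its maximal extension.
\<close>

definition smooth_manifold :: "nat \<Rightarrow> 'p topology \<Rightarrow> 'p chart set \<Rightarrow> bool" where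
  "smooth_manifold n X C \<longleftrightarrow>
     Hausdorff_space X \<and> second_countable X \<and>
     (\<forall>c\<in>C. is_chart n X c) \<and> \<Union> (fst ` C) = topspace X \<and>
     (\<forall>c\<in>C. \<forall>d\<in>C. smooth_transition n c d)"

text \<open>
  The elements of \<open>C\<^sup>\<infinity>(M)\<close> are functions on \<open>M\<close>; extensionality discards the values that a
  HOL function has outside the carrier.
\<close>

definition smooth_functions :: "nat \<Rightarrow> 'p topology \<Rightarrow> 'p chart set \<Rightarrow> ('p \<Rightarrow> real) set" where
  "smooth_functions n X C =
     {f \<in> extensional (topspace X). \<forall>(U, \<phi>)\<in>C. smooth_on n (\<phi> ` U) (\<lambda>y. f (inv_into U \<phi> y))}"

section \<open>Weil algebras\<close>

definition is_ideal :: "'a::comm_ring_1 set \<Rightarrow> bool" where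
  "is_ideal I \<longleftrightarrow> 0 \<in> I \<and> (\<forall>x\<in>I. \<forall>y\<in>I. x + y \<in> I) \<and> (\<forall>a. \<forall>x\<in>I. a * x \<in> I)"

definition is_maximal_ideal :: "'a::comm_ring_1 set \<Rightarrow> bool" where
  "is_maximal_ideal I \<longleftrightarrow> is_ideal I \<and> I \<noteq> UNIV \<and>
     (\<forall>J. is_ideal J \<and> I \<subseteq> J \<longrightarrow> J = I \<or> J = UNIV)"

text \<open>
  The type \<open>'a\<close> is the algebra, \<open>N\<close> its maximal ideal. The power \<open>N\<^sup>k\<^sup>+\<^sup>1\<close> is generated by the
  products of \<open>k + 1\<close> elements of \<open>N\<close>, so it is zero iff all these products are.
\<close>

definition weil_algebra :: "'a::{real_algebra_1, comm_ring_1} set \<Rightarrow> bool" where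
  "weil_algebra N \<longleftrightarrow>
     (\<exists>B::'a set. finite B \<and> span B = UNIV) \<and>
     is_maximal_ideal N \<and>
     (\<forall>a. \<exists>r. \<exists>b\<in>N. a = of_real r + b) \<and> range of_real \<inter> N = {0} \<and>
     (\<exists>k::nat. k \<ge> 1 \<and> (\<forall>a. (\<forall>i<k + 1. a i \<in> N) \<longrightarrow> (\<Prod>i<k + 1. a i) = 0))"

definition pr_real :: "'a::{real_algebra_1, comm_ring_1} set \<Rightarrow> 'a \<Rightarrow> real" where
  "pr_real N a = (THE r. \<exists>b\<in>N. a = of_real r + b)"

definition weil_basis :: "nat \<Rightarrow> (nat \<Rightarrow> 'a::{real_algebra_1, comm_ring_1}) \<Rightarrow> bool" where
  "weil_basis l \<alpha> \<longleftrightarrow> l > 0 \<and> \<alpha> 0 = 1 \<and> inj_on \<alpha> {..<l} \<and>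
     independent (\<alpha> ` {..<l}) \<and> span (\<alpha> ` {..<l}) = UNIV"

section \<open>The Weil bundle\<close>

definition algebra_morphisms ::
  "nat \<Rightarrow> 'p topology \<Rightarrow> 'p chart set \<Rightarrow> (('p \<Rightarrow> real) \<Rightarrow> 'a::{real_algebra_1, comm_ring_1}) set" where
  "algebra_morphisms n X C =
     {\<xi> \<in> extensional (smooth_functions n X C).
        (\<forall>f\<in>smooth_functions n X C. \<forall>g\<in>smooth_functions n X C.
           \<xi> (\<lambda>x\<in>topspace X. f x + g x) = \<xi> f + \<xi> g \<and>
           \<xi> (\<lambda>x\<in>topspace X. f x * g x) = \<xi> f * \<xi> g) \<and>
        (\<forall>c. \<forall>f\<in>smooth_functions n X C. \<xi> (\<lambda>x\<in>topspace X. c * f x) = c *\<^sub>R \<xi> f) \<and>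
        \<xi> (\<lambda>x\<in>topspace X. 1) = 1}"

definition weil_fibre ::
  "nat \<Rightarrow> 'p topology \<Rightarrow> 'p chart set \<Rightarrow> 'a::{real_algebra_1, comm_ring_1} set \<Rightarrow> 'p \<Rightarrow>
   (('p \<Rightarrow> real) \<Rightarrow> 'a) set" where
  "weil_fibre n X C N x =
     {\<xi> \<in> algebra_morphisms n X C. \<forall>f\<in>smooth_functions n X C. pr_real N (\<xi> f) = f x}"

definition weil_bundle ::
  "nat \<Rightarrow> 'p topology \<Rightarrow> 'p chart set \<Rightarrow> 'a::{real_algebra_1, comm_ring_1} set \<Rightarrow>
   (('p \<Rightarrow> real) \<Rightarrow> 'a) set" where
  "weil_bundle n X C N = (\<Union>x\<in>topspace X. weil_fibre n X C N x)"

text \<open>The fibres are disjoint, since smooth functions separate the points of a manifold.\<close>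

definition weil_proj ::
  "nat \<Rightarrow> 'p topology \<Rightarrow> 'p chart set \<Rightarrow> 'a::{real_algebra_1, comm_ring_1} set \<Rightarrow>
   (('p \<Rightarrow> real) \<Rightarrow> 'a) \<Rightarrow> 'p" where
  "weil_proj n X C N \<xi> = (THE x. x \<in> topspace X \<and> \<xi> \<in> weil_fibre n X C N x)"

text \<open>
  The value \<open>\<xi>(g)\<close> for a function \<open>g\<close> that is smooth only near the base point of \<open>\<xi>\<close>, such as a
  chart component: \<open>\<xi>\<close> depends only on germs at the base point, so \<open>\<xi>(g)\<close> is \<open>\<xi>(f)\<close> for any
  global smooth \<open>f\<close> that agrees with \<open>g\<close> near that point.
\<close>

definition weil_eval ::
  "nat \<Rightarrow> 'p topology \<Rightarrow> 'p chart set \<Rightarrow> 'a::{real_algebra_1, comm_ring_1} set \<Rightarrow>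
   (('p \<Rightarrow> real) \<Rightarrow> 'a) \<Rightarrow> ('p \<Rightarrow> real) \<Rightarrow> 'a" where
  "weil_eval n X C N \<xi> g =
     (THE a. \<exists>f\<in>smooth_functions n X C. \<exists>W. openin X W \<and> weil_proj n X C N \<xi> \<in> W \<and>
               (\<forall>y\<in>W. f y = g y) \<and> a = \<xi> f)"

definition weil_coord ::
  "nat \<Rightarrow> 'p topology \<Rightarrow> 'p chart set \<Rightarrow> 'a::{real_algebra_1, comm_ring_1} set \<Rightarrow>
   ('p \<Rightarrow> nat \<Rightarrow> real) \<Rightarrow> nat \<Rightarrow> (nat \<Rightarrow> 'a) \<Rightarrow> (('p \<Rightarrow> real) \<Rightarrow> 'a) \<Rightarrow> nat \<times> nat \<Rightarrow> real" where
  "weil_coord n X C N \<phi> l \<alpha> \<xi> =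
     (\<lambda>(i, j)\<in>{..<n} \<times> {..<l}.
        representation (\<alpha> ` {..<l}) (weil_eval n X C N \<xi> (\<lambda>p. \<phi> p i)) (\<alpha> j))"

text \<open>
  The manifold topology is generated by the preimages, under the charts \<open>(x\<^sub>i\<^sub>j)\<close> on
  \<open>\<pi>\<^sup>-\<^sup>1(U)\<close>, of the open sets of \<open>\<real>\<^sup>n\<^sup>l\<close>; all charts \<open>(U, \<phi>)\<close> of the atlas and all bases
  \<open>\<alpha>\<close> of the algebra with \<open>\<alpha> 0 = 1\<close> are used.
\<close>

definition weil_bundle_topology ::
  "nat \<Rightarrow> 'p topology \<Rightarrow> 'p chart set \<Rightarrow> 'a::{real_algebra_1, comm_ring_1} set \<Rightarrow>
   (('p \<Rightarrow> real) \<Rightarrow> 'a) topology" where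
  "weil_bundle_topology n X C N = topology_generated_by
     {{\<xi> \<in> weil_bundle n X C N. weil_proj n X C N \<xi> \<in> U \<and> weil_coord n X C N \<phi> l \<alpha> \<xi> \<in> V} |
        U \<phi> l \<alpha> V. (U, \<phi>) \<in> C \<and> weil_basis l \<alpha> \<and>
        openin (product_topology (\<lambda>_. euclideanreal) ({..<n} \<times> {..<l})) V}"

section \<open>Simple connectedness\<close>

text \<open>
  Path-connected with trivial fundamental group: every loop is homotopic, with fixed base point,
  to a constant loop. This is for abstract topologies; the constant \<^const>\<open>simply_connected\<close>
  concerns only subsets of a type of class \<^class>\<open>topological_space\<close>.
\<close>

definition simply_connected_space :: "'a topology \<Rightarrow> bool" where
  "simply_connected_space X \<longleftrightarrow> path_connected_space X \<and>
     (\<forall>p. pathin X p \<and> p 1 = p 0 \<longrightarrow>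
        homotopic_with (\<lambda>q. q 0 = p 0 \<and> q 1 = p 0) (top_of_set {0..1}) X p (\<lambda>_. p 0))"

end

theory Submission
  imports Defs "HOL-Computational_Algebra.Polynomial"
begin

text \<open>
  The bundle contracts onto its zero section, which is a copy of \<open>X\<close>; hence it inherits
  connectedness, path-connectedness and simple connectedness from \<open>X\<close>.

  In a chart a point over \<open>x\<close> is given by its coordinates \<open>x\<^sub>i + \<nu>\<^sub>i\<close>, where the \<open>\<nu>\<^sub>i\<close> are nilpotent.
  Multiplying all \<open>\<nu>\<^sub>i\<close> by \<open>\<tau> \<in> [0, 1]\<close> gives another point over \<open>x\<close>; intrinsically, the test functions are
  composed with the dilation by \<open>\<tau>\<close> about \<open>x\<close> in the chart, an operation on germs at \<open>x\<close>
  (\<open>scale_pt_fibre\<close>). This depends on the chart. If it is done with the factor \<open>1 - t b(x)\<close>,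
  where \<open>b\<close> is a bump function supported in the chart domain, it extends by the identity to a homotopy
  of the whole bundle (\<open>local_contraction\<close>). At \<open>t = 1\<close> all points over \<open>{b = 1}\<close> have reached the
  zero section, and points of the zero section never move. As \<open>X\<close> is compact, finitely many such sets
  cover it, and the composition of the corresponding homotopies moves everything to the zero section
  (\<open>contraction_to_zero_section\<close>).

  Continuity of these homotopies is where the nilpotency of the maximal ideal enters. The chart
  coordinates of a point \<open>\<xi>\<close> determine \<open>\<xi>(f)\<close> for every smooth \<open>f\<close>, continuously, by a Taylor expansion
  whose remainder vanishes (\<open>weil_eval_Taylor\<close>, \<open>acont_fibre_chart\<close>). Therefore the topology of
  the bundle is the initial topology of the evaluations \<open>\<xi> \<mapsto> \<xi>(f)\<close> at global smooth functions
  (\<open>continuous_map_bundle_iff\<close>), and maps into the bundle can be checked in any one chart.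

  The retraction yields the three claims by general topology (\<open>connected_factor\<close>,
  \<open>path_connected_factor\<close>, \<open>simply_connected_factor\<close>). For the last one, a loop is
  contracted through loops with moving base point, and the motion of the base point is then
  compensated (\<open>free_null_homotopic_imp_based\<close>).
\<close>

section \<open>Calculus on open subsets of Euclidean space\<close>

text \<open>The recursion introduces an existential quantifier, so it is unfolded only on demand.\<close>

declare Ck_on.simps(2) [simp del]

abbreviation coord_space :: "nat \<Rightarrow> (nat \<Rightarrow> real) set" where
  "coord_space n \<equiv> {x. \<forall>i\<ge>n. x i = 0}"

lemma Euclidean_space_top_of_set: "Euclidean_space n = top_of_set (coord_space n)"
  by (simp add: Euclidean_space_def euclidean_product_topology)

lemma Ck_on_0_iff:
  assumes "S \<subseteq> coord_space n"
  shows "Ck_on n 0 S f \<longleftrightarrow> continuous_on S f"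
  using assms by (simp add: Euclidean_space_top_of_set subtopology_subtopology Int_absorb1)

text \<open>
  Cubes serve as neighbourhoods because they are stable under moving single coordinates towards those
  of the centre, the operation behind Taylor expansion in one coordinate.
\<close>

definition cube :: "nat \<Rightarrow> (nat \<Rightarrow> real) \<Rightarrow> real \<Rightarrow> (nat \<Rightarrow> real) set" where
  "cube n x r = {y \<in> coord_space n. \<forall>i<n. \<bar>y i - x i\<bar> < r}"

lemma cube_subset: "cube n x r \<subseteq> coord_space n"
  by (auto simp: cube_def)

lemma centre_in_cube: "x \<in> coord_space n \<Longrightarrow> r > 0 \<Longrightarrow> x \<in> cube n x r"
  by (auto simp: cube_def)

lemma openin_cube: "openin (Euclidean_space n) (cube n x r)"
proof -
  have "open {y::nat\<Rightarrow>real. \<bar>y i - x i\<bar> < r}" for i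
    by (intro open_Collect_less continuous_intros) simp
  then have "open (\<Inter>i\<in>{..<n}. {y::nat\<Rightarrow>real. \<bar>y i - x i\<bar> < r})"
    by (intro open_INT) auto
  also have "(\<Inter>i\<in>{..<n}. {y::nat\<Rightarrow>real. \<bar>y i - x i\<bar> < r}) = {y. \<forall>i\<in>{..<n}. \<bar>y i - x i\<bar> < r}"
    by auto
  finally show ?thesis
    unfolding Euclidean_space_top_of_set openin_open
    by (intro exI[of _ "{y. \<forall>i\<in>{..<n}. \<bar>y i - x i\<bar> < r}"]) (auto simp: cube_def)
qed

lemma openin_contains_cube:
  assumes "openin (Euclidean_space n) S" "x \<in> S"
  obtains r where "r > 0" "cube n x r \<subseteq> S"
proof -
  obtain T where T: "open T" "S = coord_space n \<inter> T"
    using assms(1) unfolding Euclidean_space_top_of_set openin_open by blast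
  have "openin (product_topology (\<lambda>i. euclidean) UNIV) T"
    using T(1) by (simp add: euclidean_product_topology)
  moreover have "x \<in> T" using assms(2) T(2) by blast
  ultimately have "\<exists>X. x \<in> (\<Pi>\<^sub>E i\<in>UNIV. X i) \<and> (\<forall>i. openin euclidean (X i)) \<and>
      finite {i. X i \<noteq> topspace euclidean} \<and> (\<Pi>\<^sub>E i\<in>UNIV. X i) \<subseteq> T"
    by (rule product_topology_open_contains_basis)
  then obtain X :: "nat \<Rightarrow> real set"
    where X: "x \<in> (\<Pi>\<^sub>E i\<in>UNIV. X i)" "\<And>i. open (X i)" "(\<Pi>\<^sub>E i\<in>UNIV. X i) \<subseteq> T"
      and fin: "finite {i. X i \<noteq> UNIV}"
    by auto
  have "\<exists>e>0. \<forall>y. \<bar>y - x i\<bar> < e \<longrightarrow> y \<in> X i" for i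
  proof -
    have "x i \<in> X i" using X(1) by blast
    then show ?thesis using X(2)[of i] unfolding open_dist by (auto simp: dist_real_def)
  qed
  then obtain e where e: "\<And>i. e i > 0" "\<And>i y. \<bar>y - x i\<bar> < e i \<Longrightarrow> y \<in> X i"
    by metis
  define r where "r = Min (insert 1 (e ` {i. X i \<noteq> UNIV}))"
  have "r > 0" using e(1) fin by (auto simp: r_def)
  have r: "r \<le> e i" if "X i \<noteq> UNIV" for i
    using that fin by (auto simp: r_def intro!: Min_le)
  have "cube n x r \<subseteq> S"
  proof
    fix y assume y: "y \<in> cube n x r"
    have "y i \<in> X i" for i
    proof (cases "X i = UNIV \<or> i \<ge> n")
      case True
      then show ?thesis
      proof
        assume "i \<ge> n"
        then have "y i = x i" using y assms(2) T(2) by (auto simp: cube_def)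
        then show ?thesis using e(1)[of i] e(2)[of "x i" i] by simp
      qed simp
    next
      case False
      then have "\<bar>y i - x i\<bar> < r" "r \<le> e i"
        using y r[of i] by (simp_all add: cube_def)
      then have "\<bar>y i - x i\<bar> < e i" by linarith
      then show ?thesis using e(2) by blast
    qed
    then show "y \<in> S"
      using X(3) y T(2) by (auto simp: cube_def PiE_def)
  qed
  with \<open>r > 0\<close> show thesis using that by blast
qed

text \<open>
  A function has at most one value of each partial derivative, so the existentially quantified
  derivatives in the definition of the classes \<open>C\<^sup>k\<close> may be replaced by this one.
\<close>

definition partial_deriv :: "nat \<Rightarrow> ((nat \<Rightarrow> real) \<Rightarrow> real) \<Rightarrow> (nat \<Rightarrow> real) \<Rightarrow> real" where
  "partial_deriv i f x = deriv (\<lambda>t. f (x(i := t))) (x i)"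

lemma open_line:
  assumes "openin (Euclidean_space n) S" "x \<in> S" "i < n"
  shows "\<forall>\<^sub>F t in nhds (x i). x(i := t) \<in> S"
proof -
  obtain r where r: "r > 0" "cube n x r \<subseteq> S"
    using openin_contains_cube assms by blast
  have "x \<in> coord_space n"
    using assms openin_subset topspace_Euclidean_space by fastforce
  then have "x(i := t) \<in> S" if "dist t (x i) < r" for t
    using r that assms(3) by (auto simp: cube_def dist_real_def subset_iff)
  then show ?thesis
    using r(1) eventually_nhds_metric by blast
qed

lemma Ck_on_imp_continuous_map:
  "Ck_on n k S f \<Longrightarrow> continuous_map (subtopology (Euclidean_space n) S) euclideanreal f"
  by (cases k) (simp_all add: Ck_on.simps(2))

lemma Ck_on_SucI:
  assumes "continuous_map (subtopology (Euclidean_space n) S) euclideanreal f"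
    and "\<And>i x. i < n \<Longrightarrow> x \<in> S \<Longrightarrow> ((\<lambda>t. f (x(i := t))) has_real_derivative D i x) (at (x i))"
    and "\<And>i. i < n \<Longrightarrow> Ck_on n k S (D i)"
  shows "Ck_on n (Suc k) S f"
  unfolding Ck_on.simps using assms by blast

lemma Ck_on_SucE:
  assumes "Ck_on n (Suc k) S f"
  obtains D where
    "\<And>i x. i < n \<Longrightarrow> x \<in> S \<Longrightarrow> ((\<lambda>t. f (x(i := t))) has_real_derivative D i x) (at (x i))"
    "\<And>i. i < n \<Longrightarrow> Ck_on n k S (D i)"
  using assms unfolding Ck_on.simps by blast

lemma Ck_on_cong:
  assumes S: "openin (Euclidean_space n) S" and eq: "\<And>x. x \<in> S \<Longrightarrow> f x = g x" and f: "Ck_on n k S f"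
  shows "Ck_on n k S g"
proof -
  have c: "continuous_map (subtopology (Euclidean_space n) S) euclideanreal g"
    by (rule continuous_map_eq[OF Ck_on_imp_continuous_map[OF f]]) (simp add: eq)
  show ?thesis
  proof (cases k)
    case 0 then show ?thesis using c by simp
  next
    case (Suc k')
    from f[unfolded Suc] obtain D where D:
      "\<And>i x. i < n \<Longrightarrow> x \<in> S \<Longrightarrow> ((\<lambda>t. f (x(i := t))) has_real_derivative D i x) (at (x i))"
      "\<And>i. i < n \<Longrightarrow> Ck_on n k' S (D i)"
      by (rule Ck_on_SucE) blast
    have "((\<lambda>t. g (x(i := t))) has_real_derivative D i x) (at (x i))" if "i < n" "x \<in> S" for i x
    proof -
      have "\<forall>\<^sub>F t in nhds (x i). f (x(i := t)) = g (x(i := t))"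
        by (rule eventually_mono[OF open_line[OF S that(2,1)]]) (simp add: eq)
      from DERIV_cong_ev[OF refl this refl] D(1)[OF that] show ?thesis by blast
    qed
    then show ?thesis unfolding Suc by (intro Ck_on_SucI[where D = D] c D(2))
  qed
qed

lemma open_Euclidean_subset: "openin (Euclidean_space n) S \<Longrightarrow> S \<subseteq> coord_space n"
  using openin_subset topspace_Euclidean_space by fastforce

lemma Ck_on_Suc_iff:
  assumes "openin (Euclidean_space n) S"
  shows "Ck_on n (Suc k) S f \<longleftrightarrow> continuous_on S f \<and>
    (\<forall>i<n. (\<forall>x\<in>S. ((\<lambda>t. f (x(i := t))) has_real_derivative partial_deriv i f x) (at (x i))) \<and>
      Ck_on n k S (partial_deriv i f))" (is "?l \<longleftrightarrow> ?r")
proof -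
  have c: "continuous_map (subtopology (Euclidean_space n) S) euclideanreal f \<longleftrightarrow> continuous_on S f"
    using Ck_on_0_iff[OF open_Euclidean_subset[OF assms]] by simp
  show ?thesis
  proof
    assume l: ?l
    then obtain D where D:
      "\<And>i x. i < n \<Longrightarrow> x \<in> S \<Longrightarrow> ((\<lambda>t. f (x(i := t))) has_real_derivative D i x) (at (x i))"
      "\<And>i. i < n \<Longrightarrow> Ck_on n k S (D i)"
      by (rule Ck_on_SucE) blast
    have eq: "D i x = partial_deriv i f x" if "i < n" "x \<in> S" for i x
      unfolding partial_deriv_def using DERIV_imp_deriv[OF D(1)[OF that]] by simp
    have "Ck_on n k S (partial_deriv i f)" if "i < n" for i
      by (rule Ck_on_cong[OF assms _ D(2)[OF that]]) (rule eq[OF that])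
    moreover have "((\<lambda>t. f (x(i := t))) has_real_derivative partial_deriv i f x) (at (x i))"
      if "i < n" "x \<in> S" for i x
      using D(1)[OF that] eq[OF that] by metis
    ultimately show ?r using Ck_on_imp_continuous_map[OF l] c by blast
  next
    assume ?r then show ?l
      using c by (intro Ck_on_SucI[where D = "\<lambda>i. partial_deriv i f"]) blast+
  qed
qed

lemma Ck_on_SucD: "Ck_on n (Suc k) S f \<Longrightarrow> Ck_on n k S f"
proof (induction k arbitrary: f)
  case 0
  then show ?case by (simp add: Ck_on_imp_continuous_map)
next
  case (Suc k)
  from Suc.prems obtain D where D:
    "\<And>i x. i < n \<Longrightarrow> x \<in> S \<Longrightarrow> ((\<lambda>t. f (x(i := t))) has_real_derivative D i x) (at (x i))"
    "\<And>i. i < n \<Longrightarrow> Ck_on n (Suc k) S (D i)"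
    by (rule Ck_on_SucE) blast
  show ?case
    by (rule Ck_on_SucI[OF Ck_on_imp_continuous_map[OF Suc.prems] D(1) Suc.IH[OF D(2)]])
qed

lemma Ck_on_const: "Ck_on n k S (\<lambda>x. c)"
proof (induction k arbitrary: c)
  case (Suc k)
  show ?case
    by (rule Ck_on_SucI[where D = "\<lambda>_ _. 0"]) (simp_all add: Suc)
qed simp

lemma Ck_on_coord: "Ck_on n k S (\<lambda>x. x j)"
proof -
  have c: "continuous_map (subtopology (Euclidean_space n) S) euclideanreal (\<lambda>x. x j)"
    unfolding Euclidean_space_def
    by (intro continuous_map_from_subtopology continuous_map_product_projection) simp
  show ?thesis
  proof (cases k)
    case (Suc k')
    have "((\<lambda>t. (x(i := t)) j) has_real_derivative (if i = j then 1 else 0)) (at (x i))"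
      for i and x :: "nat \<Rightarrow> real"
      by (cases "i = j") auto
    then show ?thesis
      unfolding Suc by (intro Ck_on_SucI[where D = "\<lambda>i _. if i = j then 1 else 0"] c Ck_on_const)
  qed (use c in simp)
qed

lemma Ck_on_add: "Ck_on n k S f \<Longrightarrow> Ck_on n k S g \<Longrightarrow> Ck_on n k S (\<lambda>x. f x + g x)"
proof (induction k arbitrary: f g)
  case 0 then show ?case by (auto intro: continuous_map_add)
next
  case (Suc k)
  from Suc.prems(1) obtain D where D:
    "\<And>i x. i < n \<Longrightarrow> x \<in> S \<Longrightarrow> ((\<lambda>t. f (x(i := t))) has_real_derivative D i x) (at (x i))"
    "\<And>i. i < n \<Longrightarrow> Ck_on n k S (D i)"
    by (rule Ck_on_SucE) blast
  from Suc.prems(2) obtain E where E: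
    "\<And>i x. i < n \<Longrightarrow> x \<in> S \<Longrightarrow> ((\<lambda>t. g (x(i := t))) has_real_derivative E i x) (at (x i))"
    "\<And>i. i < n \<Longrightarrow> Ck_on n k S (E i)"
    by (rule Ck_on_SucE) blast
  show ?case
    by (rule Ck_on_SucI[where D = "\<lambda>i x. D i x + E i x"])
      (intro continuous_map_add Ck_on_imp_continuous_map[OF Suc.prems(1)]
        Ck_on_imp_continuous_map[OF Suc.prems(2)] DERIV_add D E Suc.IH; assumption)+
qed

lemma Ck_on_mult: "Ck_on n k S f \<Longrightarrow> Ck_on n k S g \<Longrightarrow> Ck_on n k S (\<lambda>x. f x * g x)"
proof (induction k arbitrary: f g)
  case 0 then show ?case by (auto intro: continuous_map_real_mult)
next
  case (Suc k)
  from Suc.prems(1) obtain D where D: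
    "\<And>i x. i < n \<Longrightarrow> x \<in> S \<Longrightarrow> ((\<lambda>t. f (x(i := t))) has_real_derivative D i x) (at (x i))"
    "\<And>i. i < n \<Longrightarrow> Ck_on n k S (D i)"
    by (rule Ck_on_SucE) blast
  from Suc.prems(2) obtain E where E:
    "\<And>i x. i < n \<Longrightarrow> x \<in> S \<Longrightarrow> ((\<lambda>t. g (x(i := t))) has_real_derivative E i x) (at (x i))"
    "\<And>i. i < n \<Longrightarrow> Ck_on n k S (E i)"
    by (rule Ck_on_SucE) blast
  show ?case
  proof (rule Ck_on_SucI[where D = "\<lambda>i x. D i x * g x + E i x * f x"])
    show "((\<lambda>t. f (x(i := t)) * g (x(i := t))) has_real_derivative D i x * g x + E i x * f x) (at (x i))"
      if "i < n" "x \<in> S" for i x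
      using DERIV_mult[OF D(1) E(1), OF that that] by simp
    show "Ck_on n k S (\<lambda>x. D i x * g x + E i x * f x)" if "i < n" for i
      by (rule Ck_on_add[OF Suc.IH[OF D(2) Ck_on_SucD] Suc.IH[OF E(2) Ck_on_SucD]])
        (use that Suc.prems in auto)
  qed (intro continuous_map_real_mult Ck_on_imp_continuous_map[OF Suc.prems(1)]
        Ck_on_imp_continuous_map[OF Suc.prems(2)])
qed

lemma Ck_on_sum: "(\<And>i. i \<in> I \<Longrightarrow> Ck_on n k S (f i)) \<Longrightarrow> Ck_on n k S (\<lambda>x. \<Sum>i\<in>I. f i x)"
  by (induction I rule: infinite_finite_induct) (auto intro: Ck_on_const Ck_on_add)

lemma Ck_on_subset: "Ck_on n k S f \<Longrightarrow> T \<subseteq> S \<Longrightarrow> Ck_on n k T f"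
proof (induction k arbitrary: f)
  case 0 then show ?case by (auto intro: continuous_map_from_subtopology_mono)
next
  case (Suc k)
  from Suc.prems(1) obtain D where D:
    "\<And>i x. i < n \<Longrightarrow> x \<in> S \<Longrightarrow> ((\<lambda>t. f (x(i := t))) has_real_derivative D i x) (at (x i))"
    "\<And>i. i < n \<Longrightarrow> Ck_on n k S (D i)"
    by (rule Ck_on_SucE) blast
  show ?case
  proof (rule Ck_on_SucI[where D = D])
    show "continuous_map (subtopology (Euclidean_space n) T) euclideanreal f"
      using continuous_map_from_subtopology_mono[OF Ck_on_imp_continuous_map[OF Suc.prems(1)]] Suc.prems(2) .
    show "Ck_on n k T (D i)" if "i < n" for i
      by (rule Suc.IH[OF D(2)[OF that] Suc.prems(2)])
    show "((\<lambda>t. f (x(i := t))) has_real_derivative D i x) (at (x i))" if "i < n" "x \<in> T" for i x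
      using D(1) that Suc.prems(2) by blast
  qed
qed

lemma continuous_on_local:
  assumes S: "openin (Euclidean_space n) S"
    and loc: "\<And>x. x \<in> S \<Longrightarrow> \<exists>T. openin (Euclidean_space n) T \<and> x \<in> T \<and> continuous_on T f"
  shows "continuous_on S f"
  unfolding continuous_on_topological
proof (intro ballI allI impI, goal_cases)
  case (1 x B)
  obtain T where T: "openin (Euclidean_space n) T" "x \<in> T" "continuous_on T f"
    using loc 1(1) by blast
  obtain A where A: "open A" "x \<in> A" "\<forall>y\<in>T. y \<in> A \<longrightarrow> f y \<in> B"
    using 1 T unfolding continuous_on_topological by meson
  obtain T' where T': "open T'" "T = coord_space n \<inter> T'"
    using T(1) unfolding Euclidean_space_top_of_set openin_open by blast
  have "open (A \<inter> T')" "x \<in> A \<inter> T'"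
    using A T' T(2) by auto
  moreover have "\<forall>y\<in>S. y \<in> A \<inter> T' \<longrightarrow> f y \<in> B"
    using A(3) T'(2) open_Euclidean_subset[OF S] by blast
  ultimately show ?case by blast
qed

lemma Ck_on_local:
  assumes S: "openin (Euclidean_space n) S"
    and "\<And>x. x \<in> S \<Longrightarrow> \<exists>T. openin (Euclidean_space n) T \<and> x \<in> T \<and> Ck_on n k T f"
  shows "Ck_on n k S f"
  using assms(2)
proof (induction k arbitrary: f)
  case 0
  have "continuous_on S f"
  proof (rule continuous_on_local[OF S])
    fix x assume "x \<in> S"
    then obtain T where T: "openin (Euclidean_space n) T" "x \<in> T" "Ck_on n 0 T f"
      using 0 by blast
    then show "\<exists>T. openin (Euclidean_space n) T \<and> x \<in> T \<and> continuous_on T f"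
      using Ck_on_0_iff[OF open_Euclidean_subset[OF T(1)]] by blast
  qed
  then show ?case using Ck_on_0_iff[OF open_Euclidean_subset[OF S]] by blast
next
  case (Suc k)
  have ex: "\<exists>T. openin (Euclidean_space n) T \<and> x \<in> T \<and> continuous_on T f \<and>
      (\<forall>i<n. (\<forall>x\<in>T. ((\<lambda>t. f (x(i := t))) has_real_derivative partial_deriv i f x) (at (x i))) \<and>
      Ck_on n k T (partial_deriv i f))" if x: "x \<in> S" for x
  proof -
    obtain T where T: "openin (Euclidean_space n) T" "x \<in> T" "Ck_on n (Suc k) T f"
      using Suc.prems[OF x] by blast
    then show ?thesis using Ck_on_Suc_iff[OF T(1)] by blast
  qed
  have "continuous_on S f"
    by (rule continuous_on_local[OF S]) (use ex in blast)
  moreover have "((\<lambda>t. f (x(i := t))) has_real_derivative partial_deriv i f x) (at (x i))"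
    if "i < n" "x \<in> S" for i x
    using ex[OF that(2)] that(1) by blast
  moreover have "Ck_on n k S (partial_deriv i f)" if "i < n" for i
    by (rule Suc.IH) (use ex that in blast)
  ultimately show ?case using Ck_on_Suc_iff[OF S] by blast
qed

lemma smooth_onI: "(\<And>k. Ck_on n k S f) \<Longrightarrow> smooth_on n S f"
  by (simp add: smooth_on_def)

lemma smooth_onD: "smooth_on n S f \<Longrightarrow> Ck_on n k S f"
  by (simp add: smooth_on_def)

lemma smooth_on_const: "smooth_on n S (\<lambda>x. c)"
  and smooth_on_coord: "smooth_on n S (\<lambda>x. x j)"
  by (simp_all add: smooth_on_def Ck_on_const Ck_on_coord)

lemma smooth_on_add: "smooth_on n S f \<Longrightarrow> smooth_on n S g \<Longrightarrow> smooth_on n S (\<lambda>x. f x + g x)"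
  and smooth_on_mult: "smooth_on n S f \<Longrightarrow> smooth_on n S g \<Longrightarrow> smooth_on n S (\<lambda>x. f x * g x)"
  by (simp_all add: smooth_on_def Ck_on_add Ck_on_mult)

lemma smooth_on_diff: "smooth_on n S f \<Longrightarrow> smooth_on n S g \<Longrightarrow> smooth_on n S (\<lambda>x. f x - g x)"
  using smooth_on_add[OF _ smooth_on_mult[OF smooth_on_const[of n S "-1"]], of f g] by simp

lemma smooth_on_power: "smooth_on n S f \<Longrightarrow> smooth_on n S (\<lambda>x. f x ^ k)"
  by (induction k) (simp_all add: smooth_on_const smooth_on_mult)

lemma smooth_on_sum: "(\<And>i. i \<in> I \<Longrightarrow> smooth_on n S (f i)) \<Longrightarrow> smooth_on n S (\<lambda>x. \<Sum>i\<in>I. f i x)"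
  by (simp add: smooth_on_def Ck_on_sum)

lemma smooth_on_subset: "smooth_on n S f \<Longrightarrow> T \<subseteq> S \<Longrightarrow> smooth_on n T f"
  unfolding smooth_on_def using Ck_on_subset by blast

lemma smooth_on_cong:
  "openin (Euclidean_space n) S \<Longrightarrow> (\<And>x. x \<in> S \<Longrightarrow> f x = g x) \<Longrightarrow> smooth_on n S f \<Longrightarrow> smooth_on n S g"
  unfolding smooth_on_def using Ck_on_cong by blast

lemma smooth_on_Un:
  assumes "openin (Euclidean_space n) S" "openin (Euclidean_space n) T" "smooth_on n S f" "smooth_on n T f"
  shows "smooth_on n (S \<union> T) f"
proof (rule smooth_onI, rule Ck_on_local)
  show "\<exists>V. openin (Euclidean_space n) V \<and> x \<in> V \<and> Ck_on n k V f" if "x \<in> S \<union> T" for k x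
    using that assms unfolding smooth_on_def by blast
qed (use assms in blast)

lemma smooth_on_imp_continuous_on:
  "openin (Euclidean_space n) S \<Longrightarrow> smooth_on n S f \<Longrightarrow> continuous_on S f"
  using Ck_on_0_iff[OF open_Euclidean_subset] smooth_onD by blast

lemma smooth_on_partial_deriv:
  assumes "openin (Euclidean_space n) S" "smooth_on n S f" "i < n"
  shows "smooth_on n S (partial_deriv i f)"
  using smooth_onD[OF assms(2), of "Suc _"] assms(3)
  unfolding Ck_on_Suc_iff[OF assms(1)] smooth_on_def by blast

lemma smooth_on_higher_partial_deriv:
  assumes "openin (Euclidean_space n) S" "smooth_on n S f" "i < n"
  shows "smooth_on n S ((partial_deriv i ^^ j) f)"
  by (induction j) (simp_all add: assms smooth_on_partial_deriv)

lemma smooth_on_has_partial_deriv: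
  assumes "openin (Euclidean_space n) S" "smooth_on n S f" "i < n" "x \<in> S"
  shows "((\<lambda>t. f (x(i := t))) has_real_derivative partial_deriv i f x) (at (x i))"
  using smooth_onD[OF assms(2), of "Suc 0"] assms(3,4) unfolding Ck_on_Suc_iff[OF assms(1)] by blast

text \<open>The sequence \<open>\<eta>\<close> consists of the iterated derivatives of a smooth function of one variable.\<close>

lemma smooth_on_real_compose:
  fixes \<eta> :: "nat \<Rightarrow> real \<Rightarrow> real"
  assumes \<eta>: "\<And>m t. t \<in> I \<Longrightarrow> (\<eta> m has_real_derivative \<eta> (Suc m) t) (at t)"
    and f: "smooth_on n S f" "f ` S \<subseteq> I" and S: "openin (Euclidean_space n) S"
  shows "smooth_on n S (\<lambda>x. \<eta> m (f x))"
proof -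
  have cont: "continuous_on S (\<lambda>x. \<eta> m (f x))" for m
  proof (rule continuous_on_compose2[of "f ` S" "\<eta> m" S f])
    show "continuous_on (f ` S) (\<eta> m)"
      using \<eta> f(2) by (intro DERIV_atLeastAtMost_imp_continuous_on continuous_at_imp_continuous_on)
        (blast dest: DERIV_isCont)
  qed (use smooth_on_imp_continuous_on[OF S f(1)] in auto)
  have "Ck_on n k S (\<lambda>x. \<eta> m (f x))" for k m
  proof (induction k arbitrary: m)
    case 0
    show ?case using cont Ck_on_0_iff[OF open_Euclidean_subset[OF S]] by blast
  next
    case (Suc k)
    show ?case
    proof (rule Ck_on_SucI[where D = "\<lambda>i x. \<eta> (Suc m) (f x) * partial_deriv i f x"])
      show "continuous_map (subtopology (Euclidean_space n) S) euclideanreal (\<lambda>x. \<eta> m (f x))"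
        using Suc.IH Ck_on_imp_continuous_map by blast
      show "((\<lambda>t. \<eta> m (f (x(i := t)))) has_real_derivative \<eta> (Suc m) (f x) * partial_deriv i f x) (at (x i))"
        if "i < n" "x \<in> S" for i x
        using DERIV_chain2[of "\<eta> m" "\<eta> (Suc m) (f x)" "\<lambda>t. f (x(i := t))" "x i"] that f(2)
          smooth_on_has_partial_deriv[OF S f(1) that] \<eta>[of "f x"] by fastforce
      show "Ck_on n k S (\<lambda>x. \<eta> (Suc m) (f x) * partial_deriv i f x)" if "i < n" for i
        by (intro Ck_on_mult Suc.IH smooth_onD smooth_on_partial_deriv S f(1) that)
    qed
  qed
  then show ?thesis by (rule smooth_onI)
qed

lemma continuous_on_cube_nhd:
  assumes S: "openin (Euclidean_space n) S" and h: "continuous_on S h" and a: "a \<in> S" and e: "e > (0::real)"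
  shows "\<exists>\<rho>>0. cube n a \<rho> \<subseteq> S \<and> (\<forall>z\<in>cube n a \<rho>. \<bar>h z - h a\<bar> < e)"
proof -
  have "openin (top_of_set S) (S \<inter> h -` {h a - e <..< h a + e})"
    using h continuous_on_open_gen[of h S UNIV] by (simp add: continuous_on_open_invariant continuous_openin_preimage_gen)
  moreover have "openin (top_of_set (coord_space n)) S"
    using S by (simp add: Euclidean_space_top_of_set)
  ultimately have "openin (Euclidean_space n) (S \<inter> h -` {h a - e <..< h a + e})"
    unfolding Euclidean_space_top_of_set using openin_trans by blast
  moreover have "a \<in> S \<inter> h -` {h a - e <..< h a + e}"
    using a e by simp
  ultimately obtain \<rho> where \<rho>: "\<rho> > 0" "cube n a \<rho> \<subseteq> S \<inter> h -` {h a - e <..< h a + e}"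
    using openin_contains_cube by blast
  have "\<bar>h z - h a\<bar> < e" if "z \<in> cube n a \<rho>" for z
  proof -
    have "h z \<in> {h a - e <..< h a + e}" using \<rho>(2) that by blast
    then show ?thesis by auto
  qed
  then show ?thesis using \<rho> by blast
qed

text \<open>
  Only the partial derivatives of \<open>F\<close> are known to exist, so the increment of \<open>F\<close> along the curve is
  split into increments in one coordinate each. The mean value theorem expresses each of them by a
  partial derivative at an intermediate point, which converges by continuity.
\<close>

lemma chain_rule_curve:
  fixes c :: "real \<Rightarrow> nat \<Rightarrow> real"
  assumes S: "openin (Euclidean_space n) S" and F: "smooth_on n S F"
    and c0: "c t0 \<in> S" and c: "\<And>i. i < n \<Longrightarrow> ((\<lambda>t. c t i) has_real_derivative c' i) (at t0)"
    and cn: "\<forall>\<^sub>F t in nhds t0. c t \<in> coord_space n"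
  shows "((\<lambda>t. F (c t)) has_real_derivative (\<Sum>i<n. partial_deriv i F (c t0) * c' i)) (at t0)"
proof -
  define cm where "cm m t = (\<lambda>i. if i < m then c t i else c t0 i)" for m t
  have c0n: "c t0 \<in> coord_space n" using c0 open_Euclidean_subset[OF S] by blast
  obtain r where r: "r > 0" "cube n (c t0) r \<subseteq> S"
    using openin_contains_cube[OF S c0] by blast
  have near: "\<forall>\<^sub>F t in at t0. \<bar>c t i - c t0 i\<bar> < e" if "i < n" "e > 0" for i e
  proof -
    have "((\<lambda>t. c t i) \<longlongrightarrow> c t0 i) (at t0)"
      using DERIV_isCont[OF c[OF that(1)]] isCont_def by blast
    then show ?thesis using tendstoD that(2) by (fastforce simp: dist_real_def)
  qed
  have near_all: "\<forall>\<^sub>F t in at t0. \<forall>i\<in>{..<n}. \<bar>c t i - c t0 i\<bar> < e" if "e > 0" for e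
    by (rule eventually_ball_finite) (use near that in auto)
  have step: "((\<lambda>t. F (cm (Suc m) t) - F (cm m t)) has_real_derivative partial_deriv m F (c t0) * c' m) (at t0)"
    if m: "m < n" for m
  proof -
    have cm1: "cm (Suc m) t = (cm m t)(m := c t m)" and cm0: "cm m t = (cm m t)(m := c t0 m)" for t
      by (auto simp: cm_def fun_eq_iff)
    have line: "(cm m t)(m := u) \<in> cube n (c t0) e"
      if "\<forall>i\<in>{..<n}. \<bar>c t i - c t0 i\<bar> < e" "\<bar>u - c t0 m\<bar> \<le> \<bar>c t m - c t0 m\<bar>" for t u e
    proof -
      have "\<bar>c t m - c t0 m\<bar> < e" using that(1) m by blast
      then have "0 < e" "\<bar>u - c t0 m\<bar> < e" using that(2) by linarith+
      then have "\<bar>((cm m t)(m := u)) i - c t0 i\<bar> < e" if "i < n" for i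
        using \<open>\<forall>i\<in>{..<n}. \<bar>c t i - c t0 i\<bar> < e\<close> that by (simp add: cm_def)
      moreover have "((cm m t)(m := u)) i = 0" if "i \<ge> n" for i
        using that m c0n by (simp add: cm_def)
      ultimately show ?thesis unfolding cube_def by blast
    qed
    have der: "((\<lambda>u. F ((cm m t)(m := u))) has_real_derivative partial_deriv m F ((cm m t)(m := u))) (at u)"
      if "\<forall>i\<in>{..<n}. \<bar>c t i - c t0 i\<bar> < r" "\<bar>u - c t0 m\<bar> \<le> \<bar>c t m - c t0 m\<bar>" for t u
    proof -
      have "(cm m t)(m := u) \<in> S" using line[OF that] r(2) by blast
      from smooth_on_has_partial_deriv[OF S F m this] show ?thesis by simp
    qed
    define Q where "Q t u \<longleftrightarrow> ((\<forall>i\<in>{..<n}. \<bar>c t i - c t0 i\<bar> < r) \<longrightarrow> \<bar>u - c t0 m\<bar> \<le> \<bar>c t m - c t0 m\<bar> \<and>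
        F (cm (Suc m) t) - F (cm m t) = (c t m - c t0 m) * partial_deriv m F ((cm m t)(m := u)))" for t u
    have "\<exists>u. (\<forall>i\<in>{..<n}. \<bar>c t i - c t0 i\<bar> < r) \<longrightarrow> \<bar>u - c t0 m\<bar> \<le> \<bar>c t m - c t0 m\<bar> \<and>
        F (cm (Suc m) t) - F (cm m t) = (c t m - c t0 m) * partial_deriv m F ((cm m t)(m := u))" for t
    proof (cases "\<forall>i\<in>{..<n}. \<bar>c t i - c t0 i\<bar> < r")
      case True
      consider "c t m = c t0 m" | "c t0 m < c t m" | "c t m < c t0 m" by linarith
      then show ?thesis
      proof cases
        case 1
        then have "cm (Suc m) t = cm m t" using cm1[of t] cm0[of t] by simp
        then show ?thesis using 1 by (intro exI[of _ "c t0 m"]) simp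
      next
        case 2
        have "((\<lambda>u. F ((cm m t)(m := u))) has_real_derivative partial_deriv m F ((cm m t)(m := x))) (at x)"
          if "c t0 m \<le> x" "x \<le> c t m" for x
          by (rule der[OF True]) (use that in linarith)
        from MVT2[OF 2 this] obtain z where "c t0 m < z" "z < c t m"
          "F ((cm m t)(m := c t m)) - F ((cm m t)(m := c t0 m)) = (c t m - c t0 m) * partial_deriv m F ((cm m t)(m := z))"
          by blast
        then have "\<bar>z - c t0 m\<bar> \<le> \<bar>c t m - c t0 m\<bar> \<and>
            F (cm (Suc m) t) - F (cm m t) = (c t m - c t0 m) * partial_deriv m F ((cm m t)(m := z))"
          unfolding cm1[symmetric] cm0[symmetric] by linarith
        then show ?thesis by blast
      next
        case 3
        have "((\<lambda>u. F ((cm m t)(m := u))) has_real_derivative partial_deriv m F ((cm m t)(m := x))) (at x)"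
          if "c t m \<le> x" "x \<le> c t0 m" for x
          by (rule der[OF True]) (use that in linarith)
        from MVT2[OF 3 this] obtain z where "c t m < z" "z < c t0 m"
          "F ((cm m t)(m := c t0 m)) - F ((cm m t)(m := c t m)) = (c t0 m - c t m) * partial_deriv m F ((cm m t)(m := z))"
          by blast
        then have "\<bar>z - c t0 m\<bar> \<le> \<bar>c t m - c t0 m\<bar> \<and>
            F (cm (Suc m) t) - F (cm m t) = (c t m - c t0 m) * partial_deriv m F ((cm m t)(m := z))"
          unfolding cm1[symmetric] cm0[symmetric] by (simp add: algebra_simps)
        then show ?thesis by blast
      qed
    qed blast
    then have "\<exists>u. Q t u" for t unfolding Q_def .
    then obtain u where "\<And>t. Q t (u t)" by metis
    then have u: "\<bar>u t - c t0 m\<bar> \<le> \<bar>c t m - c t0 m\<bar> \<and>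
        F (cm (Suc m) t) - F (cm m t) = (c t m - c t0 m) * partial_deriv m F ((cm m t)(m := u t))"
      if "\<forall>i\<in>{..<n}. \<bar>c t i - c t0 i\<bar> < r" for t
      using that unfolding Q_def by blast
    have lim: "((\<lambda>t. partial_deriv m F ((cm m t)(m := u t))) \<longlongrightarrow> partial_deriv m F (c t0)) (at t0)"
    proof (rule tendstoI)
      fix e :: real assume e: "e > 0"
      obtain \<rho> where \<rho>: "\<rho> > 0" "\<forall>z\<in>cube n (c t0) \<rho>. \<bar>partial_deriv m F z - partial_deriv m F (c t0)\<bar> < e"
        using continuous_on_cube_nhd[OF S smooth_on_imp_continuous_on[OF S smooth_on_partial_deriv[OF S F m]] c0 e]
        by blast
      from near_all[OF r(1)] near_all[OF \<rho>(1)]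
      show "\<forall>\<^sub>F t in at t0. dist (partial_deriv m F ((cm m t)(m := u t))) (partial_deriv m F (c t0)) < e"
      proof eventually_elim
        case (elim t)
        show ?case unfolding dist_real_def
          by (rule bspec[OF \<rho>(2) line[OF elim(2)]]) (use u[OF elim(1)] in simp)
      qed
    qed
    have "((\<lambda>t. (c t m - c t0 m) / (t - t0)) \<longlongrightarrow> c' m) (at t0)"
      using c[OF m] by (simp add: has_field_derivative_iff)
    from tendsto_mult[OF lim this]
    have "((\<lambda>t. ((F (cm (Suc m) t) - F (cm m t)) - (F (cm (Suc m) t0) - F (cm m t0))) / (t - t0))
        \<longlongrightarrow> partial_deriv m F (c t0) * c' m) (at t0)"
    proof (rule Lim_transform_eventually)
      from near_all[OF r(1)]
      show "\<forall>\<^sub>F t in at t0. partial_deriv m F ((cm m t)(m := u t)) * ((c t m - c t0 m) / (t - t0)) =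
        (F (cm (Suc m) t) - F (cm m t) - (F (cm (Suc m) t0) - F (cm m t0))) / (t - t0)"
      proof eventually_elim
        case (elim t)
        have "cm (Suc m) t0 = cm m t0" by (auto simp: cm_def)
        then show ?case using u[OF elim] by simp
      qed
    qed
    then show ?thesis by (simp add: has_field_derivative_iff)
  qed
  have "((\<lambda>t. F (cm m t)) has_real_derivative (\<Sum>i<m. partial_deriv i F (c t0) * c' i)) (at t0)"
    if "m \<le> n" for m
    using that
  proof (induction m)
    case 0
    have "cm 0 = (\<lambda>t. c t0)" by (auto simp: cm_def)
    then show ?case by simp
  next
    case (Suc m)
    have "((\<lambda>t. F (cm m t) + (F (cm (Suc m) t) - F (cm m t))) has_real_derivative
        (\<Sum>i<m. partial_deriv i F (c t0) * c' i) + partial_deriv m F (c t0) * c' m) (at t0)"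
      by (rule DERIV_add[OF Suc.IH step]) (use Suc.prems in auto)
    then show ?case by simp
  qed
  then have der: "((\<lambda>t. F (cm n t)) has_real_derivative (\<Sum>i<n. partial_deriv i F (c t0) * c' i)) (at t0)"
    by blast
  have "\<forall>\<^sub>F t in nhds t0. F (cm n t) = F (c t)"
    using cn
  proof eventually_elim
    case (elim t)
    have "cm n t = c t" using elim c0n by (auto simp: cm_def fun_eq_iff)
    then show ?case by simp
  qed
  from DERIV_cong_ev[OF refl this refl] der show ?thesis by blast
qed

text \<open>
  By the chain rule a partial derivative of \<open>F \<circ> G\<close> is a sum of products of functions \<open>F' \<circ> G\<close> with
  smooth functions, where \<open>F'\<close> is a derivative of \<open>F\<close>; so the order of differentiability grows by
  induction for all \<open>F\<close> at once.
\<close>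

lemma smooth_on_compose:
  fixes G :: "(nat \<Rightarrow> real) \<Rightarrow> nat \<Rightarrow> real"
  assumes S: "openin (Euclidean_space n) S" and T: "openin (Euclidean_space n) T"
    and G: "\<And>i. i < n \<Longrightarrow> smooth_on n T (\<lambda>y. G y i)" "G ` T \<subseteq> S"
    and F: "smooth_on n S F"
  shows "smooth_on n T (\<lambda>y. F (G y))"
proof -
  have Gn: "G y \<in> coord_space n" if "y \<in> T" for y
    using that G(2) open_Euclidean_subset[OF S] by blast
  have "continuous_on T (\<lambda>y. G y i)" for i
  proof (cases "i < n")
    case False
    then have "continuous_on T (\<lambda>y. G y i) \<longleftrightarrow> continuous_on T (\<lambda>y. 0::real)"
      using Gn by (intro continuous_on_cong) auto
    then show ?thesis by simp
  qed (use G(1) smooth_on_imp_continuous_on[OF T] in blast)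
  then have contG: "continuous_on T G"
    by (rule continuous_on_coordinatewise_then_product)
  have "Ck_on n k T (\<lambda>y. F (G y))" for k
    using F
  proof (induction k arbitrary: F)
    case 0
    have "continuous_on T (\<lambda>y. F (G y))"
      by (rule continuous_on_compose2[OF smooth_on_imp_continuous_on[OF S 0] contG G(2)])
    then show ?case using Ck_on_0_iff[OF open_Euclidean_subset[OF T]] by blast
  next
    case (Suc k)
    show ?case
    proof (rule Ck_on_SucI[where D = "\<lambda>i y. \<Sum>j<n. partial_deriv j F (G y) * partial_deriv i (\<lambda>y. G y j) y"])
      show "continuous_map (subtopology (Euclidean_space n) T) euclideanreal (\<lambda>y. F (G y))"
        by (rule Ck_on_imp_continuous_map[OF Suc.IH[OF Suc.prems]])
      show "Ck_on n k T (\<lambda>y. \<Sum>j<n. partial_deriv j F (G y) * partial_deriv i (\<lambda>y. G y j) y)" if "i < n" for i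
        using that by (intro Ck_on_sum Ck_on_mult Suc.IH smooth_on_partial_deriv[OF S] Suc.prems
            smooth_onD[OF smooth_on_partial_deriv[OF T]] G(1)) auto
      show "((\<lambda>t. F (G (y(i := t)))) has_real_derivative
          (\<Sum>j<n. partial_deriv j F (G y) * partial_deriv i (\<lambda>y. G y j) y)) (at (y i))" if "i < n" "y \<in> T" for i y
        using chain_rule_curve[OF S Suc.prems, of "\<lambda>t. G (y(i := t))" "y i" "\<lambda>j. partial_deriv i (\<lambda>y. G y j) y"]
          smooth_on_has_partial_deriv[OF T G(1) that] G(2) that(2)
          eventually_mono[OF open_line[OF T that(2,1)] Gn]
        by (auto simp: image_subset_iff)
    qed
  qed
  then show ?thesis by (rule smooth_onI)
qed

text \<open>
  Differentiation under the integral sign produces an integral of the same form, with a partial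
  derivative of \<open>F\<close> and the weight \<open>w s\<close> or \<open>s w s\<close>. For this reason the statement allows an arbitrary weight.
\<close>

lemma smooth_on_integral:
  fixes F :: "(nat \<Rightarrow> real) \<Rightarrow> real"
  assumes i: "i < n" and F: "smooth_on n (cube n a r) F" and w: "continuous_on {0..1} w"
  shows "smooth_on n (cube n a r)
    (\<lambda>y. integral {0..1} (\<lambda>s. w s * F (y(i := a i + s * (y i - a i)))))"
proof -
  let ?B = "cube n a r"
  define h where "h s y = y(i := a i + s * (y i - a i))" for s :: real and y :: "nat \<Rightarrow> real"
  have B: "openin (Euclidean_space n) ?B" by (rule openin_cube)
  have h_cube: "h s y \<in> ?B" if "y \<in> ?B" "s \<in> {0..1}" for s y
  proof -
    have "\<bar>s * (y i - a i)\<bar> \<le> 1 * \<bar>y i - a i\<bar>"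
      unfolding abs_mult using that(2) by (intro mult_right_mono) auto
    also have "\<dots> < r" using that(1) i by (simp add: cube_def)
    finally show ?thesis
      using that(1) i by (simp add: cube_def h_def)
  qed
  have h_cont: "continuous_on X (\<lambda>(y, s). h s y)" for X
  proof -
    have "continuous_on X (\<lambda>p. (h (snd p) (fst p)) j)" for j
    proof (cases "j = i")
      case True
      have "continuous_on X (\<lambda>p. a i + snd p * (fst p i - a i))"
        by (intro continuous_intros continuous_on_product_coordinates
            continuous_on_compose2[OF continuous_on_product_coordinates[of i] continuous_on_fst]) auto
      then show ?thesis using True by (simp add: h_def)
    next
      case False
      have "continuous_on X (\<lambda>p. (fst p) j)"
        by (intro continuous_on_compose2[OF continuous_on_product_coordinates[of j] continuous_on_fst]
            continuous_intros) auto
      then show ?thesis using False by (simp add: h_def)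
    qed
    then show ?thesis
      unfolding case_prod_beta by (rule continuous_on_coordinatewise_then_product)
  qed
  have joint: "continuous_on (?B \<times> {0..1}) (\<lambda>(y, s). w s * F (h s y))"
    if F: "smooth_on n ?B F" and w: "continuous_on {0..1} w" for F w
  proof -
    have 1: "continuous_on (?B \<times> {0..1}) (\<lambda>p. F ((\<lambda>(y, s). h s y) p))"
      by (rule continuous_on_compose2[OF smooth_on_imp_continuous_on[OF B F] h_cont])
        (use h_cube in auto)
    have 2: "continuous_on (?B \<times> {0..1}) (\<lambda>p. w (snd p))"
      by (rule continuous_on_compose2[OF w continuous_on_snd]) (auto intro: continuous_intros)
    show ?thesis
      using continuous_on_mult[OF 2 1] by (simp add: case_prod_beta)
  qed
  have "Ck_on n k ?B (\<lambda>y. integral {0..1} (\<lambda>s. w s * F (h s y)))" for k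
    using F w
  proof (induction k arbitrary: F w)
    case 0
    have "continuous_on ?B (\<lambda>y. integral (cbox 0 1) (\<lambda>s. w s * F (h s y)))"
      by (rule integral_continuous_on_param) (use joint[OF 0] in \<open>simp add: cbox_interval\<close>)
    then show ?case using Ck_on_0_iff[OF cube_subset] by (simp add: cbox_interval)
  next
    case (Suc k)
    define e where "e j s = (if j = i then s else 1)" for j :: nat and s :: real
    have w': "continuous_on {0..1} (\<lambda>s. w s * e j s)" for j
      unfolding e_def using Suc.prems(2) by (cases "j = i") (auto intro!: continuous_intros)
    show ?case
    proof (rule Ck_on_SucI[where D = "\<lambda>j y. integral {0..1} (\<lambda>s. (w s * e j s) * partial_deriv j F (h s y))"])
      show "continuous_map (subtopology (Euclidean_space n) ?B) euclideanreal (\<lambda>y. integral {0..1} (\<lambda>s. w s * F (h s y)))"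
        by (rule Ck_on_imp_continuous_map[OF Suc.IH[OF Suc.prems]])
      show "Ck_on n k ?B (\<lambda>y. integral {0..1} (\<lambda>s. (w s * e j s) * partial_deriv j F (h s y)))" if "j < n" for j
        by (rule Suc.IH[OF smooth_on_partial_deriv[OF B Suc.prems(1) that] w'])
      fix j y assume j: "j < n" and y: "y \<in> ?B"
      let ?U = "{a j - r <..< a j + r}"
      have yj: "y j \<in> ?U"
      proof -
        have "\<bar>y j - a j\<bar> < r" using y j by (simp add: cube_def)
        then show ?thesis by auto
      qed
      have yt: "y(j := t) \<in> ?B" if "t \<in> ?U" for t
      proof -
        have "\<bar>t - a j\<bar> < r" using that by auto
        then show ?thesis using y j by (simp add: cube_def)
      qed
      have line_cont: "continuous_on (?U \<times> {0..1}) (\<lambda>(t, s). v s * H (h s (y(j := t))))"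
        if "smooth_on n ?B H" "continuous_on {0..1} v" for v H
      proof -
        have "continuous_on (?U \<times> {0..1}) (\<lambda>p. (y(j := fst p), snd p))"
        proof (intro continuous_on_Pair continuous_on_coordinatewise_then_product continuous_on_snd continuous_on_id)
          show "continuous_on (?U \<times> {0..1}) (\<lambda>p. (y(j := fst p)) l)" for l
            by (cases "l = j") (auto intro: continuous_intros)
        qed
        moreover have "(\<lambda>p. (y(j := fst p), snd p)) ` (?U \<times> {0..1}) \<subseteq> ?B \<times> {0..1}"
          using yt by (intro image_subsetI) (simp add: mem_Times_iff)
        ultimately have "continuous_on (?U \<times> {0..1})
            (\<lambda>p. (\<lambda>(y, s). v s * H (h s y)) (y(j := fst p), snd p))"
          by (rule continuous_on_compose2[OF joint[OF that]])
        then show ?thesis by (simp add: case_prod_beta)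
      qed
      have der: "((\<lambda>t. w s * F (h s (y(j := t)))) has_real_derivative (w s * e j s) * partial_deriv j F (h s (y(j := t)))) (at t within ?U)"
        if "t \<in> ?U" "s \<in> cbox 0 1" for t s
      proof -
        have s: "s \<in> {0..1}" using that(2) by (simp add: cbox_interval)
        define z where "z = h s (y(j := t))"
        have z: "z \<in> ?B" unfolding z_def by (rule h_cube[OF yt[OF that(1)] s])
        have dz: "((\<lambda>u. F (z(j := u))) has_real_derivative partial_deriv j F z) (at (z j))"
          by (rule smooth_on_has_partial_deriv[OF B Suc.prems(1) j z])
        have line: "h s (y(j := u)) = z(j := (if j = i then a i + s * (u - a i) else u))" for u
          by (auto simp: z_def h_def fun_eq_iff)
        have zj: "z j = (if j = i then a i + s * (t - a i) else t)"
          by (auto simp: z_def h_def)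
        have "((\<lambda>u. if j = i then a i + s * (u - a i) else u) has_real_derivative e j s) (at t)"
          by (cases "j = i") (auto simp: e_def intro!: derivative_eq_intros)
        from DERIV_chain2[OF dz[unfolded zj] this]
        have "((\<lambda>u. F (h s (y(j := u)))) has_real_derivative partial_deriv j F z * e j s) (at t)"
          unfolding line .
        from DERIV_cmult[OF this, of "w s"]
        have "((\<lambda>u. w s * F (h s (y(j := u)))) has_real_derivative (w s * e j s) * partial_deriv j F z) (at t)"
          by (simp add: mult_ac)
        then show ?thesis
          unfolding z_def by (rule has_field_derivative_at_within)
      qed
      have "((\<lambda>t. integral (cbox 0 1) (\<lambda>s. w s * F (h s (y(j := t))))) has_real_derivative
          integral (cbox 0 1) (\<lambda>s. (w s * e j s) * partial_deriv j F (h s (y(j := y j))))) (at (y j) within ?U)"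
      proof (rule leibniz_rule_field_derivative[OF der])
        show "(\<lambda>s. w s * F (h s (y(j := t)))) integrable_on cbox 0 1" if "t \<in> ?U" for t
        proof -
          have "continuous_on {0..1} (\<lambda>s. (\<lambda>(t, s). w s * F (h s (y(j := t)))) (t, s))"
            by (rule continuous_on_compose2[OF line_cont[OF Suc.prems]]) (use that in \<open>auto intro: continuous_intros\<close>)
          then show ?thesis by (simp add: cbox_interval integrable_continuous_real)
        qed
        show "continuous_on (?U \<times> cbox 0 1) (\<lambda>(t, s). w s * e j s * partial_deriv j F (h s (y(j := t))))"
          using line_cont[OF smooth_on_partial_deriv[OF B Suc.prems(1) j] w'] by (simp add: cbox_interval)
      qed (use yj in auto)
      then show "((\<lambda>t. integral {0..1} (\<lambda>s. w s * F (h s (y(j := t))))) has_real_derivative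
          integral {0..1} (\<lambda>s. (w s * e j s) * partial_deriv j F (h s y))) (at (y j))"
        using at_within_open[OF yj] by (simp add: cbox_interval)
    qed
  qed
  then show ?thesis unfolding h_def by (rule smooth_onI)
qed

text \<open>
  The integral form of the Taylor remainder is used because it is again a smooth function of the
  point; a mean value form would not be.
\<close>

lemma Taylor_in_coordinate:
  assumes i: "i < n" and F: "smooth_on n (cube n a r) F" and p: "p > 0"
  obtains R where "smooth_on n (cube n a r) R"
    "\<forall>y\<in>cube n a r. F y =
      (\<Sum>j<p. (y i - a i) ^ j / fact j * (partial_deriv i ^^ j) F (y(i := a i))) + (y i - a i) ^ p * R y"
proof -
  let ?B = "cube n a r"
  define w :: "real \<Rightarrow> real" where "w s = (1 - s) ^ (p - 1) / fact (p - 1)" for s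
  define G where "G j = (partial_deriv i ^^ j) F" for j
  have B: "openin (Euclidean_space n) ?B" by (rule openin_cube)
  have G: "smooth_on n ?B (G j)" for j
    unfolding G_def by (rule smooth_on_higher_partial_deriv[OF B F i])
  define R where "R y = integral {0..1} (\<lambda>s. w s * G p (y(i := a i + s * (y i - a i))))" for y
  have R: "smooth_on n ?B R"
    unfolding R_def w_def by (rule smooth_on_integral[OF i G]) (intro continuous_intros; simp)
  have "F y = (\<Sum>j<p. (y i - a i) ^ j / fact j * (partial_deriv i ^^ j) F (y(i := a i))) + (y i - a i) ^ p * R y"
    if y: "y \<in> ?B" for y
  proof -
    define c where "c s = y(i := a i + s * (y i - a i))" for s
    define Df where "Df j s = (y i - a i) ^ j * G j (c s)" for j s
    have c: "c s \<in> ?B" if "s \<in> {0..1}" for s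
    proof -
      have "\<bar>s * (y i - a i)\<bar> \<le> 1 * \<bar>y i - a i\<bar>"
        unfolding abs_mult using that by (intro mult_right_mono) auto
      also have "\<dots> < r" using y i by (simp add: cube_def)
      finally show ?thesis using y i by (simp add: cube_def c_def)
    qed
    have "(Df j has_vector_derivative Df (Suc j) s) (at s within {0..1})" if s: "0 \<le> s" "s \<le> 1" for j s
    proof -
      have "((\<lambda>u. G j ((c s)(i := u))) has_real_derivative partial_deriv i (G j) (c s)) (at (a i + s * (y i - a i)))"
        using smooth_on_has_partial_deriv[OF B G i c] s by (simp add: c_def)
      moreover have "((\<lambda>s. a i + s * (y i - a i)) has_real_derivative (y i - a i)) (at s)"
        by (auto intro!: derivative_eq_intros)
      ultimately have "((\<lambda>u. G j ((c s)(i := a i + u * (y i - a i)))) has_real_derivative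
          partial_deriv i (G j) (c s) * (y i - a i)) (at s)"
        by (rule DERIV_chain2)
      from DERIV_cmult[OF this, of "(y i - a i) ^ j"]
      have "(Df j has_real_derivative Df (Suc j) s) (at s)"
        by (simp add: Df_def[abs_def] c_def G_def mult_ac)
      then show ?thesis
        using has_field_derivative_at_within has_real_derivative_iff_has_vector_derivative by blast
    qed
    then have "Df 0 1 = (\<Sum>j<p. ((1 - 0) ^ j / fact j) *\<^sub>R Df j 0) +
        integral {0..1} (\<lambda>s. ((1 - s) ^ (p - 1) / fact (p - 1)) *\<^sub>R Df p s)"
      by (intro Taylor_integral[OF p refl]) auto
    also have "Df 0 1 = F y"
      by (simp add: Df_def G_def c_def)
    also have "(\<Sum>j<p. ((1 - 0) ^ j / fact j) *\<^sub>R Df j 0) =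
        (\<Sum>j<p. (y i - a i) ^ j / fact j * (partial_deriv i ^^ j) F (y(i := a i)))"
      by (simp add: Df_def G_def c_def)
    also have "integral {0..1} (\<lambda>s. ((1 - s) ^ (p - 1) / fact (p - 1)) *\<^sub>R Df p s) =
        integral {0..1} (\<lambda>s. (y i - a i) ^ p * (w s * G p (c s)))"
      by (simp add: Df_def w_def mult_ac)
    also have "\<dots> = (y i - a i) ^ p * R y"
      by (simp add: R_def c_def)
    finally show ?thesis .
  qed
  with R show thesis using that by blast
qed

section \<open>Cutoff functions\<close>

text \<open>
  Every derivative of \<open>exp (- 1 / t)\<close> is a polynomial in \<open>1 / t\<close> times the function itself, hence
  tends to \<open>0\<close> at the origin from the right.
\<close>

definition flat_fun :: "real poly \<Rightarrow> real \<Rightarrow> real" where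
  "flat_fun P t = (if t \<le> 0 then 0 else poly P (1 / t) * exp (- (1 / t)))"

lemma flat_fun_at_0: "(flat_fun P \<longlongrightarrow> 0) (at 0)"
proof -
  have "((\<lambda>u. poly P u * exp (- u)) \<longlongrightarrow> 0) at_top"
  proof -
    have "((\<lambda>u. \<Sum>i\<le>degree P. coeff P i * (u ^ i / exp u)) \<longlongrightarrow> (\<Sum>i\<le>degree P. coeff P i * 0)) at_top"
      by (intro tendsto_sum tendsto_mult tendsto_const tendsto_power_div_exp_0)
    then show ?thesis
      by (simp add: poly_altdef sum_distrib_right exp_minus divide_inverse mult.assoc)
  qed
  from filterlim_compose[OF this filterlim_inverse_at_top_right]
  have r: "((\<lambda>t. poly P (1 / t) * exp (- (1 / t))) \<longlongrightarrow> 0) (at_right 0)"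
    by (simp add: inverse_eq_divide)
  have "(flat_fun P \<longlongrightarrow> 0) (at_right 0)"
    using r by (rule Lim_transform_eventually)
      (auto simp: flat_fun_def eventually_at_right_less intro: eventually_mono[OF eventually_at_right_less])
  moreover have "(flat_fun P \<longlongrightarrow> 0) (at_left 0)"
  proof (rule Lim_transform_eventually[OF tendsto_const])
    show "\<forall>\<^sub>F t in at_left 0. 0 = flat_fun P t"
      unfolding eventually_at_filter by (simp add: flat_fun_def)
  qed
  ultimately show ?thesis using filterlim_split_at by blast
qed

lemma flat_fun_deriv:
  "(flat_fun P has_real_derivative flat_fun ([:0, 0, 1:] * (P - pderiv P)) t) (at t)"
proof -
  consider "t < 0" | "t = 0" | "t > 0" by linarith
  then show ?thesis
  proof cases
    case 1
    have "((\<lambda>_. 0) has_real_derivative 0) (at t)" by simp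
    moreover have "\<forall>\<^sub>F s in nhds t. flat_fun P s = 0"
      using eventually_nhds_in_open[of "{..<0}" t] 1 by (auto simp: flat_fun_def elim: eventually_mono)
    ultimately have "(flat_fun P has_real_derivative 0) (at t)"
      using DERIV_cong_ev[of t t "flat_fun P" "\<lambda>_. 0"] by blast
    then show ?thesis using 1 by (simp add: flat_fun_def)
  next
    case 2
    have "((\<lambda>s. (flat_fun P s - flat_fun P 0) / (s - 0)) \<longlongrightarrow> 0) (at 0)"
    proof (rule Lim_transform_eventually[OF flat_fun_at_0[of "pCons 0 P"]])
      show "\<forall>\<^sub>F s in at 0. flat_fun (pCons 0 P) s = (flat_fun P s - flat_fun P 0) / (s - 0)"
        unfolding eventually_at_filter by (auto simp: flat_fun_def)
    qed
    then show ?thesis using 2 by (simp add: has_field_derivative_iff flat_fun_def)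
  next
    case 3
    have "((\<lambda>s. poly P (1 / s) * exp (- (1 / s))) has_real_derivative
        poly (pderiv P) (1 / t) * (- (1 / t\<^sup>2)) * exp (- (1 / t)) + poly P (1 / t) * (exp (- (1 / t)) * (1 / t\<^sup>2))) (at t)"
      using 3 by (auto intro!: derivative_eq_intros DERIV_chain2[OF poly_DERIV] simp: power2_eq_square)
    also have "poly (pderiv P) (1 / t) * (- (1 / t\<^sup>2)) * exp (- (1 / t)) + poly P (1 / t) * (exp (- (1 / t)) * (1 / t\<^sup>2))
        = flat_fun ([:0, 0, 1:] * (P - pderiv P)) t"
      using 3 by (simp add: flat_fun_def power2_eq_square algebra_simps)
    finally have d: "((\<lambda>s. poly P (1 / s) * exp (- (1 / s))) has_real_derivative
        flat_fun ([:0, 0, 1:] * (P - pderiv P)) t) (at t)" .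
    have "\<forall>\<^sub>F s in nhds t. poly P (1 / s) * exp (- (1 / s)) = flat_fun P s"
      using eventually_nhds_in_open[of "{0<..}" t] 3 by (auto simp: flat_fun_def elim: eventually_mono)
    from DERIV_cong_ev[OF refl this refl] d show ?thesis by blast
  qed
qed

text \<open>
  A cutoff of a smooth function \<open>q\<close>: with \<open>e t = exp (- 1 / t)\<close> for \<open>t > 0\<close> and \<open>e t = 0\<close> otherwise,
  it is \<open>e (b - q) / (e (b - q) + e (q - a))\<close>, whose denominator is positive since \<open>a < b\<close>.
\<close>

lemma smooth_cutoff:
  assumes S: "openin (Euclidean_space n) S" and q: "smooth_on n S q" and ab: "a < b"
  obtains h where "smooth_on n S (\<lambda>x. h (q x))" "\<And>t. 0 \<le> h t \<and> h t \<le> 1"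
    "\<And>t. t \<le> a \<Longrightarrow> h t = 1" "\<And>t. t \<ge> b \<Longrightarrow> h t = (0::real)"
proof
  define e where "e = flat_fun 1"
  \<comment> \<open>\<open>E\<close> and \<open>I\<close> are the sequences of derivatives of \<open>e\<close> and of the reciprocal.\<close>
  define E where "E m = flat_fun (((\<lambda>P. [:0, 0, 1:] * (P - pderiv P)) ^^ m) 1)" for m
  define I where "I m t = (-1) ^ m * fact m * inverse t ^ Suc m" for m and t :: real
  define h where "h t = e (b - t) * inverse (e (b - t) + e (t - a))" for t
  have E: "(E m has_real_derivative E (Suc m) t) (at t)" for m t
    unfolding E_def using flat_fun_deriv by simp
  have e_smooth: "smooth_on n S (\<lambda>x. e (p x))" if "smooth_on n S p" for p
    using smooth_on_real_compose[where I = UNIV and \<eta> = E and m = 0, OF E that _ S] by (simp add: E_def e_def)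
  have I: "(I m has_real_derivative I (Suc m) t) (at t)" if "t \<in> {0<..}" for m t
  proof -
    have "((\<lambda>t. inverse t ^ Suc m) has_real_derivative
        (1 + of_nat m) * (- (inverse t ^ Suc (Suc 0)) * inverse t ^ m)) (at t)"
      using that by (intro DERIV_power_Suc DERIV_inverse) simp
    from DERIV_cmult[OF this, of "(-1) ^ m * fact m"] show ?thesis
      unfolding I_def[abs_def] by (simp add: mult_ac)
  qed
  have e_pos: "e t > 0" if "t > 0" for t using that by (simp add: e_def flat_fun_def)
  have e_nonneg: "e t \<ge> 0" for t by (simp add: e_def flat_fun_def)
  have e_0: "e t = 0" if "t \<le> 0" for t using that by (simp add: e_def flat_fun_def)
  have den: "e (b - t) + e (t - a) > 0" for t
  proof (cases "t < b")
    case True then show ?thesis using e_pos[of "b - t"] e_nonneg[of "t - a"] by simp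
  next
    case False then show ?thesis using e_pos[of "t - a"] e_nonneg[of "b - t"] ab by simp
  qed
  have 1: "smooth_on n S (\<lambda>x. e (b - q x))" "smooth_on n S (\<lambda>x. e (q x - a))"
    by (intro e_smooth smooth_on_diff smooth_on_const q)+
  have "smooth_on n S (\<lambda>x. I 0 (e (b - q x) + e (q x - a)))"
    by (rule smooth_on_real_compose[where I = "{0<..}" and \<eta> = I, OF I smooth_on_add[OF 1] _ S]) (use den in auto)
  from smooth_on_mult[OF 1(1) this]
  show "smooth_on n S (\<lambda>x. h (q x))" by (simp add: h_def I_def)
  show "0 \<le> h t \<and> h t \<le> 1" for t
    using den[of t] e_nonneg[of "b - t"] e_nonneg[of "t - a"] by (simp add: h_def field_simps)
  show "h t = 1" if "t \<le> a" for t
    using that e_0[of "t - a"] den[of t] by (simp add: h_def)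
  show "h t = 0" if "t \<ge> b" for t
    using that e_0[of "b - t"] by (simp add: h_def)
qed

section \<open>Smooth functions on a manifold\<close>

lemma continuous_map_local:
  assumes "\<And>x. x \<in> topspace X \<Longrightarrow> \<exists>W. openin X W \<and> x \<in> W \<and> continuous_map (subtopology X W) Y f"
  shows "continuous_map X Y f"
proof (rule pasting_lemma[where I = "{W. openin X W \<and> continuous_map (subtopology X W) Y f}" and T = id and f = "\<lambda>_. f"])
  show "\<exists>j. j \<in> {W. openin X W \<and> continuous_map (subtopology X W) Y f} \<and> x \<in> id j \<and> f x = f x"
    if "x \<in> topspace X" for x
    using assms[OF that] by auto
qed auto

lemma compactin_closed_cube:
  "compactin (Euclidean_space n) {y \<in> coord_space n. \<forall>i<n. \<bar>y i - a i\<bar> \<le> \<delta>}" (is "compactin _ ?Q")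
proof -
  let ?I = "\<lambda>i. if i < n then {a i - \<delta>..a i + \<delta>} else {0}"
  have iff: "u \<in> {a i - \<delta>..a i + \<delta>} \<longleftrightarrow> \<bar>u - a i\<bar> \<le> \<delta>" for u i by auto
  have "?Q = (\<Pi>\<^sub>E i\<in>UNIV. ?I i)"
  proof (rule set_eqI)
    fix y
    have "y \<in> (\<Pi>\<^sub>E i\<in>UNIV. ?I i) \<longleftrightarrow> (\<forall>i. y i \<in> ?I i)" by (simp add: PiE_iff)
    also have "\<dots> \<longleftrightarrow> y \<in> ?Q"
      unfolding mem_Collect_eq iff[symmetric] by (metis (no_types, lifting) not_le singleton_iff)
    finally show "y \<in> ?Q \<longleftrightarrow> y \<in> (\<Pi>\<^sub>E i\<in>UNIV. ?I i)" by blast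
  qed
  moreover have "compactin (powertop_real UNIV) (\<Pi>\<^sub>E i\<in>UNIV. ?I i)"
    unfolding compactin_PiE by simp
  ultimately have "compactin (powertop_real UNIV) ?Q" by simp
  then show ?thesis
    unfolding Euclidean_space_def compactin_subtopology by blast
qed

locale smooth_mfd =
  fixes n :: nat and X :: "'p topology" and C :: "'p chart set"
  assumes mfd: "smooth_manifold n X C"
begin

lemma
  assumes "(U, \<phi>) \<in> C"
  shows openin_chart_domain: "openin X U"
    and openin_chart_image: "openin (Euclidean_space n) (\<phi> ` U)"
    and homeomorphic_chart:
      "homeomorphic_map (subtopology X U) (subtopology (Euclidean_space n) (\<phi> ` U)) \<phi>"
proof -
  have "is_chart n X (U, \<phi>)" using mfd assms unfolding smooth_manifold_def by blast
  then show "openin X U" "openin (Euclidean_space n) (\<phi> ` U)"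
    "homeomorphic_map (subtopology X U) (subtopology (Euclidean_space n) (\<phi> ` U)) \<phi>"
    by (simp_all add: is_chart_def)
qed

lemma chart_subset: "(U, \<phi>) \<in> C \<Longrightarrow> U \<subseteq> topspace X"
  using openin_chart_domain openin_subset by blast

lemma chart_coord_space: "(U, \<phi>) \<in> C \<Longrightarrow> p \<in> U \<Longrightarrow> \<phi> p \<in> coord_space n"
  using open_Euclidean_subset[OF openin_chart_image] by blast

lemma inj_on_chart:
  assumes "(U, \<phi>) \<in> C"
  shows "inj_on \<phi> U"
proof -
  have "topspace (subtopology X U) = U"
    using chart_subset[OF assms] by auto
  then show ?thesis
    using homeomorphic_imp_injective_map[OF homeomorphic_chart[OF assms]] by simp
qed

lemma chart_inverse: "(U, \<phi>) \<in> C \<Longrightarrow> p \<in> U \<Longrightarrow> inv_into U \<phi> (\<phi> p) = p"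
  using inj_on_chart by simp

lemma chart_exists:
  assumes "x \<in> topspace X"
  shows "\<exists>U \<phi>. (U, \<phi>) \<in> C \<and> x \<in> U"
proof -
  have "x \<in> \<Union> (fst ` C)" using mfd assms by (simp add: smooth_manifold_def)
  then obtain c where "c \<in> C" "x \<in> fst c" by blast
  then show ?thesis by (intro exI[of _ "fst c"] exI[of _ "snd c"]) simp
qed

lemma openin_chart_preimage:
  assumes c: "(U, \<phi>) \<in> C" and S: "openin (Euclidean_space n) S"
  shows "openin X {p \<in> U. \<phi> p \<in> S}"
proof -
  have "openin (subtopology (Euclidean_space n) (\<phi> ` U)) (S \<inter> \<phi> ` U)"
    using S openin_subtopology by blast
  from openin_continuous_map_preimage[OF homeomorphic_imp_continuous_map[OF homeomorphic_chart[OF c]] this]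
  have "openin (subtopology X U) {p \<in> topspace (subtopology X U). \<phi> p \<in> S \<inter> \<phi> ` U}" .
  also have "{p \<in> topspace (subtopology X U). \<phi> p \<in> S \<inter> \<phi> ` U} = {p \<in> U. \<phi> p \<in> S}"
    using chart_subset[OF c] by auto
  finally show ?thesis
    using openin_chart_domain[OF c] openin_open_subtopology by blast
qed

lemma openin_chart_image_Int:
  assumes c: "(U, \<phi>) \<in> C" and W: "openin X W"
  shows "openin (Euclidean_space n) (\<phi> ` (U \<inter> W))"
proof -
  have "openin (subtopology X U) (U \<inter> W)"
    using W openin_subtopology by blast
  then have "openin (subtopology (Euclidean_space n) (\<phi> ` U)) (\<phi> ` (U \<inter> W))"
    using homeomorphic_imp_open_map[OF homeomorphic_chart[OF c]] unfolding open_map_def by blast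
  then show ?thesis
    using openin_chart_image[OF c] openin_open_subtopology by blast
qed

definition local_smooth :: "'p set \<Rightarrow> ('p \<Rightarrow> real) \<Rightarrow> bool" where
  "local_smooth W g \<longleftrightarrow> openin X W \<and>
     (\<forall>(V, \<psi>)\<in>C. smooth_on n (\<psi> ` (V \<inter> W)) (\<lambda>y. g (inv_into V \<psi> y)))"

lemma local_smoothI:
  "openin X W \<Longrightarrow> (\<And>V \<psi>. (V, \<psi>) \<in> C \<Longrightarrow> smooth_on n (\<psi> ` (V \<inter> W)) (\<lambda>y. g (inv_into V \<psi> y))) \<Longrightarrow> local_smooth W g"
  unfolding local_smooth_def by blast

lemma local_smooth_openin: "local_smooth W g \<Longrightarrow> openin X W"
  by (simp add: local_smooth_def)

lemma local_smoothD:
  "local_smooth W g \<Longrightarrow> (V, \<psi>) \<in> C \<Longrightarrow> smooth_on n (\<psi> ` (V \<inter> W)) (\<lambda>y. g (inv_into V \<psi> y))"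
  unfolding local_smooth_def by blast

lemma local_smooth_const: "openin X W \<Longrightarrow> local_smooth W (\<lambda>_. c)"
  by (intro local_smoothI smooth_on_const)

lemma local_smooth_add: "local_smooth W f \<Longrightarrow> local_smooth W g \<Longrightarrow> local_smooth W (\<lambda>p. f p + g p)"
  unfolding local_smooth_def using smooth_on_add by fast

lemma local_smooth_mult: "local_smooth W f \<Longrightarrow> local_smooth W g \<Longrightarrow> local_smooth W (\<lambda>p. f p * g p)"
  unfolding local_smooth_def using smooth_on_mult by fast

lemma local_smooth_subset:
  assumes "local_smooth W f" "openin X W'" "W' \<subseteq> W"
  shows "local_smooth W' f"
proof (rule local_smoothI[OF assms(2)])
  fix V \<psi> assume "(V, \<psi>) \<in> C"
  from local_smoothD[OF assms(1) this] show "smooth_on n (\<psi> ` (V \<inter> W')) (\<lambda>y. f (inv_into V \<psi> y))"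
    by (rule smooth_on_subset) (use assms(3) in blast)
qed

lemma local_smooth_cong:
  assumes "local_smooth W f" "\<And>p. p \<in> W \<Longrightarrow> f p = g p"
  shows "local_smooth W g"
proof (rule local_smoothI[OF local_smooth_openin[OF assms(1)]])
  fix V \<psi> assume c: "(V, \<psi>) \<in> C"
  show "smooth_on n (\<psi> ` (V \<inter> W)) (\<lambda>y. g (inv_into V \<psi> y))"
  proof (rule smooth_on_cong[OF openin_chart_image_Int[OF c local_smooth_openin[OF assms(1)]] _ local_smoothD[OF assms(1) c]])
    fix y assume "y \<in> \<psi> ` (V \<inter> W)"
    then show "f (inv_into V \<psi> y) = g (inv_into V \<psi> y)"
      using chart_inverse[OF c] assms(2) by auto
  qed
qed

lemma local_smooth_Un:
  assumes "local_smooth W g" "local_smooth W' g"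
  shows "local_smooth (W \<union> W') g"
proof (rule local_smoothI)
  show "openin X (W \<union> W')" using assms local_smooth_openin by blast
  fix V \<psi> assume c: "(V, \<psi>) \<in> C"
  have "smooth_on n (\<psi> ` (V \<inter> W) \<union> \<psi> ` (V \<inter> W')) (\<lambda>y. g (inv_into V \<psi> y))"
    by (intro smooth_on_Un openin_chart_image_Int[OF c] local_smooth_openin[OF assms(1)]
        local_smooth_openin[OF assms(2)] local_smoothD[OF assms(1) c] local_smoothD[OF assms(2) c])
  then show "smooth_on n (\<psi> ` (V \<inter> (W \<union> W'))) (\<lambda>y. g (inv_into V \<psi> y))"
    by (simp add: Int_Un_distrib image_Un)
qed

text \<open>Compatibility of the charts makes smoothness in one chart sufficient.\<close>

lemma local_smooth_chart:
  assumes c: "(U, \<phi>) \<in> C" and S: "openin (Euclidean_space n) S" and F: "smooth_on n S F"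
  shows "local_smooth {p \<in> U. \<phi> p \<in> S} (\<lambda>p. F (\<phi> p))"
proof (rule local_smoothI)
  show open': "openin X {p \<in> U. \<phi> p \<in> S}" by (rule openin_chart_preimage[OF c S])
  fix V \<psi> assume d: "(V, \<psi>) \<in> C"
  have "smooth_transition n (V, \<psi>) (U, \<phi>)"
    using mfd c d unfolding smooth_manifold_def by blast
  then have tr: "smooth_on n (\<psi> ` (V \<inter> U)) (\<lambda>y. \<phi> (inv_into V \<psi> y) i)" if "i < n" for i
    using that by (simp add: smooth_transition_def)
  show "smooth_on n (\<psi> ` (V \<inter> {p \<in> U. \<phi> p \<in> S})) (\<lambda>y. F (\<phi> (inv_into V \<psi> y)))"
  proof (rule smooth_on_compose[OF S openin_chart_image_Int[OF d open'] _ _ F])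
    show "smooth_on n (\<psi> ` (V \<inter> {p \<in> U. \<phi> p \<in> S})) (\<lambda>y. \<phi> (inv_into V \<psi> y) i)" if "i < n" for i
      by (rule smooth_on_subset[OF tr[OF that]]) blast
    show "(\<lambda>y. \<phi> (inv_into V \<psi> y)) ` (\<psi> ` (V \<inter> {p \<in> U. \<phi> p \<in> S})) \<subseteq> S"
      using chart_inverse[OF d] by auto
  qed
qed

abbreviation smooth_funs :: "('p \<Rightarrow> real) set" where
  "smooth_funs \<equiv> smooth_functions n X C"

lemma smooth_funs_iff:
  "f \<in> smooth_funs \<longleftrightarrow> f \<in> extensional (topspace X) \<and> local_smooth (topspace X) f"
proof -
  have "V \<inter> topspace X = V" if "(V, \<psi>) \<in> C" for V \<psi>
    using chart_subset[OF that] by blast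
  then have "(\<forall>(V, \<psi>)\<in>C. smooth_on n (\<psi> ` V) (\<lambda>y. f (inv_into V \<psi> y))) \<longleftrightarrow>
      (\<forall>(V, \<psi>)\<in>C. smooth_on n (\<psi> ` (V \<inter> topspace X)) (\<lambda>y. f (inv_into V \<psi> y)))"
    by (intro ball_cong refl) (metis (no_types, lifting) case_prod_beta prod.collapse)
  then show ?thesis
    by (simp add: smooth_functions_def local_smooth_def)
qed

lemma smooth_funs_restrictI:
  assumes "local_smooth (topspace X) g"
  shows "(\<lambda>p\<in>topspace X. g p) \<in> smooth_funs"
  unfolding smooth_funs_iff
  by (auto intro: local_smooth_cong[OF assms])

lemma smooth_funs_local: "f \<in> smooth_funs \<Longrightarrow> openin X W \<Longrightarrow> local_smooth W f"
  using local_smooth_subset openin_subset smooth_funs_iff by blast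

lemma smooth_funs_const: "(\<lambda>p\<in>topspace X. c) \<in> smooth_funs"
  by (rule smooth_funs_restrictI[OF local_smooth_const[OF openin_topspace]])

lemma smooth_funs_add: "f \<in> smooth_funs \<Longrightarrow> g \<in> smooth_funs \<Longrightarrow> (\<lambda>p\<in>topspace X. f p + g p) \<in> smooth_funs"
  by (rule smooth_funs_restrictI[OF local_smooth_add[OF smooth_funs_local smooth_funs_local]]) auto

lemma smooth_funs_mult: "f \<in> smooth_funs \<Longrightarrow> g \<in> smooth_funs \<Longrightarrow> (\<lambda>p\<in>topspace X. f p * g p) \<in> smooth_funs"
  by (rule smooth_funs_restrictI[OF local_smooth_mult[OF smooth_funs_local smooth_funs_local]]) auto

lemma smooth_funs_scale: "f \<in> smooth_funs \<Longrightarrow> (\<lambda>p\<in>topspace X. c * f p) \<in> smooth_funs"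
  by (rule smooth_funs_restrictI[OF local_smooth_mult[OF local_smooth_const smooth_funs_local]]) auto

lemma smooth_funs_extend_by_0:
  assumes g: "local_smooth W g" and K: "closedin X K" "K \<subseteq> W"
    and 0: "\<And>p. p \<in> topspace X - K \<Longrightarrow> g p = 0"
  shows "(\<lambda>p\<in>topspace X. g p) \<in> smooth_funs"
proof (rule smooth_funs_restrictI)
  have "openin X (topspace X - K)" using K(1) by blast
  then have "local_smooth (topspace X - K) g"
    using local_smooth_cong[OF local_smooth_const[of _ 0]] 0 by metis
  moreover have "W \<union> (topspace X - K) = topspace X"
    using openin_subset[OF local_smooth_openin[OF g]] K(2) by blast
  ultimately show "local_smooth (topspace X) g"
    using local_smooth_Un[OF g, of "topspace X - K"] by simp
qed

text \<open>
  Summing the squares of the chart components reduces the construction of a bump function to that of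
  a cutoff on the real line. The support lies over a compact cube, which makes it closed in the
  Hausdorff space \<open>X\<close>, so that the function may be extended by \<open>0\<close> beyond the chart.
\<close>

lemma bump_function:
  assumes W: "openin X W" and x: "x \<in> W"
  obtains b W' K where "b \<in> smooth_funs" "\<forall>p\<in>topspace X. 0 \<le> b p \<and> b p \<le> 1"
    "openin X W'" "x \<in> W'" "W' \<subseteq> W" "\<forall>p\<in>W'. b p = 1"
    "closedin X K" "K \<subseteq> W" "\<forall>p\<in>topspace X - K. b p = 0"
proof -
  have "x \<in> topspace X" using W x openin_subset by blast
  then obtain U \<phi> where c: "(U, \<phi>) \<in> C" and xU: "x \<in> U" using chart_exists by blast
  define S where "S = \<phi> ` (U \<inter> W)"
  have S: "openin (Euclidean_space n) S" unfolding S_def by (rule openin_chart_image_Int[OF c W])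
  have xS: "\<phi> x \<in> S" using x xU by (auto simp: S_def)
  obtain r where r: "r > 0" "cube n (\<phi> x) r \<subseteq> S" using openin_contains_cube[OF S xS] by blast
  define \<delta> where "\<delta> = r / 2"
  have \<delta>: "\<delta> > 0" "\<delta> < r" using r(1) by (auto simp: \<delta>_def)
  define Q where "Q = {y \<in> coord_space n. \<forall>i<n. \<bar>y i - \<phi> x i\<bar> \<le> \<delta>}"
  define q where "q y = (\<Sum>i<n. (y i - \<phi> x i)\<^sup>2)" for y :: "nat \<Rightarrow> real"
  define K where "K = {p \<in> U. \<phi> p \<in> Q}"
  have "Q \<subseteq> cube n (\<phi> x) r"
  proof
    fix y assume y: "y \<in> Q"
    have "\<bar>y i - \<phi> x i\<bar> < r" if "i < n" for i
      by (rule le_less_trans[OF _ \<delta>(2)]) (use y that in \<open>simp add: Q_def\<close>)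
    then show "y \<in> cube n (\<phi> x) r" using y by (simp add: Q_def cube_def)
  qed
  then have QS: "Q \<subseteq> S" using r(2) by blast
  have q_smooth: "smooth_on n (\<phi> ` U) q"
    unfolding q_def by (intro smooth_on_sum smooth_on_power smooth_on_diff smooth_on_coord smooth_on_const)
  have "\<delta>\<^sup>2 / 2 < \<delta>\<^sup>2" using \<delta>(1) by simp
  from smooth_cutoff[OF openin_chart_image[OF c] q_smooth this]
  obtain h where h: "smooth_on n (\<phi> ` U) (\<lambda>y. h (q y))" "\<And>t. 0 \<le> h t \<and> h t \<le> 1"
    "\<And>t. t \<le> \<delta>\<^sup>2 / 2 \<Longrightarrow> h t = 1" "\<And>t. t \<ge> \<delta>\<^sup>2 \<Longrightarrow> h t = (0::real)"
    by metis
  define g where "g p = (if p \<in> U then h (q (\<phi> p)) else 0)" for p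
  have KW: "K \<subseteq> W"
  proof
    fix p assume "p \<in> K"
    then have p: "p \<in> U" "\<phi> p \<in> \<phi> ` (U \<inter> W)" using QS by (auto simp: K_def S_def)
    then show "p \<in> W" using inj_onD[OF inj_on_chart[OF c]] by blast
  qed
  have KU: "K \<subseteq> U" by (auto simp: K_def)
  have "compactin X K"
  proof -
    have "compactin (Euclidean_space n) Q"
      unfolding Q_def by (rule compactin_closed_cube)
    moreover have QU: "Q \<subseteq> \<phi> ` U" using QS by (auto simp: S_def)
    ultimately have "compactin (subtopology (Euclidean_space n) (\<phi> ` U)) Q"
      by (simp add: compactin_subtopology)
    moreover have "\<phi> ` K = Q" using QU by (auto simp: K_def)
    moreover have "K \<subseteq> topspace (subtopology X U)" using chart_subset[OF c] by (auto simp: K_def)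
    ultimately have "compactin (subtopology X U) K"
      using homeomorphic_map_compactness_eq[OF homeomorphic_chart[OF c], of K] by simp
    then show ?thesis by (simp add: compactin_subtopology)
  qed
  moreover have "Hausdorff_space X" using mfd by (simp add: smooth_manifold_def)
  ultimately have Kc: "closedin X K" using compactin_imp_closedin by blast
  have g0: "g p = 0" if "p \<in> topspace X - K" for p
  proof (cases "p \<in> U")
    case True
    then have "\<phi> p \<notin> Q" using that by (auto simp: K_def)
    then obtain i where i: "i < n" "\<bar>\<phi> p i - \<phi> x i\<bar> > \<delta>"
      using chart_coord_space[OF c True] by (auto simp: Q_def not_le)
    have "\<delta>\<^sup>2 \<le> (\<phi> p i - \<phi> x i)\<^sup>2"
      using i(2) \<delta>(1) by (simp add: abs_le_square_iff[symmetric])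
    also have "\<dots> \<le> q (\<phi> p)" unfolding q_def
      by (rule member_le_sum[of i "{..<n}" "\<lambda>i. (\<phi> p i - \<phi> x i)\<^sup>2"]) (use i(1) in auto)
    finally show ?thesis using True h(4) by (simp add: g_def)
  qed (simp add: g_def)
  have "local_smooth {p \<in> U. \<phi> p \<in> \<phi> ` U} (\<lambda>p. h (q (\<phi> p)))"
    by (rule local_smooth_chart[OF c openin_chart_image[OF c] h(1)])
  moreover have "{p \<in> U. \<phi> p \<in> \<phi> ` U} = U" by blast
  ultimately have "local_smooth U g"
    by (intro local_smooth_cong[of U "\<lambda>p. h (q (\<phi> p))" g]) (simp_all add: g_def)
  then have b: "(\<lambda>p\<in>topspace X. g p) \<in> smooth_funs"
    by (rule smooth_funs_extend_by_0[OF _ Kc KU g0])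
  have "continuous_on S q"
    using smooth_on_imp_continuous_on[OF S smooth_on_subset[OF q_smooth]] by (auto simp: S_def)
  then obtain \<rho> where \<rho>: "\<rho> > 0" "cube n (\<phi> x) \<rho> \<subseteq> S" "\<forall>z\<in>cube n (\<phi> x) \<rho>. \<bar>q z - q (\<phi> x)\<bar> < \<delta>\<^sup>2 / 2"
    using continuous_on_cube_nhd[OF S _ xS, of q "\<delta>\<^sup>2 / 2"] \<delta>(1) by auto
  define W' where "W' = {p \<in> U. \<phi> p \<in> cube n (\<phi> x) \<rho>}"
  show thesis
  proof (rule that[OF b _ _ _ _ _ Kc KW])
    show "\<forall>p\<in>topspace X. 0 \<le> (\<lambda>p\<in>topspace X. g p) p \<and> (\<lambda>p\<in>topspace X. g p) p \<le> 1"
      using h(2) by (simp add: g_def)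
    show W': "openin X W'" unfolding W'_def by (rule openin_chart_preimage[OF c openin_cube])
    show "x \<in> W'" using xU centre_in_cube[OF chart_coord_space[OF c xU] \<rho>(1)] by (simp add: W'_def)
    show "W' \<subseteq> W"
    proof
      fix p assume "p \<in> W'"
      then have p: "p \<in> U" "\<phi> p \<in> \<phi> ` (U \<inter> W)" using \<rho>(2) by (auto simp: W'_def S_def)
      then show "p \<in> W" using inj_onD[OF inj_on_chart[OF c]] by blast
    qed
    show "\<forall>p\<in>W'. (\<lambda>p\<in>topspace X. g p) p = 1"
    proof
      fix p assume that: "p \<in> W'"
      have "q (\<phi> x) = 0" by (simp add: q_def)
      moreover have "p \<in> U" "\<bar>q (\<phi> p) - q (\<phi> x)\<bar> < \<delta>\<^sup>2 / 2" using that \<rho>(3) by (auto simp: W'_def)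
      ultimately have "h (q (\<phi> p)) = 1" by (intro h(3)) linarith
      then show "(\<lambda>p\<in>topspace X. g p) p = 1" using \<open>p \<in> U\<close> chart_subset[OF c] by (auto simp: g_def)
    qed
    show "\<forall>p\<in>topspace X - K. (\<lambda>p\<in>topspace X. g p) p = 0"
      using g0 by simp
  qed
qed

text \<open>The germs at \<open>x\<close> of smooth functions, on which a point of the bundle over \<open>x\<close> is evaluated.\<close>

definition smooth_near :: "'p \<Rightarrow> ('p \<Rightarrow> real) \<Rightarrow> bool" where
  "smooth_near x g \<longleftrightarrow> (\<exists>f\<in>smooth_funs. \<exists>W. openin X W \<and> x \<in> W \<and> (\<forall>y\<in>W. f y = g y))"

lemma local_smooth_imp_smooth_near:
  assumes g: "local_smooth W g" and x: "x \<in> W"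
  shows "smooth_near x g"
proof -
  obtain b W' K where b: "b \<in> smooth_funs" "\<forall>p\<in>topspace X. 0 \<le> b p \<and> b p \<le> 1"
    "openin X W'" "x \<in> W'" "W' \<subseteq> W" "\<forall>p\<in>W'. b p = 1"
    "closedin X K" "K \<subseteq> W" "\<forall>p\<in>topspace X - K. b p = 0"
    by (rule bump_function[OF local_smooth_openin[OF g] x])
  have "local_smooth W (\<lambda>p. b p * g p)"
    by (intro local_smooth_mult smooth_funs_local b(1) local_smooth_openin[OF g] g)
  then have "(\<lambda>p\<in>topspace X. b p * g p) \<in> smooth_funs"
    by (rule smooth_funs_extend_by_0[OF _ b(7,8)]) (use b(9) in simp)
  moreover have "(\<lambda>p\<in>topspace X. b p * g p) y = g y" if "y \<in> W'" for y
    using that b(6) openin_subset[OF b(3)] by auto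
  ultimately show ?thesis using b(3,4) unfolding smooth_near_def by blast
qed

lemma smooth_near_chart:
  assumes "(U, \<phi>) \<in> C" "x \<in> U" "openin (Euclidean_space n) S" "\<phi> x \<in> S" "smooth_on n S F"
  shows "smooth_near x (\<lambda>p. F (\<phi> p))"
  by (rule local_smooth_imp_smooth_near[OF local_smooth_chart[OF assms(1,3,5)]]) (simp add: assms(2,4))

lemma smooth_funs_continuous:
  assumes "f \<in> smooth_funs"
  shows "continuous_map X euclideanreal f"
proof -
  have "\<exists>W. openin X W \<and> x \<in> W \<and> continuous_map (subtopology X W) euclideanreal f" if "x \<in> topspace X" for x
  proof -
    from chart_exists[OF that] obtain U \<phi> where c: "(U, \<phi>) \<in> C" and x: "x \<in> U" by blast
    have sm: "smooth_on n (\<phi> ` (U \<inter> U)) (\<lambda>y. f (inv_into U \<phi> y))"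
      by (rule local_smoothD[OF smooth_funs_local[OF assms openin_chart_domain[OF c]] c])
    have "Ck_on n 0 (\<phi> ` U) (\<lambda>y. f (inv_into U \<phi> y))" 
      using smooth_onD[OF sm] unfolding Int_absorb .
    from continuous_map_compose[OF homeomorphic_imp_continuous_map[OF homeomorphic_chart[OF c]]
        Ck_on_imp_continuous_map[OF this]]
    have "continuous_map (subtopology X U) euclideanreal ((\<lambda>y. f (inv_into U \<phi> y)) \<circ> \<phi>)" .
    then have "continuous_map (subtopology X U) euclideanreal f"
      by (rule continuous_map_eq) (simp add: chart_inverse[OF c])
    then show ?thesis using x openin_chart_domain[OF c] by blast
  qed
  then show ?thesis by (rule continuous_map_local)
qed

end

section \<open>Weil algebras\<close>

locale weil_alg =
  fixes N :: "'a::{real_algebra_1, comm_ring_1} set"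
  assumes weil: "weil_algebra N"
begin

lemma ideal_N: "is_ideal N"
  using weil by (simp add: weil_algebra_def is_maximal_ideal_def)

lemma nil_0: "0 \<in> N"
  and nil_add: "x \<in> N \<Longrightarrow> y \<in> N \<Longrightarrow> x + y \<in> N"
  and nil_mult: "x \<in> N \<Longrightarrow> a * x \<in> N"
  using ideal_N by (simp_all add: is_ideal_def)

lemma nil_uminus: "x \<in> N \<Longrightarrow> - x \<in> N"
  using nil_mult[of x "-1"] by simp

lemma nil_diff: "x \<in> N \<Longrightarrow> y \<in> N \<Longrightarrow> x - y \<in> N"
  using nil_add[OF _ nil_uminus, of x y] by simp

lemma pr_real_eqI:
  assumes "a - of_real r \<in> N"
  shows "pr_real N a = r"
  unfolding pr_real_def
proof (rule the_equality)
  show "\<exists>b\<in>N. a = of_real r + b"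
    by (rule bexI[OF _ assms]) simp
  fix s assume "\<exists>b\<in>N. a = of_real s + b"
  then have "a - of_real s \<in> N" by auto
  from nil_diff[OF this assms] have "of_real (r - s) \<in> N" by simp
  moreover have "range of_real \<inter> N = {0}" using weil by (simp add: weil_algebra_def)
  ultimately have "of_real (r - s) = (0::'a)" by blast
  then show "s = r" by simp
qed

lemma pr_real_diff_nil: "a - of_real (pr_real N a) \<in> N"
proof -
  have "\<exists>r. \<exists>b\<in>N. a = of_real r + b" using weil by (simp add: weil_algebra_def)
  then obtain r b where rb: "b \<in> N" "a = of_real r + b" by blast
  then have "a - of_real r \<in> N" by simp
  with pr_real_eqI[OF this] show ?thesis by simp
qed

lemma pr_real_of_real: "pr_real N (of_real r) = r"
  by (rule pr_real_eqI) (simp add: nil_0)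

lemma pr_real_add: "pr_real N (a + b) = pr_real N a + pr_real N b"
  using nil_add[OF pr_real_diff_nil[of a] pr_real_diff_nil[of b]]
  by (intro pr_real_eqI) (simp add: algebra_simps)

lemma pr_real_mult: "pr_real N (a * b) = pr_real N a * pr_real N b"
proof (rule pr_real_eqI)
  have "a * (b - of_real (pr_real N b)) + of_real (pr_real N b) * (a - of_real (pr_real N a)) \<in> N"
    by (intro nil_add nil_mult pr_real_diff_nil)
  then show "a * b - of_real (pr_real N a * pr_real N b) \<in> N"
    by (simp add: algebra_simps)
qed

lemma pr_real_scaleR: "pr_real N (c *\<^sub>R a) = c * pr_real N a"
  using pr_real_mult[of "of_real c" a] by (simp add: pr_real_of_real scaleR_conv_of_real)

lemma linear_pr_real: "linear (pr_real N)"
  by (intro linearI) (simp_all add: pr_real_add pr_real_scaleR)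

lemma nilpotent_power: "\<exists>p>0. \<forall>x\<in>N. x ^ p = 0"
proof -
  have "\<exists>k::nat. k \<ge> 1 \<and> (\<forall>a. (\<forall>i<k + 1. a i \<in> N) \<longrightarrow> (\<Prod>i<k + 1. a i) = 0)"
    using weil by (simp add: weil_algebra_def)
  then obtain k :: nat where k: "\<forall>a. (\<forall>i<k + 1. a i \<in> N) \<longrightarrow> (\<Prod>i<k + 1. a i) = 0"
    by blast
  have "x ^ (k + 1) = 0" if "x \<in> N" for x
    using k[rule_format, of "\<lambda>_. x"] that by simp
  then show ?thesis by (intro exI[of _ "k + 1"]) simp
qed

text \<open>If \<open>\<nu> = u - 1\<close> is nilpotent and \<open>a u = 0\<close>, then \<open>a = - a \<nu> = a \<nu>\<^sup>2 = \<dots> = 0\<close>.\<close>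

lemma cancel_unit:
  assumes u: "pr_real N u = 1" and 0: "a * u = 0"
  shows "a = 0"
proof -
  obtain p where p: "\<forall>x\<in>N. x ^ p = 0" using nilpotent_power by blast
  have nu: "u - 1 \<in> N" using pr_real_diff_nil[of u] u by simp
  have *: "a * (u - 1) = - a" using 0 by (simp add: algebra_simps)
  have "a * (u - 1) ^ m = (-1) ^ m * a" for m
  proof (induction m)
    case (Suc m)
    have "a * (u - 1) ^ Suc m = (a * (u - 1)) * (u - 1) ^ m" by (simp only: power_Suc mult.assoc)
    then show ?case using Suc by (simp add: *)
  qed simp
  from this[of p] have "(-1) ^ p * a = 0" using p nu by simp
  then show ?thesis by (cases "even p") simp_all
qed

lemma finite_basis:
  obtains B :: "'a set" where "finite B" "independent B" "span B = UNIV" "1 \<in> B"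
proof -
  have "\<exists>B::'a set. finite B \<and> span B = UNIV" using weil by (simp add: weil_algebra_def)
  then obtain B0 :: "'a set" where B0: "finite B0" "span B0 = UNIV" by blast
  have "independent {1::'a}" by simp
  then obtain B where B: "{1::'a} \<subseteq> B" "independent B" "UNIV \<subseteq> span B"
    using maximal_independent_subset_extend[of "{1::'a}" UNIV] by auto
  have "finite B" using independent_span_bound[OF B0(1) B(2)] B0(2) by simp
  with B that show thesis by blast
qed

lemma weil_basis_exists: "\<exists>l \<alpha>. weil_basis l (\<alpha> :: nat \<Rightarrow> 'a)"
proof -
  obtain B :: "'a set" where B: "finite B" "independent B" "span B = UNIV" "1 \<in> B"
    by (rule finite_basis)
  obtain h where h: "bij_betw h {0..<card (B - {1})} (B - {1})"
    using ex_bij_betw_nat_finite[of "B - {1}"] B(1) by blast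
  define \<alpha> where "\<alpha> i = (case i of 0 \<Rightarrow> 1 | Suc j \<Rightarrow> h j)" for i
  define l where "l = Suc (card (B - {1}))"
  have l: "{..<l} = insert 0 (Suc ` {0..<card (B - {1})})"
    unfolding l_def by (metis atLeast0LessThan lessThan_Suc_eq_insert_0)
  have "\<alpha> ` {..<l} = insert 1 (h ` {0..<card (B - {1})})"
    unfolding l by (simp add: \<alpha>_def image_image del: image_Suc_atLeastLessThan)
  also have "\<dots> = B" using h B(4) unfolding bij_betw_def by auto
  finally have im: "\<alpha> ` {..<l} = B" .
  have lB: "l = card B" unfolding l_def using card_Suc_Diff1[OF B(1,4)] .
  have "inj_on \<alpha> {..<l}"
  proof (rule eq_card_imp_inj_on)
    show "card (\<alpha> ` {..<l}) = card {..<l}"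
      unfolding im by (simp add: lB)
  qed simp
  moreover have "\<alpha> 0 = 1" by (simp add: \<alpha>_def)
  ultimately have "weil_basis l \<alpha>" unfolding weil_basis_def im using B(2,3) by (simp add: l_def)
  then show ?thesis by blast
qed

text \<open>
  The type of the algebra carries no topology; a map into it counts as continuous if all its
  compositions with linear functionals are. This is the topology of a finite-dimensional space.
\<close>

definition acont :: "'z topology \<Rightarrow> ('z \<Rightarrow> 'a) \<Rightarrow> bool" where
  "acont Z \<Phi> \<longleftrightarrow> (\<forall>L. linear L \<longrightarrow> continuous_map Z euclideanreal (\<lambda>z. L (\<Phi> z)))"

lemma acontI: "(\<And>L. linear L \<Longrightarrow> continuous_map Z euclideanreal (\<lambda>z. L (\<Phi> z))) \<Longrightarrow> acont Z \<Phi>"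
  by (simp add: acont_def)

lemma acontD: "acont Z \<Phi> \<Longrightarrow> linear L \<Longrightarrow> continuous_map Z euclideanreal (\<lambda>z. L (\<Phi> z))"
  by (simp add: acont_def)

lemma acont_cong:
  assumes "acont Z \<Phi>" "\<And>z. z \<in> topspace Z \<Longrightarrow> \<Phi> z = \<Psi> z"
  shows "acont Z \<Psi>"
proof (rule acontI)
  fix L :: "'a \<Rightarrow> real" assume "linear L"
  from acontD[OF assms(1) this] show "continuous_map Z euclideanreal (\<lambda>z. L (\<Psi> z))"
    by (rule continuous_map_eq) (simp add: assms(2))
qed

lemma acont_compose: "acont Z \<Phi> \<Longrightarrow> continuous_map Y Z g \<Longrightarrow> acont Y (\<lambda>y. \<Phi> (g y))"
  unfolding acont_def using continuous_map_compose[of Y Z g euclideanreal] by (fastforce simp: o_def)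

lemma acont_subtopology: "acont Z \<Phi> \<Longrightarrow> acont (subtopology Z W) \<Phi>"
  unfolding acont_def using continuous_map_from_subtopology by blast

lemma acont_const: "acont Z (\<lambda>z. a)"
  by (simp add: acont_def)

lemma acont_add: "acont Z \<Phi> \<Longrightarrow> acont Z \<Psi> \<Longrightarrow> acont Z (\<lambda>z. \<Phi> z + \<Psi> z)"
  by (rule acontI) (simp add: linear_add continuous_map_add acontD)

lemma acont_scaleR:
  assumes "continuous_map Z euclideanreal c" "acont Z \<Phi>"
  shows "acont Z (\<lambda>z. c z *\<^sub>R \<Phi> z)"
proof (rule acontI)
  fix L :: "'a \<Rightarrow> real" assume L: "linear L"
  show "continuous_map Z euclideanreal (\<lambda>z. L (c z *\<^sub>R \<Phi> z))"
    using continuous_map_real_mult[OF assms(1) acontD[OF assms(2) L]] by (simp add: linear_scale[OF L])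
qed

lemma acont_sum: "(\<And>i. i \<in> I \<Longrightarrow> acont Z (\<Phi> i)) \<Longrightarrow> acont Z (\<lambda>z. \<Sum>i\<in>I. \<Phi> i z)"
  by (induction I rule: infinite_finite_induct) (simp_all add: acont_const acont_add)

lemma linear_representation:
  assumes "independent B" "span B = UNIV"
  shows "linear (\<lambda>v::'a. representation B v b)"
  using assms by (intro linearI) (simp_all add: representation_add representation_scale)

text \<open>The product is bilinear, so its coordinates are polynomials in the coordinates of the factors.\<close>

lemma acont_mult:
  assumes \<Phi>: "acont Z \<Phi>" and \<Psi>: "acont Z \<Psi>"
  shows "acont Z (\<lambda>z. \<Phi> z * \<Psi> z)"
proof -
  obtain B :: "'a set" where B: "finite B" "independent B" "span B = UNIV" "1 \<in> B"
    by (rule finite_basis)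
  let ?r = "representation B"
  have r: "(\<Sum>b\<in>B. ?r v b *\<^sub>R b) = v" for v
    using B by (intro sum_representation_eq) auto
  have c: "continuous_map Z euclideanreal (\<lambda>z. ?r (\<Phi> z) b)" "continuous_map Z euclideanreal (\<lambda>z. ?r (\<Psi> z) b)" for b
    by (rule acontD[OF \<Phi> linear_representation[OF B(2,3)]], rule acontD[OF \<Psi> linear_representation[OF B(2,3)]])
  have "\<Phi> z * \<Psi> z = (\<Sum>b\<in>B. \<Sum>b'\<in>B. (?r (\<Phi> z) b * ?r (\<Psi> z) b') *\<^sub>R (b * b'))" for z
  proof -
    have "\<Phi> z * \<Psi> z = (\<Sum>b\<in>B. ?r (\<Phi> z) b *\<^sub>R b) * (\<Sum>b\<in>B. ?r (\<Psi> z) b *\<^sub>R b)"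
      by (simp only: r)
    also have "\<dots> = (\<Sum>b\<in>B. \<Sum>b'\<in>B. (?r (\<Phi> z) b * ?r (\<Psi> z) b') *\<^sub>R (b * b'))"
      by (simp add: sum_product mult_ac)
    finally show ?thesis .
  qed
  moreover have "acont Z (\<lambda>z. \<Sum>b\<in>B. \<Sum>b'\<in>B. (?r (\<Phi> z) b * ?r (\<Psi> z) b') *\<^sub>R (b * b'))"
    by (intro acont_sum acont_scaleR continuous_map_real_mult c acont_const)
  ultimately show ?thesis by simp
qed

lemma acont_power: "acont Z \<Phi> \<Longrightarrow> acont Z (\<lambda>z. \<Phi> z ^ k)"
  by (induction k) (simp_all add: acont_const acont_mult)

lemma acont_of_real: "continuous_map Z euclideanreal c \<Longrightarrow> acont Z (\<lambda>z. of_real (c z))"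
  using acont_scaleR[OF _ acont_const[of Z 1]] by (simp add: of_real_def)

lemma acont_diff: "acont Z \<Phi> \<Longrightarrow> acont Z \<Psi> \<Longrightarrow> acont Z (\<lambda>z. \<Phi> z - \<Psi> z)"
  using acont_add[OF _ acont_scaleR[OF continuous_map_const[THEN iffD2], of Z "-1" \<Psi>], of \<Phi>] by simp

end

section \<open>Points of the Weil bundle as functionals on germs\<close>

locale weil_mfd = smooth_mfd n X C + weil_alg N
  for n :: nat and X :: "'p topology" and C :: "'p chart set"
    and N :: "'a::{real_algebra_1, comm_ring_1} set"
begin

abbreviation fibre :: "'p \<Rightarrow> (('p \<Rightarrow> real) \<Rightarrow> 'a) set" where
  "fibre x \<equiv> weil_fibre n X C N x"

abbreviation ev :: "(('p \<Rightarrow> real) \<Rightarrow> 'a) \<Rightarrow> ('p \<Rightarrow> real) \<Rightarrow> 'a" where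
  "ev \<xi> g \<equiv> weil_eval n X C N \<xi> g"

abbreviation proj :: "(('p \<Rightarrow> real) \<Rightarrow> 'a) \<Rightarrow> 'p" where
  "proj \<xi> \<equiv> weil_proj n X C N \<xi>"

lemma fibre_morphism: "\<xi> \<in> fibre x \<Longrightarrow> \<xi> \<in> algebra_morphisms n X C"
  by (simp add: weil_fibre_def)

lemma fibre_add:
  assumes "\<xi> \<in> fibre x" "f \<in> smooth_funs" "g \<in> smooth_funs"
  shows "\<xi> (\<lambda>p\<in>topspace X. f p + g p) = \<xi> f + \<xi> g"
  using fibre_morphism[OF assms(1)] assms(2,3) by (simp add: algebra_morphisms_def)

lemma fibre_mult:
  assumes "\<xi> \<in> fibre x" "f \<in> smooth_funs" "g \<in> smooth_funs"
  shows "\<xi> (\<lambda>p\<in>topspace X. f p * g p) = \<xi> f * \<xi> g"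
  using fibre_morphism[OF assms(1)] assms(2,3) by (simp add: algebra_morphisms_def)

lemma fibre_scale:
  assumes "\<xi> \<in> fibre x" "f \<in> smooth_funs"
  shows "\<xi> (\<lambda>p\<in>topspace X. c * f p) = c *\<^sub>R \<xi> f"
  using fibre_morphism[OF assms(1)] assms(2) by (simp add: algebra_morphisms_def)

lemma fibre_one:
  assumes "\<xi> \<in> fibre x"
  shows "\<xi> (\<lambda>p\<in>topspace X. 1) = 1"
  using fibre_morphism[OF assms] by (simp add: algebra_morphisms_def)

lemma fibre_const:
  assumes "\<xi> \<in> fibre x"
  shows "\<xi> (\<lambda>p\<in>topspace X. c) = of_real c"
proof -
  have "(\<lambda>p\<in>topspace X. c) = (\<lambda>p\<in>topspace X. c * (\<lambda>p\<in>topspace X. 1) p)"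
    by (auto simp: fun_eq_iff)
  then show ?thesis
    using fibre_scale[OF assms smooth_funs_const, of c 1] fibre_one[OF assms] by (simp add: of_real_def)
qed

lemma fibre_pr_real: "\<xi> \<in> fibre x \<Longrightarrow> f \<in> smooth_funs \<Longrightarrow> pr_real N (\<xi> f) = f x"
  by (simp add: weil_fibre_def)

text \<open>
  If \<open>f\<close> and \<open>g\<close> agree near the base point, their difference is annihilated by a bump function there,
  whose value under \<open>\<xi>\<close> is a unit.
\<close>

lemma fibre_local:
  assumes \<xi>: "\<xi> \<in> fibre x" and f: "f \<in> smooth_funs" and g: "g \<in> smooth_funs"
    and W: "openin X W" "x \<in> W" and eq: "\<forall>p\<in>W. f p = g p"
  shows "\<xi> f = \<xi> g"
proof -
  obtain b W' K where b: "b \<in> smooth_funs" "\<forall>p\<in>topspace X. 0 \<le> b p \<and> b p \<le> 1"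
    "openin X W'" "x \<in> W'" "W' \<subseteq> W" "\<forall>p\<in>W'. b p = 1"
    "closedin X K" "K \<subseteq> W" "\<forall>p\<in>topspace X - K. b p = 0"
    by (rule bump_function[OF W])
  define g' where "g' = (\<lambda>p\<in>topspace X. (-1) * g p)"
  define h where "h = (\<lambda>p\<in>topspace X. f p + g' p)"
  have g': "g' \<in> smooth_funs" unfolding g'_def by (rule smooth_funs_scale[OF g])
  have h: "h \<in> smooth_funs" unfolding h_def by (rule smooth_funs_add[OF f g'])
  have "\<xi> h = \<xi> f + (-1) *\<^sub>R \<xi> g"
    unfolding h_def fibre_add[OF \<xi> f g'] unfolding g'_def fibre_scale[OF \<xi> g] ..
  moreover have "\<xi> h = 0"
  proof (rule cancel_unit)
    show "pr_real N (\<xi> b) = 1" using fibre_pr_real[OF \<xi> b(1)] b(4,6) by simp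
    have "h p * b p = 0" if "p \<in> topspace X" for p
    proof (cases "p \<in> K")
      case True
      then have "f p = g p" using b(8) eq by blast
      then show ?thesis using that by (simp add: h_def g'_def)
    next
      case False
      then show ?thesis using b(9) that by simp
    qed
    then have "(\<lambda>p\<in>topspace X. h p * b p) = (\<lambda>p\<in>topspace X. 0)" by (auto simp: fun_eq_iff)
    then show "\<xi> h * \<xi> b = 0"
      using fibre_mult[OF \<xi> h b(1)] fibre_const[OF \<xi>, of 0] by simp
  qed
  ultimately show ?thesis by simp
qed

lemma Hausdorff_X: "Hausdorff_space X"
  using mfd by (simp add: smooth_manifold_def)

lemma fibre_disjoint:
  assumes "\<xi> \<in> fibre x" "\<xi> \<in> fibre y" "x \<in> topspace X" "y \<in> topspace X"
  shows "x = y"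
proof (rule ccontr)
  assume ne: "x \<noteq> y"
  have "closedin X {y}"
    using closedin_Hausdorff_sing_eq[OF Hausdorff_X] assms(4) by blast
  then have W: "openin X (topspace X - {y})" by blast
  have "x \<in> topspace X - {y}" using ne assms(3) by blast
  from bump_function[OF W this]
  obtain b W' K where b: "b \<in> smooth_funs" "\<forall>p\<in>topspace X. 0 \<le> b p \<and> b p \<le> 1"
    "openin X W'" "x \<in> W'" "W' \<subseteq> topspace X - {y}" "\<forall>p\<in>W'. b p = 1"
    "closedin X K" "K \<subseteq> topspace X - {y}" "\<forall>p\<in>topspace X - K. b p = 0"
    by this
  have "b x = 1" using b(4,6) by simp
  moreover have "b y = 0" using b(8,9) assms(4) by blast
  ultimately show False
    using fibre_pr_real[OF assms(1) b(1)] fibre_pr_real[OF assms(2) b(1)] by simp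
qed

lemma weil_proj_eq: "\<xi> \<in> fibre x \<Longrightarrow> x \<in> topspace X \<Longrightarrow> proj \<xi> = x"
  unfolding weil_proj_def by (rule the_equality) (auto intro: fibre_disjoint)

lemma weil_eval_eq:
  assumes \<xi>: "\<xi> \<in> fibre x" and f: "f \<in> smooth_funs" and W: "openin X W" "x \<in> W"
    and eq: "\<forall>p\<in>W. f p = g p"
  shows "ev \<xi> g = \<xi> f"
  unfolding weil_eval_def
proof (rule the_equality)
  have x: "x \<in> topspace X" using W openin_subset by blast
  have pr: "proj \<xi> = x" by (rule weil_proj_eq[OF \<xi> x])
  show "\<exists>f'\<in>smooth_funs. \<exists>W. openin X W \<and> proj \<xi> \<in> W \<and> (\<forall>y\<in>W. f' y = g y) \<and> \<xi> f = \<xi> f'"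
    unfolding pr using f W eq by blast
  fix a assume "\<exists>f'\<in>smooth_funs. \<exists>W. openin X W \<and> proj \<xi> \<in> W \<and> (\<forall>y\<in>W. f' y = g y) \<and> a = \<xi> f'"
  then obtain f' W' where f': "f' \<in> smooth_funs" "openin X W'" "x \<in> W'" "\<forall>y\<in>W'. f' y = g y" "a = \<xi> f'"
    unfolding pr by blast
  have "\<xi> f' = \<xi> f"
  proof (rule fibre_local[OF \<xi> f'(1) f openin_Int[OF W(1) f'(2)]])
    show "x \<in> W \<inter> W'" using W(2) f'(3) by blast
    show "\<forall>p\<in>W \<inter> W'. f' p = f p" using eq f'(4) by simp
  qed
  then show "a = \<xi> f" using f'(5) by simp
qed

lemma smooth_nearE:
  assumes "smooth_near x g"
  obtains f W where "f \<in> smooth_funs" "openin X W" "x \<in> W" "\<forall>p\<in>W. f p = g p"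
  using assms unfolding smooth_near_def by blast

lemma weil_eval_cong:
  assumes \<xi>: "\<xi> \<in> fibre x" and g: "smooth_near x g" and W: "openin X W" "x \<in> W"
    and eq: "\<forall>p\<in>W. g p = h p"
  shows "ev \<xi> g = ev \<xi> h"
proof -
  obtain f V where f: "f \<in> smooth_funs" "openin X V" "x \<in> V" "\<forall>p\<in>V. f p = g p"
    using g by (rule smooth_nearE)
  have "ev \<xi> g = \<xi> f" by (rule weil_eval_eq[OF \<xi> f])
  moreover have "ev \<xi> h = \<xi> f"
    by (rule weil_eval_eq[OF \<xi> f(1) openin_Int[OF W(1) f(2)]]) (use W(2) f(3,4) eq in auto)
  ultimately show ?thesis by simp
qed

lemma
  assumes g: "smooth_near x g" and h: "smooth_near x h"
  shows smooth_near_add: "smooth_near x (\<lambda>p. g p + h p)"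
    and weil_eval_add: "\<xi> \<in> fibre x \<Longrightarrow> ev \<xi> (\<lambda>p. g p + h p) = ev \<xi> g + ev \<xi> h"
proof -
  obtain f V where f: "f \<in> smooth_funs" "openin X V" "x \<in> V" "\<forall>p\<in>V. f p = g p"
    using g by (rule smooth_nearE)
  obtain f' V' where f': "f' \<in> smooth_funs" "openin X V'" "x \<in> V'" "\<forall>p\<in>V'. f' p = h p"
    using h by (rule smooth_nearE)
  have s: "(\<lambda>p\<in>topspace X. f p + f' p) \<in> smooth_funs" by (rule smooth_funs_add[OF f(1) f'(1)])
  have o: "openin X (V \<inter> V')" by (rule openin_Int[OF f(2) f'(2)])
  have x: "x \<in> V \<inter> V'" using f(3) f'(3) by blast
  have eq: "\<forall>p\<in>V \<inter> V'. (\<lambda>p\<in>topspace X. f p + f' p) p = g p + h p"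
    using f(4) f'(4) openin_subset[OF o] by auto
  show "smooth_near x (\<lambda>p. g p + h p)"
    unfolding smooth_near_def by (intro bexI[OF _ s] exI[of _ "V \<inter> V'"]) (use o x eq in blast)
  show "ev \<xi> (\<lambda>p. g p + h p) = ev \<xi> g + ev \<xi> h" if "\<xi> \<in> fibre x"
    unfolding weil_eval_eq[OF that s o x eq] weil_eval_eq[OF that f] weil_eval_eq[OF that f']
    by (rule fibre_add[OF that f(1) f'(1)])
qed

lemma
  assumes g: "smooth_near x g" and h: "smooth_near x h"
  shows smooth_near_mult: "smooth_near x (\<lambda>p. g p * h p)"
    and weil_eval_mult: "\<xi> \<in> fibre x \<Longrightarrow> ev \<xi> (\<lambda>p. g p * h p) = ev \<xi> g * ev \<xi> h"
proof -
  obtain f V where f: "f \<in> smooth_funs" "openin X V" "x \<in> V" "\<forall>p\<in>V. f p = g p"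
    using g by (rule smooth_nearE)
  obtain f' V' where f': "f' \<in> smooth_funs" "openin X V'" "x \<in> V'" "\<forall>p\<in>V'. f' p = h p"
    using h by (rule smooth_nearE)
  have s: "(\<lambda>p\<in>topspace X. f p * f' p) \<in> smooth_funs" by (rule smooth_funs_mult[OF f(1) f'(1)])
  have o: "openin X (V \<inter> V')" by (rule openin_Int[OF f(2) f'(2)])
  have x: "x \<in> V \<inter> V'" using f(3) f'(3) by blast
  have eq: "\<forall>p\<in>V \<inter> V'. (\<lambda>p\<in>topspace X. f p * f' p) p = g p * h p"
    using f(4) f'(4) openin_subset[OF o] by auto
  show "smooth_near x (\<lambda>p. g p * h p)"
    unfolding smooth_near_def by (intro bexI[OF _ s] exI[of _ "V \<inter> V'"]) (use o x eq in blast)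
  show "ev \<xi> (\<lambda>p. g p * h p) = ev \<xi> g * ev \<xi> h" if "\<xi> \<in> fibre x"
    unfolding weil_eval_eq[OF that s o x eq] weil_eval_eq[OF that f] weil_eval_eq[OF that f']
    by (rule fibre_mult[OF that f(1) f'(1)])
qed

lemma smooth_near_const: "x \<in> topspace X \<Longrightarrow> smooth_near x (\<lambda>_. c)"
  by (rule local_smooth_imp_smooth_near[OF local_smooth_const[OF openin_topspace]])

lemma weil_eval_const:
  assumes "\<xi> \<in> fibre x" "x \<in> topspace X"
  shows "ev \<xi> (\<lambda>_. c) = of_real c"
  using weil_eval_eq[OF assms(1) smooth_funs_const openin_topspace assms(2), of c "\<lambda>_. c"]
    fibre_const[OF assms(1)] by simp

lemma pr_real_weil_eval:
  assumes "\<xi> \<in> fibre x" "smooth_near x g"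
  shows "pr_real N (ev \<xi> g) = g x"
proof -
  obtain f V where f: "f \<in> smooth_funs" "openin X V" "x \<in> V" "\<forall>p\<in>V. f p = g p"
    using assms(2) by (rule smooth_nearE)
  show ?thesis using weil_eval_eq[OF assms(1) f] fibre_pr_real[OF assms(1) f(1)] f(3,4) by simp
qed

lemma smooth_near_sum_eval:
  assumes "finite I" "\<And>i. i \<in> I \<Longrightarrow> smooth_near x (g i)" "x \<in> topspace X" "\<xi> \<in> fibre x"
  shows "smooth_near x (\<lambda>p. \<Sum>i\<in>I. g i p) \<and> ev \<xi> (\<lambda>p. \<Sum>i\<in>I. g i p) = (\<Sum>i\<in>I. ev \<xi> (g i))"
  using assms(1,2)
proof (induction I rule: finite_induct)
  case empty
  then show ?case
    using smooth_near_const[OF assms(3), of 0] weil_eval_const[OF assms(4,3), of 0] by simp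
next
  case (insert i I)
  have I: "smooth_near x (\<lambda>p. \<Sum>i\<in>I. g i p)" "ev \<xi> (\<lambda>p. \<Sum>i\<in>I. g i p) = (\<Sum>i\<in>I. ev \<xi> (g i))"
    using insert by auto
  have i: "smooth_near x (g i)" using insert.prems by blast
  show ?case
    using smooth_near_add[OF i I(1)] weil_eval_add[OF i I(1) assms(4)] I(2) insert.hyps by simp
qed

lemma smooth_near_power_eval:
  assumes "smooth_near x g" "x \<in> topspace X" "\<xi> \<in> fibre x"
  shows "smooth_near x (\<lambda>p. g p ^ k) \<and> ev \<xi> (\<lambda>p. g p ^ k) = ev \<xi> g ^ k"
proof (induction k)
  case 0
  then show ?case
    using smooth_near_const[OF assms(2), of 1] weil_eval_const[OF assms(3,2), of 1] by simp
next
  case (Suc k)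
  then show ?case
    using smooth_near_mult[OF assms(1), of "\<lambda>p. g p ^ k"] weil_eval_mult[OF assms(1), of "\<lambda>p. g p ^ k" \<xi>] assms(3)
    by simp
qed

end

section \<open>Taylor expansion at a point of the bundle\<close>

definition freeze :: "(nat \<Rightarrow> real) \<Rightarrow> nat \<Rightarrow> (nat \<Rightarrow> real) \<Rightarrow> nat \<Rightarrow> real" where
  "freeze a m y = (\<lambda>i. if i < m then a i else y i)"

lemma freeze_in_cube: "a \<in> coord_space n \<Longrightarrow> y \<in> cube n a r \<Longrightarrow> 0 < r \<Longrightarrow> freeze a m y \<in> cube n a r"
  by (simp add: freeze_def cube_def)

lemma freeze_upd: "freeze a m (y(m := a m)) = freeze a (Suc m) y"
  by (auto simp: freeze_def fun_eq_iff less_Suc_eq)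

lemma freeze_all: "a \<in> coord_space n \<Longrightarrow> y \<in> coord_space n \<Longrightarrow> freeze a n y = a"
  by (auto simp: freeze_def fun_eq_iff)

lemma smooth_on_freeze:
  assumes F: "smooth_on n (cube n a r) F" and a: "a \<in> coord_space n" and r: "r > 0"
  shows "smooth_on n (cube n a r) (\<lambda>y. F (freeze a m y))"
proof (rule smooth_on_compose[OF openin_cube openin_cube _ _ F])
  show "smooth_on n (cube n a r) (\<lambda>y. freeze a m y i)" for i
    by (cases "i < m") (simp_all add: freeze_def smooth_on_const smooth_on_coord)
  show "freeze a m ` cube n a r \<subseteq> cube n a r"
    using freeze_in_cube[OF a _ r] by blast
qed

lemma partial_deriv_freeze:
  "(partial_deriv m ^^ j) (\<lambda>y. F (freeze a m y)) = (\<lambda>y. (partial_deriv m ^^ j) F (freeze a m y))"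
proof (induction j)
  case (Suc j)
  have *: "freeze a m (y(m := t)) = (freeze a m y)(m := t)" "freeze a m y m = y m" for y t
    by (auto simp: freeze_def fun_eq_iff)
  show ?case
    unfolding funpow.simps(2) o_apply Suc by (rule ext) (simp only: partial_deriv_def[of m _ "_ :: nat \<Rightarrow> real"] *)
qed simp

context weil_mfd
begin

text \<open>
  In the Taylor expansion in one coordinate the powers of the nilpotent element \<open>\<nu>\<close> appear, so the
  smooth remainder contributes nothing: only the derivatives with that coordinate frozen at the base
  point are left.
\<close>

lemma weil_eval_Taylor:
  fixes \<xi> :: "('p \<Rightarrow> real) \<Rightarrow> 'a"
  assumes \<xi>: "\<xi> \<in> fibre x" and c: "(U, \<phi>) \<in> C" and x: "x \<in> U" and F: "smooth_on n (\<phi> ` U) F"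
    and m: "m < n" and p: "p > 0" "\<forall>x\<in>N. x ^ p = 0"
  shows "ev \<xi> (\<lambda>q. F (freeze (\<phi> x) m (\<phi> q))) =
    (\<Sum>j<p. (1 / fact j) *\<^sub>R ((ev \<xi> (\<lambda>q. \<phi> q m) - of_real (\<phi> x m)) ^ j *
      ev \<xi> (\<lambda>q. (partial_deriv m ^^ j) F (freeze (\<phi> x) (Suc m) (\<phi> q)))))"
proof -
  define a where "a = \<phi> x"
  have a: "a \<in> coord_space n" unfolding a_def by (rule chart_coord_space[OF c x])
  have xX: "x \<in> topspace X" using x chart_subset[OF c] by blast
  have oU: "openin (Euclidean_space n) (\<phi> ` U)" by (rule openin_chart_image[OF c])
  have "a \<in> \<phi> ` U" using x by (simp add: a_def)
  then obtain r where r: "r > 0" "cube n a r \<subseteq> \<phi> ` U"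
    using openin_contains_cube[OF oU] by blast
  let ?B = "cube n a r"
  have aB: "\<phi> x \<in> ?B" using centre_in_cube[OF a r(1)] by (simp add: a_def)
  have near: "smooth_near x (\<lambda>q. G (\<phi> q))" if "smooth_on n ?B G" for G
    by (rule smooth_near_chart[OF c x openin_cube aB that])
  have FB: "smooth_on n ?B ((partial_deriv m ^^ j) F)" for j
    by (rule smooth_on_subset[OF smooth_on_higher_partial_deriv[OF oU F m] r(2)])
  have FB0: "smooth_on n ?B F" by (rule smooth_on_subset[OF F r(2)])
  define G where "G j y = (partial_deriv m ^^ j) F (freeze a (Suc m) y)" for j y
  have G: "smooth_on n ?B (G j)" for j
    unfolding G_def by (rule smooth_on_freeze[OF FB a r(1)])
  have F0: "smooth_on n ?B (\<lambda>y. F (freeze a m y))"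
    by (rule smooth_on_freeze[OF FB0 a r(1)])
  obtain R where R: "smooth_on n ?B R" "\<forall>y\<in>?B. F (freeze a m y) =
      (\<Sum>j<p. (y m - a m) ^ j / fact j * (partial_deriv m ^^ j) (\<lambda>y. F (freeze a m y)) (y(m := a m))) +
      (y m - a m) ^ p * R y"
    by (rule Taylor_in_coordinate[OF m F0 p(1)])
  define z where "z q = \<phi> q m + (- a m)" for q
  have z_near: "smooth_near x z"
    unfolding z_def by (rule near) (intro smooth_on_add smooth_on_coord smooth_on_const)
  define \<nu> where "\<nu> = ev \<xi> (\<lambda>q. \<phi> q m) - of_real (a m)"
  have z_ev: "ev \<xi> z = \<nu>"
    unfolding z_def \<nu>_def
    using weil_eval_add[OF near[OF smooth_on_coord] smooth_near_const[OF xX] \<xi>, of m "- a m"]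
      weil_eval_const[OF \<xi> xX] by simp
  have "pr_real N (ev \<xi> (\<lambda>q. \<phi> q m)) = \<phi> x m"
    by (rule pr_real_weil_eval[OF \<xi> near[OF smooth_on_coord]])
  then have "\<nu> \<in> N" using pr_real_diff_nil[of "ev \<xi> (\<lambda>q. \<phi> q m)"] by (simp add: \<nu>_def a_def)
  then have nu_p: "\<nu> ^ p = 0" using p(2) by blast
  have pow: "smooth_near x (\<lambda>q. z q ^ j)" "ev \<xi> (\<lambda>q. z q ^ j) = \<nu> ^ j" for j
    using smooth_near_power_eval[OF z_near xX \<xi>, of j] z_ev by simp_all
  define T where "T j q = (1 / fact j) * (z q ^ j * G j (\<phi> q))" for j q
  have zG: "smooth_near x (\<lambda>q. z q ^ j * G j (\<phi> q))" for j
    by (rule smooth_near_mult[OF pow(1) near[OF G]])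
  have T: "smooth_near x (T j)" "ev \<xi> (T j) = (1 / fact j) *\<^sub>R (\<nu> ^ j * ev \<xi> (\<lambda>q. G j (\<phi> q)))" for j
  proof -
    show "smooth_near x (T j)"
      unfolding T_def by (rule smooth_near_mult[OF smooth_near_const[OF xX] zG])
    have "ev \<xi> (T j) = of_real (1 / fact j) * ev \<xi> (\<lambda>q. z q ^ j * G j (\<phi> q))"
      unfolding T_def by (simp only: weil_eval_mult[OF smooth_near_const[OF xX] zG \<xi>] weil_eval_const[OF \<xi> xX])
    also have "ev \<xi> (\<lambda>q. z q ^ j * G j (\<phi> q)) = \<nu> ^ j * ev \<xi> (\<lambda>q. G j (\<phi> q))"
      by (simp only: weil_eval_mult[OF pow(1) near[OF G] \<xi>] pow(2))
    finally show "ev \<xi> (T j) = (1 / fact j) *\<^sub>R (\<nu> ^ j * ev \<xi> (\<lambda>q. G j (\<phi> q)))"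
      by (simp only: scaleR_conv_of_real)
  qed
  have sum: "smooth_near x (\<lambda>q. \<Sum>j<p. T j q)" "ev \<xi> (\<lambda>q. \<Sum>j<p. T j q) = (\<Sum>j<p. ev \<xi> (T j))"
    using smooth_near_sum_eval[of "{..<p}" x T \<xi>] T(1) xX \<xi> by auto
  have rem: "smooth_near x (\<lambda>q. z q ^ p * R (\<phi> q))" "ev \<xi> (\<lambda>q. z q ^ p * R (\<phi> q)) = 0"
    using smooth_near_mult[OF pow(1) near[OF R(1)]] weil_eval_mult[OF pow(1) near[OF R(1)] \<xi>] pow(2) nu_p
    by simp_all
  have "ev \<xi> (\<lambda>q. F (freeze a m (\<phi> q))) = ev \<xi> (\<lambda>q. (\<Sum>j<p. T j q) + z q ^ p * R (\<phi> q))"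
  proof (rule weil_eval_cong[OF \<xi> near[OF F0] openin_chart_preimage[OF c openin_cube]])
    show "x \<in> {q \<in> U. \<phi> q \<in> ?B}" using x aB by simp
    show "\<forall>q\<in>{q \<in> U. \<phi> q \<in> ?B}. F (freeze a m (\<phi> q)) = (\<Sum>j<p. T j q) + z q ^ p * R (\<phi> q)"
      using R(2) by (simp add: partial_deriv_freeze freeze_upd T_def G_def z_def)
  qed
  also have "\<dots> = (\<Sum>j<p. ev \<xi> (T j))"
    by (simp only: weil_eval_add[OF sum(1) rem(1) \<xi>] sum(2) rem(2) add_0_right)
  finally show ?thesis
    by (simp add: T(2) \<nu>_def a_def G_def)
qed

text \<open>
  The chart coordinates of a point determine its value on every function that is smooth on the chart
  domain, and they do so continuously. The coordinates are frozen one after the other; once all are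
  frozen the function is constant near the base point.
\<close>

lemma acont_weil_eval_chart:
  fixes h :: "'z \<Rightarrow> ('p \<Rightarrow> real) \<Rightarrow> 'a"
  assumes c: "(U, \<phi>) \<in> C"
    and h: "\<And>z. z \<in> topspace Z \<Longrightarrow> h z \<in> fibre (b z)" and b: "\<And>z. z \<in> topspace Z \<Longrightarrow> b z \<in> U"
    and coord: "\<And>i. i < n \<Longrightarrow> acont Z (\<lambda>z. ev (h z) (\<lambda>q. \<phi> q i))"
    and F: "smooth_on n (\<phi> ` U) F"
  shows "acont Z (\<lambda>z. ev (h z) (\<lambda>q. F (\<phi> q)))"
proof -
  obtain p where p: "p > 0" "\<forall>x\<in>N. x ^ p = 0" using nilpotent_power by blast
  have oU: "openin (Euclidean_space n) (\<phi> ` U)" by (rule openin_chart_image[OF c])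
  have near: "smooth_near (b z) (\<lambda>q. G (\<phi> q))" if "z \<in> topspace Z" "smooth_on n (\<phi> ` U) G" for z G
    by (rule smooth_near_chart[OF c b[OF that(1)] oU _ that(2)]) (use b[OF that(1)] in blast)
  have bcoord: "continuous_map Z euclideanreal (\<lambda>z. \<phi> (b z) i)" if "i < n" for i
  proof (rule continuous_map_eq[OF acontD[OF coord[OF that] linear_pr_real]])
    show "pr_real N (ev (h z) (\<lambda>q. \<phi> q i)) = \<phi> (b z) i" if "z \<in> topspace Z" for z
      by (rule pr_real_weil_eval[OF h near]) (use that in \<open>simp_all add: smooth_on_coord\<close>)
  qed
  have bcoord': "continuous_map Z euclideanreal (\<lambda>z. \<phi> (b z) i)" for i
  proof (cases "i < n")
    case False
    have "continuous_map Z euclideanreal (\<lambda>z. 0)" by simp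
    then show ?thesis
      by (rule continuous_map_eq) (use chart_coord_space[OF c b] False in simp)
  qed (rule bcoord)
  have "continuous_map Z (Euclidean_space n) (\<lambda>z. \<phi> (b z))"
    unfolding Euclidean_space_def continuous_map_in_subtopology continuous_map_componentwise_UNIV
    using bcoord' chart_coord_space[OF c b] by blast
  then have bcont: "continuous_map Z (subtopology (Euclidean_space n) (\<phi> ` U)) (\<lambda>z. \<phi> (b z))"
    unfolding continuous_map_in_subtopology using b by blast
  have "acont Z (\<lambda>z. ev (h z) (\<lambda>q. F (freeze (\<phi> (b z)) m (\<phi> q))))" if "m \<le> n" for m
    using that F
  proof (induction m arbitrary: F rule: inc_induct)
    case base
    have "continuous_map Z euclideanreal (\<lambda>z. F (\<phi> (b z)))"
      using continuous_map_compose[OF bcont Ck_on_imp_continuous_map[OF smooth_onD[OF base]]] by (simp add: o_def)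
    from acont_of_real[OF this] show ?case
    proof (rule acont_cong)
      fix z assume z: "z \<in> topspace Z"
      have bX: "b z \<in> topspace X" using b[OF z] chart_subset[OF c] by blast
      have "ev (h z) (\<lambda>_. F (\<phi> (b z))) = ev (h z) (\<lambda>q. F (freeze (\<phi> (b z)) n (\<phi> q)))"
      proof (rule weil_eval_cong[OF h[OF z] smooth_near_const[OF bX] openin_chart_domain[OF c] b[OF z]])
        show "\<forall>q\<in>U. F (\<phi> (b z)) = F (freeze (\<phi> (b z)) n (\<phi> q))"
          using freeze_all[OF chart_coord_space[OF c b[OF z]] chart_coord_space[OF c]] by simp
      qed
      then show "of_real (F (\<phi> (b z))) = ev (h z) (\<lambda>q. F (freeze (\<phi> (b z)) n (\<phi> q)))"
        using weil_eval_const[OF h[OF z] bX] by simp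
    qed
  next
    case (step m)
    have "acont Z (\<lambda>z. \<Sum>j<p. (1 / fact j) *\<^sub>R ((ev (h z) (\<lambda>q. \<phi> q m) - of_real (\<phi> (b z) m)) ^ j *
      ev (h z) (\<lambda>q. (partial_deriv m ^^ j) F (freeze (\<phi> (b z)) (Suc m) (\<phi> q)))))"
      by (intro acont_sum acont_scaleR acont_mult acont_power acont_diff acont_of_real coord bcoord
          step.IH smooth_on_higher_partial_deriv[OF oU] step.prems step.hyps) simp
    then show ?case
      by (rule acont_cong) (rule weil_eval_Taylor[OF h c b step.prems step.hyps(2) p, symmetric])
  qed
  from this[of 0] show ?thesis by (simp add: freeze_def)
qed

lemma acont_fibre_chart:
  fixes h :: "'z \<Rightarrow> ('p \<Rightarrow> real) \<Rightarrow> 'a"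
  assumes c: "(U, \<phi>) \<in> C"
    and h: "\<And>z. z \<in> topspace Z \<Longrightarrow> h z \<in> fibre (b z)" and b: "\<And>z. z \<in> topspace Z \<Longrightarrow> b z \<in> U"
    and coord: "\<And>i. i < n \<Longrightarrow> acont Z (\<lambda>z. ev (h z) (\<lambda>q. \<phi> q i))"
    and f: "f \<in> smooth_funs"
  shows "acont Z (\<lambda>z. h z f)"
proof -
  have "smooth_on n (\<phi> ` (U \<inter> U)) (\<lambda>y. f (inv_into U \<phi> y))"
    by (rule local_smoothD[OF smooth_funs_local[OF f openin_chart_domain[OF c]] c])
  then have F: "smooth_on n (\<phi> ` U) (\<lambda>y. f (inv_into U \<phi> y))" unfolding Int_absorb .
  from acont_weil_eval_chart[OF c h b coord F] show ?thesis
  proof (rule acont_cong)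
    fix z assume z: "z \<in> topspace Z"
    show "ev (h z) (\<lambda>q. f (inv_into U \<phi> (\<phi> q))) = h z f"
      by (rule weil_eval_eq[OF h[OF z] f openin_chart_domain[OF c] b[OF z]]) (simp add: chart_inverse[OF c])
  qed
qed

end

section \<open>The topology of the Weil bundle\<close>

context weil_mfd
begin

abbreviation wbundle :: "(('p \<Rightarrow> real) \<Rightarrow> 'a) set" where
  "wbundle \<equiv> weil_bundle n X C N"

abbreviation bundle_top :: "(('p \<Rightarrow> real) \<Rightarrow> 'a) topology" where
  "bundle_top \<equiv> weil_bundle_topology n X C N"

lemma bundleI: "\<xi> \<in> fibre x \<Longrightarrow> x \<in> topspace X \<Longrightarrow> \<xi> \<in> wbundle"
  unfolding weil_bundle_def by blast

lemma
  assumes "\<xi> \<in> wbundle"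
  shows bundle_fibre: "\<xi> \<in> fibre (proj \<xi>)" and bundle_proj: "proj \<xi> \<in> topspace X"
proof -
  obtain x where x: "x \<in> topspace X" "\<xi> \<in> fibre x"
    using assms unfolding weil_bundle_def by blast
  then show "\<xi> \<in> fibre (proj \<xi>)" "proj \<xi> \<in> topspace X"
    using weil_proj_eq[OF x(2,1)] by simp_all
qed

lemma acont_local:
  assumes "\<And>z. z \<in> topspace Z \<Longrightarrow> \<exists>W. openin Z W \<and> z \<in> W \<and> acont (subtopology Z W) \<Phi>"
  shows "acont Z \<Phi>"
proof (rule acontI, rule continuous_map_local)
  fix L :: "'a \<Rightarrow> real" and z assume L: "linear L" and z: "z \<in> topspace Z"
  from assms[OF z] obtain W where "openin Z W" "z \<in> W" "acont (subtopology Z W) \<Phi>" by blast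
  then show "\<exists>W. openin Z W \<and> z \<in> W \<and> continuous_map (subtopology Z W) euclideanreal (\<lambda>z. L (\<Phi> z))"
    using acontD[OF _ L] by blast
qed

text \<open>
  A neighbourhood of a point is recognised by a bump function supported in it, so continuity of the
  values at smooth functions forces continuity of the base point.
\<close>

lemma continuous_map_proj:
  assumes h: "\<And>z. z \<in> topspace Z \<Longrightarrow> h z \<in> wbundle"
    and ac: "\<And>f. f \<in> smooth_funs \<Longrightarrow> acont Z (\<lambda>z. h z f)"
  shows "continuous_map Z X (\<lambda>z. proj (h z))"
  unfolding continuous_map_def
proof (intro conjI allI impI)
  show "(\<lambda>z. proj (h z)) \<in> topspace Z \<rightarrow> topspace X"
    using bundle_proj[OF h] by blast
  fix W assume W: "openin X W"
  show "openin Z {z \<in> topspace Z. proj (h z) \<in> W}"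
  proof (subst openin_subopen, intro ballI)
    fix z0 assume "z0 \<in> {z \<in> topspace Z. proj (h z) \<in> W}"
    then have z0: "z0 \<in> topspace Z" "proj (h z0) \<in> W" by auto
    from bump_function[OF W z0(2)]
    obtain b W' K where b: "b \<in> smooth_funs" "\<forall>p\<in>topspace X. 0 \<le> b p \<and> b p \<le> 1"
      "openin X W'" "proj (h z0) \<in> W'" "W' \<subseteq> W" "\<forall>p\<in>W'. b p = 1"
      "closedin X K" "K \<subseteq> W" "\<forall>p\<in>topspace X - K. b p = 0"
      by this
    have pr: "pr_real N (h z b) = b (proj (h z))" if "z \<in> topspace Z" for z
      by (rule fibre_pr_real[OF bundle_fibre[OF h[OF that]] b(1)])
    have "continuous_map Z euclideanreal (\<lambda>z. pr_real N (h z b))"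
      by (rule acontD[OF ac[OF b(1)] linear_pr_real])
    from openin_continuous_map_preimage[OF this, of "{0<..}"]
    have "openin Z {z \<in> topspace Z. pr_real N (h z b) \<in> {0<..}}" by simp
    moreover have "z0 \<in> {z \<in> topspace Z. pr_real N (h z b) \<in> {0<..}}"
      using z0(1) pr b(4,6) by simp
    moreover have "{z \<in> topspace Z. pr_real N (h z b) \<in> {0<..}} \<subseteq> {z \<in> topspace Z. proj (h z) \<in> W}"
    proof
      fix z assume z: "z \<in> {z \<in> topspace Z. pr_real N (h z b) \<in> {0<..}}"
      then have "b (proj (h z)) \<noteq> 0" using pr by auto
      then have "proj (h z) \<in> K" using b(9) bundle_proj[OF h] z by blast
      then show "z \<in> {z \<in> topspace Z. proj (h z) \<in> W}" using b(8) z by blast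
    qed
    ultimately show "\<exists>T. openin Z T \<and> z0 \<in> T \<and> T \<subseteq> {z \<in> topspace Z. proj (h z) \<in> W}" by blast
  qed
qed

lemma acont_chart_coord:
  assumes h: "\<And>z. z \<in> topspace Z \<Longrightarrow> h z \<in> wbundle"
    and ac: "\<And>f. f \<in> smooth_funs \<Longrightarrow> acont Z (\<lambda>z. h z f)"
    and c: "(U, \<phi>) \<in> C" and U: "\<And>z. z \<in> topspace Z \<Longrightarrow> proj (h z) \<in> U"
  shows "acont Z (\<lambda>z. ev (h z) (\<lambda>q. \<phi> q i))"
proof (rule acont_local)
  fix z0 assume z0: "z0 \<in> topspace Z"
  have "smooth_near (proj (h z0)) (\<lambda>q. \<phi> q i)"
    by (rule smooth_near_chart[OF c U[OF z0] openin_chart_image[OF c] _ smooth_on_coord]) (use U[OF z0] in blast)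
  then obtain f W where f: "f \<in> smooth_funs" "openin X W" "proj (h z0) \<in> W" "\<forall>p\<in>W. f p = \<phi> p i"
    by (rule smooth_nearE)
  let ?O = "{z \<in> topspace Z. proj (h z) \<in> W}"
  have "openin Z ?O"
    by (rule openin_continuous_map_preimage[OF continuous_map_proj[OF h ac] f(2)])
  moreover have "acont (subtopology Z ?O) (\<lambda>z. ev (h z) (\<lambda>q. \<phi> q i))"
  proof (rule acont_cong[OF acont_subtopology[OF ac[OF f(1)]]])
    fix z assume "z \<in> topspace (subtopology Z ?O)"
    then have z: "z \<in> topspace Z" "proj (h z) \<in> W" by auto
    show "h z f = ev (h z) (\<lambda>q. \<phi> q i)"
      by (rule weil_eval_eq[OF bundle_fibre[OF h[OF z(1)]] f(1,2) z(2) f(4), symmetric])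
  qed
  ultimately show "\<exists>W. openin Z W \<and> z0 \<in> W \<and> acont (subtopology Z W) (\<lambda>z. ev (h z) (\<lambda>q. \<phi> q i))"
    using z0 f(3) by blast
qed

definition basic_open :: "'p set \<Rightarrow> ('p \<Rightarrow> nat \<Rightarrow> real) \<Rightarrow> nat \<Rightarrow> (nat \<Rightarrow> 'a) \<Rightarrow> (nat \<times> nat \<Rightarrow> real) set \<Rightarrow>
    (('p \<Rightarrow> real) \<Rightarrow> 'a) set" where
  "basic_open U \<phi> l \<alpha> V = {\<xi> \<in> wbundle. proj \<xi> \<in> U \<and> weil_coord n X C N \<phi> l \<alpha> \<xi> \<in> V}"

abbreviation coord_top :: "nat \<Rightarrow> (nat \<times> nat \<Rightarrow> real) topology" where
  "coord_top l \<equiv> product_topology (\<lambda>_. euclideanreal) ({..<n} \<times> {..<l})"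

lemma bundle_top_generated:
  "bundle_top = topology_generated_by
    {basic_open U \<phi> l \<alpha> V | U \<phi> l \<alpha> V. (U, \<phi>) \<in> C \<and> weil_basis l \<alpha> \<and> openin (coord_top l) V}"
  unfolding weil_bundle_topology_def basic_open_def by simp

lemma openin_basic_open:
  assumes "(U, \<phi>) \<in> C" "weil_basis l \<alpha>" "openin (coord_top l) V"
  shows "openin bundle_top (basic_open U \<phi> l \<alpha> V)"
  unfolding bundle_top_generated by (rule topology_generated_by_Basis) (use assms in blast)

lemma weil_coord_extensional: "weil_coord n X C N \<phi> l \<alpha> \<xi> \<in> topspace (coord_top l)"
  by (simp add: weil_coord_def)

lemma weil_coord_apply:
  "i < n \<Longrightarrow> j < l \<Longrightarrow>
    weil_coord n X C N \<phi> l \<alpha> \<xi> (i, j) = representation (\<alpha> ` {..<l}) (ev \<xi> (\<lambda>p. \<phi> p i)) (\<alpha> j)"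
  by (simp add: weil_coord_def)

lemma weil_basisD:
  assumes "weil_basis l (\<alpha> :: nat \<Rightarrow> 'a)"
  shows "independent (\<alpha> ` {..<l})" "span (\<alpha> ` {..<l}) = UNIV" "inj_on \<alpha> {..<l}"
  using assms by (simp_all add: weil_basis_def)

lemma basic_open_all:
  assumes "\<xi> \<in> wbundle" "proj \<xi> \<in> U"
  shows "\<xi> \<in> basic_open U \<phi> l \<alpha> (topspace (coord_top l))"
  using assms weil_coord_extensional by (simp add: basic_open_def)

lemma topspace_bundle_top: "topspace bundle_top = wbundle"
proof
  show "topspace bundle_top \<subseteq> wbundle"
    unfolding bundle_top_generated topology_generated_by_topspace by (auto simp: basic_open_def)
  show "wbundle \<subseteq> topspace bundle_top"
  proof
    fix \<xi> assume \<xi>: "\<xi> \<in> wbundle"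
    from chart_exists[OF bundle_proj[OF \<xi>]] obtain U \<phi> where c: "(U, \<phi>) \<in> C" "proj \<xi> \<in> U" by blast
    from weil_basis_exists obtain l and \<alpha> :: "nat \<Rightarrow> 'a" where \<alpha>: "weil_basis l \<alpha>" by blast
    show "\<xi> \<in> topspace bundle_top"
      using openin_subset[OF openin_basic_open[OF c(1) \<alpha> openin_topspace]] basic_open_all[OF \<xi> c(2)] by blast
  qed
qed

text \<open>
  Over a chart domain the coordinates are continuous by definition of the topology, and they
  determine the values at all smooth functions continuously.
\<close>

lemma acont_evaluation:
  assumes f: "f \<in> smooth_funs"
  shows "acont bundle_top (\<lambda>\<xi>. \<xi> f)"
proof (rule acont_local)
  fix \<xi>0 assume "\<xi>0 \<in> topspace bundle_top"
  then have \<xi>0: "\<xi>0 \<in> wbundle" by (simp add: topspace_bundle_top)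
  from chart_exists[OF bundle_proj[OF \<xi>0]] obtain U \<phi> where c: "(U, \<phi>) \<in> C" and U: "proj \<xi>0 \<in> U" by blast
  from weil_basis_exists obtain l and \<alpha> :: "nat \<Rightarrow> 'a" where \<alpha>: "weil_basis l \<alpha>" by blast
  define W where "W = basic_open U \<phi> l \<alpha> (topspace (coord_top l))"
  have W: "openin bundle_top W" unfolding W_def by (rule openin_basic_open[OF c \<alpha> openin_topspace])
  let ?Z = "subtopology bundle_top W"
  have top: "topspace ?Z = W" using openin_subset[OF W] by auto
  have WD: "\<xi> \<in> wbundle" "proj \<xi> \<in> U" if "\<xi> \<in> W" for \<xi>
    using that by (simp_all add: W_def basic_open_def)
  have rep: "continuous_map ?Z euclideanreal (\<lambda>\<xi>. representation (\<alpha> ` {..<l}) (ev \<xi> (\<lambda>p. \<phi> p i)) (\<alpha> j))"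
    if ij: "i < n" "j < l" for i j
    unfolding continuous_map_def
  proof (intro conjI allI impI)
    fix S :: "real set" assume "openin euclideanreal S"
    then have S: "openin (coord_top l) {v \<in> topspace (coord_top l). v (i, j) \<in> S}"
      by (intro openin_continuous_map_preimage[OF continuous_map_product_projection]) (use ij in auto)
    have "openin bundle_top (basic_open U \<phi> l \<alpha> {v \<in> topspace (coord_top l). v (i, j) \<in> S})"
      by (rule openin_basic_open[OF c \<alpha> S])
    moreover have "basic_open U \<phi> l \<alpha> {v \<in> topspace (coord_top l). v (i, j) \<in> S} =
        {\<xi> \<in> W. representation (\<alpha> ` {..<l}) (ev \<xi> (\<lambda>p. \<phi> p i)) (\<alpha> j) \<in> S}"
      unfolding W_def basic_open_def using weil_coord_extensional
      by (simp add: weil_coord_apply[OF ij] Collect_conj_eq[symmetric] conj_ac)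
    ultimately have "openin bundle_top {\<xi> \<in> W. representation (\<alpha> ` {..<l}) (ev \<xi> (\<lambda>p. \<phi> p i)) (\<alpha> j) \<in> S}"
      by simp
    then show "openin ?Z {\<xi> \<in> topspace ?Z. representation (\<alpha> ` {..<l}) (ev \<xi> (\<lambda>p. \<phi> p i)) (\<alpha> j) \<in> S}"
      unfolding top openin_open_subtopology[OF W] by blast
  qed simp
  have "acont ?Z (\<lambda>\<xi>. \<xi> f)"
  proof (rule acont_fibre_chart[OF c _ _ _ f])
    show "\<xi> \<in> fibre (proj \<xi>)" "proj \<xi> \<in> U" if "\<xi> \<in> topspace ?Z" for \<xi>
      using that bundle_fibre WD unfolding top by blast+
    fix i assume i: "i < n"
    have "acont ?Z (\<lambda>\<xi>. \<Sum>j<l. representation (\<alpha> ` {..<l}) (ev \<xi> (\<lambda>p. \<phi> p i)) (\<alpha> j) *\<^sub>R \<alpha> j)"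
      by (intro acont_sum acont_scaleR acont_const rep i) simp
    moreover have "(\<Sum>j<l. representation (\<alpha> ` {..<l}) v (\<alpha> j) *\<^sub>R \<alpha> j) = v" for v
    proof -
      have "(\<Sum>j<l. representation (\<alpha> ` {..<l}) v (\<alpha> j) *\<^sub>R \<alpha> j) =
          (\<Sum>b\<in>\<alpha> ` {..<l}. representation (\<alpha> ` {..<l}) v b *\<^sub>R b)"
        by (simp add: sum.reindex[OF weil_basisD(3)[OF \<alpha>]])
      also have "\<dots> = v"
        by (rule sum_representation_eq) (use weil_basisD[OF \<alpha>] in auto)
      finally show ?thesis .
    qed
    ultimately show "acont ?Z (\<lambda>\<xi>. ev \<xi> (\<lambda>q. \<phi> q i))" by simp
  qed
  then show "\<exists>W. openin bundle_top W \<and> \<xi>0 \<in> W \<and> acont (subtopology bundle_top W) (\<lambda>\<xi>. \<xi> f)"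
    using W basic_open_all[OF \<xi>0 U] unfolding W_def by blast
qed

text \<open>
  The manifold topology is thus the initial topology of the evaluations at global smooth functions,
  a description that mentions neither charts nor bases.
\<close>

proposition continuous_map_bundle_iff:
  "continuous_map Z bundle_top h \<longleftrightarrow>
    (\<forall>z\<in>topspace Z. h z \<in> wbundle) \<and> (\<forall>f\<in>smooth_funs. acont Z (\<lambda>z. h z f))"
proof (intro iffI conjI ballI)
  assume h: "continuous_map Z bundle_top h"
  show "h z \<in> wbundle" if "z \<in> topspace Z" for z
    using continuous_map_funspace[OF h] that topspace_bundle_top by blast
  show "acont Z (\<lambda>z. h z f)" if "f \<in> smooth_funs" for f
    by (rule acont_compose[OF acont_evaluation[OF that] h])
next
  assume "(\<forall>z\<in>topspace Z. h z \<in> wbundle) \<and> (\<forall>f\<in>smooth_funs. acont Z (\<lambda>z. h z f))"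
  then have h: "\<And>z. z \<in> topspace Z \<Longrightarrow> h z \<in> wbundle" and ac: "\<And>f. f \<in> smooth_funs \<Longrightarrow> acont Z (\<lambda>z. h z f)"
    by blast+
  have pre: "openin Z (h -` basic_open U \<phi> l \<alpha> V \<inter> topspace Z)"
    if c: "(U, \<phi>) \<in> C" and \<alpha>: "weil_basis l \<alpha>" and V: "openin (coord_top l) V" for U \<phi> l \<alpha> V
  proof -
    let ?O = "{z \<in> topspace Z. proj (h z) \<in> U}"
    have O: "openin Z ?O"
      by (rule openin_continuous_map_preimage[OF continuous_map_proj[OF h ac] openin_chart_domain[OF c]])
    have top: "topspace (subtopology Z ?O) = ?O" by auto
    have "continuous_map (subtopology Z ?O) (coord_top l) (\<lambda>z. weil_coord n X C N \<phi> l \<alpha> (h z))"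
      unfolding continuous_map_componentwise
    proof (intro conjI ballI)
      show "(\<lambda>z. weil_coord n X C N \<phi> l \<alpha> (h z)) ` topspace (subtopology Z ?O) \<subseteq> extensional ({..<n} \<times> {..<l})"
        by (auto simp: weil_coord_def)
      fix k assume "k \<in> {..<n} \<times> {..<l}"
      then obtain i j where k: "k = (i, j)" "i < n" "j < l" by blast
      have "acont (subtopology Z ?O) (\<lambda>z. ev (h z) (\<lambda>q. \<phi> q i))"
        by (rule acont_chart_coord[OF _ _ c]) (use h acont_subtopology[OF ac] in auto)
      from acontD[OF this linear_representation[OF weil_basisD(1,2)[OF \<alpha>]]]
      show "continuous_map (subtopology Z ?O) euclideanreal (\<lambda>z. weil_coord n X C N \<phi> l \<alpha> (h z) k)"
        by (simp add: k weil_coord_apply)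
    qed
    from openin_continuous_map_preimage[OF this V]
    have "openin Z {z \<in> ?O. weil_coord n X C N \<phi> l \<alpha> (h z) \<in> V}"
      unfolding top openin_open_subtopology[OF O] by blast
    also have "{z \<in> ?O. weil_coord n X C N \<phi> l \<alpha> (h z) \<in> V} = h -` basic_open U \<phi> l \<alpha> V \<inter> topspace Z"
      using h by (auto simp: basic_open_def)
    finally show ?thesis .
  qed
  show "continuous_map Z bundle_top h"
    unfolding bundle_top_generated
  proof (rule continuous_on_generated_topo)
    fix G assume "G \<in> {basic_open U \<phi> l \<alpha> V | U \<phi> l \<alpha> V. (U, \<phi>) \<in> C \<and> weil_basis l \<alpha> \<and> openin (coord_top l) V}"
    then show "openin Z (h -` G \<inter> topspace Z)" using pre by blast
  next
    have "h z \<in> topspace bundle_top" if "z \<in> topspace Z" for z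
      using h[OF that] topspace_bundle_top by blast
    then show "h ` topspace Z \<subseteq>
      \<Union> {basic_open U \<phi> l \<alpha> V | U \<phi> l \<alpha> V. (U, \<phi>) \<in> C \<and> weil_basis l \<alpha> \<and> openin (coord_top l) V}"
      unfolding bundle_top_generated topology_generated_by_topspace by blast
  qed
qed

end

section \<open>Homotopy and connectedness\<close>

abbreviation unit_top :: "real topology" where
  "unit_top \<equiv> top_of_set {0..1}"

lemma square_top: "prod_topology unit_top unit_top = top_of_set ({0..1} \<times> {0..1})"
  by (simp add: subtopology_Times prod_topology_euclidean)

text \<open>
  A free contraction \<open>G\<close> of a loop moves its base point along a track. Preceding each stage of \<open>G\<close> by
  the track run forwards, and following it by the track run backwards, keeps the base point in place;
  at the end only the track and its reverse remain, and these cancel. In the first homotopy \<open>\<sigma>\<close> is the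
  stage of \<open>G\<close> and \<open>\<kappa>\<close> the parameter along the loop.
\<close>

lemma free_null_homotopic_imp_based:
  assumes "homotopic_with (\<lambda>q. q 0 = q 1) unit_top Y p (\<lambda>_. c)"
  shows "homotopic_with (\<lambda>q. q 0 = p 0 \<and> q 1 = p 0) unit_top Y p (\<lambda>_. p 0)"
proof -
  obtain G where G: "continuous_map (prod_topology unit_top unit_top) Y G"
    "\<forall>u. G (0, u) = p u" "\<forall>u. G (1, u) = c" "\<forall>t\<in>{0..1}. G (t, 0) = G (t, 1)"
    using assms unfolding homotopic_with_def by blast
  have p01: "p 1 = p 0" using G(2,4) by (metis atLeastAtMost_iff order_refl zero_le_one)
  define \<sigma> where "\<sigma> t u = min t (min (3 * u) (3 * (1 - u)))" for t u :: real
  define \<kappa> where "\<kappa> t u = max 0 (min 1 ((u - t / 3) / (1 - 2 * t / 3)))" for t u :: real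
  define \<mu> where "\<mu> u = min 1 (min (3 * u) (3 * (1 - u)))" for u :: real
  have comp: "continuous_map (prod_topology unit_top unit_top) Y (\<lambda>z. G (a z, b z))"
    if "continuous_on ({0..1} \<times> {0..1}) a" "continuous_on ({0..1} \<times> {0..1}) b"
      "\<And>z. z \<in> {0..1} \<times> {0..1} \<Longrightarrow> a z \<in> {0..1} \<and> b z \<in> {0..1}" for a b :: "real \<times> real \<Rightarrow> real"
  proof -
    have "continuous_map (prod_topology unit_top unit_top) (prod_topology unit_top unit_top) (\<lambda>z. (a z, b z))"
      unfolding square_top using that by (simp add: continuous_on_Pair image_subset_iff)
    from continuous_map_compose[OF this G(1)] show ?thesis by (simp add: o_def)
  qed
  have first: "homotopic_with (\<lambda>q. q 0 = p 0 \<and> q 1 = p 0) unit_top Y p (\<lambda>u. G (\<mu> u, 0))"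
  proof (subst homotopic_with)
    show "(h 0 = p 0 \<and> h 1 = p 0) = (k 0 = p 0 \<and> k 1 = p 0)"
      if "\<And>x. x \<in> topspace unit_top \<Longrightarrow> h x = k x" for h k :: "real \<Rightarrow> 'a"
      using that[of 0] that[of 1] by simp
    let ?H = "\<lambda>z. G (\<sigma> (fst z) (snd z), \<kappa> (fst z) (snd z))"
    show "\<exists>h. continuous_map (prod_topology unit_top unit_top) Y h \<and>
      (\<forall>x\<in>topspace unit_top. h (0, x) = p x) \<and> (\<forall>x\<in>topspace unit_top. h (1, x) = G (\<mu> x, 0)) \<and>
      (\<forall>t\<in>{0..1}. h (t, 0) = p 0 \<and> h (t, 1) = p 0)"
    proof (intro exI[of _ ?H] conjI ballI)
      show "continuous_map (prod_topology unit_top unit_top) Y ?H"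
      proof (rule comp)
        show "continuous_on ({0..1} \<times> {0..1}) (\<lambda>z. \<sigma> (fst z) (snd z))"
          unfolding \<sigma>_def by (intro continuous_intros)
        show "continuous_on ({0..1} \<times> {0..1}) (\<lambda>z. \<kappa> (fst z) (snd z))"
          unfolding \<kappa>_def by (intro continuous_intros) auto
      qed (auto simp: \<sigma>_def \<kappa>_def)
      fix u :: real assume "u \<in> topspace unit_top"
      then have u: "0 \<le> u" "u \<le> 1" by auto
      show "?H (0, u) = p u" using u G(2) by (simp add: \<sigma>_def \<kappa>_def)
      consider "u \<le> 1/3" | "1/3 \<le> u" "u \<le> 2/3" | "2/3 \<le> u" by linarith
      then show "?H (1, u) = G (\<mu> u, 0)"
      proof cases
        case 1
        then have "\<kappa> 1 u = 0" by (simp add: \<kappa>_def)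
        then show ?thesis by (simp add: \<sigma>_def \<mu>_def)
      next
        case 2
        then have "\<mu> u = 1" by (simp add: \<mu>_def)
        then show ?thesis using G(3) by (simp add: \<sigma>_def \<mu>_def)
      next
        case 3
        then have "\<kappa> 1 u = 1" by (simp add: \<kappa>_def)
        moreover have "\<mu> u \<in> {0..1}" using u by (auto simp: \<mu>_def)
        ultimately show ?thesis using G(4) by (simp add: \<sigma>_def \<mu>_def)
      qed
    next
      fix t :: real assume t: "t \<in> {0..1}"
      have "\<sigma> t 0 = 0" "\<sigma> t 1 = 0" using t by (auto simp: \<sigma>_def)
      moreover have "\<kappa> t 0 = 0"
      proof -
        have "(0 - t / 3) / (1 - 2 * t / 3) \<le> 0"
          using t by (intro divide_nonpos_pos) auto
        then show ?thesis unfolding \<kappa>_def by linarith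
      qed
      moreover have "\<kappa> t 1 = 1" using t by (simp add: \<kappa>_def)
      ultimately show "?H (t, 0) = p 0" "?H (t, 1) = p 0" using G(2) p01 by simp_all
    qed
  qed
  have "homotopic_with (\<lambda>q. q 0 = p 0 \<and> q 1 = p 0) unit_top Y (\<lambda>u. G (\<mu> u, 0)) (\<lambda>_. p 0)"
    unfolding homotopic_with_def
  proof (intro exI[of _ "\<lambda>z. G ((1 - fst z) * \<mu> (snd z), 0)"] conjI allI ballI)
    show "continuous_map (prod_topology unit_top unit_top) Y (\<lambda>z. G ((1 - fst z) * \<mu> (snd z), 0))"
    proof (rule comp)
      show "continuous_on ({0..1} \<times> {0..1}) (\<lambda>z. (1 - fst z) * \<mu> (snd z))"
        unfolding \<mu>_def by (intro continuous_intros)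
      fix z :: "real \<times> real" assume z: "z \<in> {0..1} \<times> {0..1}"
      then have "0 \<le> 1 - fst z" "1 - fst z \<le> 1" "0 \<le> \<mu> (snd z)" "\<mu> (snd z) \<le> 1"
        by (auto simp: \<mu>_def)
      then show "(1 - fst z) * \<mu> (snd z) \<in> {0..1} \<and> 0 \<in> {0..1::real}"
        by (simp add: mult_le_one)
    qed simp
  qed (use G(2) in \<open>simp_all add: \<mu>_def\<close>)
  from homotopic_with_trans[OF first this] show ?thesis .
qed

text \<open>
  The identity of \<open>Y\<close> is homotopic to a map that factors through \<open>X\<close>. This is half of a homotopy
  equivalence, and it suffices to transfer the properties at issue from \<open>X\<close> to \<open>Y\<close>.
\<close>

locale homotopy_factor =
  fixes X :: "'x topology" and Y :: "'y topology" and \<pi> :: "'y \<Rightarrow> 'x" and s :: "'x \<Rightarrow> 'y"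
    and R :: "real \<times> 'y \<Rightarrow> 'y"
  assumes \<pi>: "continuous_map Y X \<pi>" and s: "continuous_map X Y s"
    and R: "continuous_map (prod_topology unit_top Y) Y R"
    and R0: "\<And>y. y \<in> topspace Y \<Longrightarrow> R (0, y) = y"
    and R1: "\<And>y. y \<in> topspace Y \<Longrightarrow> R (1, y) = s (\<pi> y)"
begin

lemma pathin_track:
  assumes "y \<in> topspace Y"
  shows "pathin Y (\<lambda>t. R (t, y))"
proof -
  have "continuous_map unit_top (prod_topology unit_top Y) (\<lambda>t. (t, y))"
    using assms by (simp add: continuous_map_pairwise o_def)
  from continuous_map_compose[OF this R] show ?thesis by (simp add: pathin_def o_def)
qed

lemma track_component:
  assumes "y \<in> topspace Y"
  shows "path_component_of Y y (s (\<pi> y))"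
  unfolding path_component_of_def
  using pathin_track[OF assms] R0[OF assms] R1[OF assms] by blast

text \<open>Every point is joined by its track to the connected image of \<open>X\<close>.\<close>

lemma connected_factor:
  assumes X: "connected_space X"
  shows "connected_space Y"
  unfolding connected_space_subconnected
proof (intro ballI)
  fix y z assume y: "y \<in> topspace Y" and z: "z \<in> topspace Y"
  define T where "T v = (\<lambda>t. R (t, v)) ` {0..1}" for v
  have T: "connectedin Y (T v)" "v \<in> T v" "s (\<pi> v) \<in> T v" if "v \<in> topspace Y" for v
  proof -
    show "connectedin Y (T v)"
      unfolding T_def by (rule connectedin_path_image[OF pathin_track[OF that]])
    show "v \<in> T v" unfolding T_def using R0[OF that] by (intro image_eqI[of _ _ 0]) auto
    show "s (\<pi> v) \<in> T v" unfolding T_def using R1[OF that] by (intro image_eqI[of _ _ 1]) auto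
  qed
  have S: "connectedin Y (s ` topspace X)"
    using connectedin_continuous_map_image[OF s] X connectedin_topspace by blast
  have sp: "s (\<pi> v) \<in> s ` topspace X" if "v \<in> topspace Y" for v
    using continuous_map_funspace[OF \<pi>] that by blast
  have "connectedin Y (T y \<union> s ` topspace X)"
    by (rule connectedin_Un[OF T(1)[OF y] S]) (use T(3)[OF y] sp[OF y] in blast)
  then have "connectedin Y ((T y \<union> s ` topspace X) \<union> T z)"
    by (rule connectedin_Un[OF _ T(1)[OF z]]) (use T(3)[OF z] sp[OF z] in blast)
  then show "\<exists>S. connectedin Y S \<and> y \<in> S \<and> z \<in> S"
    using T(2)[OF y] T(2)[OF z] by blast
qed

lemma path_connected_factor:
  assumes X: "path_connected_space X"
  shows "path_connected_space Y"
  unfolding path_connected_space_iff_path_component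
proof (intro ballI)
  fix y z assume y: "y \<in> topspace Y" and z: "z \<in> topspace Y"
  have "\<pi> y \<in> topspace X" "\<pi> z \<in> topspace X"
    using continuous_map_funspace[OF \<pi>] y z by blast+
  then obtain g where g: "pathin X g" "g 0 = \<pi> y" "g 1 = \<pi> z"
    using X unfolding path_connected_space_def by blast
  have "pathin Y (s \<circ> g)" by (rule pathin_compose[OF g(1) s])
  then have "path_component_of Y (s (\<pi> y)) (s (\<pi> z))"
    unfolding path_component_of_def using g(2,3) by (intro exI[of _ "s \<circ> g"]) simp
  then show "path_component_of Y y z"
    using track_component[OF y] track_component[OF z] path_component_of_trans path_component_of_sym by metis
qed

text \<open>
  A loop \<open>p\<close> is freely homotopic to \<open>s \<circ> \<pi> \<circ> p\<close> through the tracks of its points, and \<open>\<pi> \<circ> p\<close> is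
  contractible in \<open>X\<close>.
\<close>

lemma simply_connected_factor:
  assumes X: "simply_connected_space X"
  shows "simply_connected_space Y"
  unfolding simply_connected_space_def
proof (intro conjI allI impI)
  show "path_connected_space Y"
    using X path_connected_factor unfolding simply_connected_space_def by blast
  fix p assume p: "pathin Y p \<and> p 1 = p 0"
  then have pc: "continuous_map unit_top Y p" by (simp add: pathin_def)
  have pY: "p u \<in> topspace Y" if "u \<in> {0..1}" for u
    using continuous_map_funspace[OF pc] that by auto
  let ?loop = "\<lambda>q. q 0 = q (1::real)"
  have 1: "homotopic_with ?loop unit_top Y p (s \<circ> (\<pi> \<circ> p))"
  proof (subst homotopic_with)
    show "(h 0 = h 1) = (k 0 = k 1)" if "\<And>x. x \<in> topspace unit_top \<Longrightarrow> h x = k x" for h k :: "real \<Rightarrow> 'y"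
      using that[of 0] that[of 1] by simp
    have "continuous_map (prod_topology unit_top unit_top) (prod_topology unit_top Y) (\<lambda>z. (fst z, p (snd z)))"
      using continuous_map_fst[of unit_top unit_top] continuous_map_compose[OF continuous_map_snd pc]
      by (simp only: continuous_map_pairwise o_def fst_conv snd_conv simp_thms)
    from continuous_map_compose[OF this R]
    have "continuous_map (prod_topology unit_top unit_top) Y (\<lambda>z. R (fst z, p (snd z)))"
      by (simp add: o_def)
    then show "\<exists>h. continuous_map (prod_topology unit_top unit_top) Y h \<and>
        (\<forall>x\<in>topspace unit_top. h (0, x) = p x) \<and> (\<forall>x\<in>topspace unit_top. h (1, x) = (s \<circ> (\<pi> \<circ> p)) x) \<and>
        (\<forall>t\<in>{0..1}. h (t, 0) = h (t, 1))"
      using p pY R0 R1 by (intro exI[of _ "\<lambda>z. R (fst z, p (snd z))"]) auto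
  qed
  have "pathin X (\<pi> \<circ> p)" by (rule pathin_compose[OF conjunct1[OF p] \<pi>])
  moreover have "(\<pi> \<circ> p) 1 = (\<pi> \<circ> p) 0" using p by simp
  ultimately have "homotopic_with (\<lambda>q. q 0 = (\<pi> \<circ> p) 0 \<and> q 1 = (\<pi> \<circ> p) 0) unit_top X (\<pi> \<circ> p) (\<lambda>_. (\<pi> \<circ> p) 0)"
    using X unfolding simply_connected_space_def by blast
  then have "homotopic_with ?loop unit_top Y (s \<circ> (\<pi> \<circ> p)) (s \<circ> (\<lambda>_. (\<pi> \<circ> p) 0))"
    by (rule homotopic_with_compose_continuous_map_left[OF _ s]) simp
  then have "homotopic_with ?loop unit_top Y (s \<circ> (\<pi> \<circ> p)) (\<lambda>_. s (\<pi> (p 0)))"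
    by (simp add: o_def)
  from homotopic_with_trans[OF 1 this]
  show "homotopic_with (\<lambda>q. q 0 = p 0 \<and> q 1 = p 0) unit_top Y p (\<lambda>_. p 0)"
    by (rule free_null_homotopic_imp_based)
qed

end

section \<open>Contraction of the bundle onto its zero section\<close>

context weil_mfd
begin

text \<open>The zero section takes \<open>x\<close> to evaluation at \<open>x\<close>, a morphism with values in \<open>\<real> \<subseteq> \<^bold>A\<close>.\<close>

definition zero_pt :: "'p \<Rightarrow> ('p \<Rightarrow> real) \<Rightarrow> 'a" where
  "zero_pt x = (\<lambda>f\<in>smooth_funs. of_real (f x))"

lemma zero_pt_fibre:
  assumes x: "x \<in> topspace X"
  shows "zero_pt x \<in> fibre x"
  unfolding weil_fibre_def algebra_morphisms_def
  using x smooth_funs_const[of 1]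
  by (simp add: zero_pt_def smooth_funs_add smooth_funs_mult smooth_funs_scale pr_real_of_real scaleR_conv_of_real)

lemma weil_eval_zero_pt:
  assumes x: "x \<in> topspace X" and g: "smooth_near x g"
  shows "ev (zero_pt x) g = of_real (g x)"
proof -
  obtain f W where f: "f \<in> smooth_funs" "openin X W" "x \<in> W" "\<forall>p\<in>W. f p = g p"
    using g by (rule smooth_nearE)
  show ?thesis using weil_eval_eq[OF zero_pt_fibre[OF x] f] f by (simp add: zero_pt_def)
qed

lemma zero_pt_continuous: "continuous_map X bundle_top zero_pt"
  unfolding continuous_map_bundle_iff
proof (intro conjI ballI)
  show "zero_pt x \<in> wbundle" if "x \<in> topspace X" for x
    by (rule bundleI[OF zero_pt_fibre[OF that] that])
  show "acont X (\<lambda>x. zero_pt x f)" if "f \<in> smooth_funs" for f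
    using acont_of_real[OF smooth_funs_continuous[OF that]] that by (simp add: zero_pt_def)
qed

lemma proj_continuous: "continuous_map bundle_top X proj"
  by (rule continuous_map_proj) (simp_all add: topspace_bundle_top acont_evaluation)

text \<open>
  A general Weil algebra has no dilations, but the manifold does locally: a point over \<open>x\<close> is scaled
  by composing test functions with the dilation \<open>y \<mapsto> \<phi> x + \<tau> (y - \<phi> x)\<close> of a chart, which fixes \<open>x\<close>.
\<close>

definition dilation :: "(nat \<Rightarrow> real) \<Rightarrow> real \<Rightarrow> (nat \<Rightarrow> real) \<Rightarrow> nat \<Rightarrow> real" where
  "dilation a \<tau> y = (\<lambda>i. a i + \<tau> * (y i - a i))"

definition scale_pt :: "'p set \<Rightarrow> ('p \<Rightarrow> nat \<Rightarrow> real) \<Rightarrow> real \<Rightarrow> (('p \<Rightarrow> real) \<Rightarrow> 'a) \<Rightarrow> ('p \<Rightarrow> real) \<Rightarrow> 'a" where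
  "scale_pt U \<phi> \<tau> \<xi> =
    (\<lambda>f\<in>smooth_funs. ev \<xi> (\<lambda>q. f (inv_into U \<phi> (dilation (\<phi> (proj \<xi>)) \<tau> (\<phi> q)))))"

lemma dilation_in_cube:
  assumes "y \<in> cube n a r" "a \<in> coord_space n" "0 \<le> \<tau>" "\<tau> \<le> 1"
  shows "dilation a \<tau> y \<in> cube n a r"
proof -
  have "\<bar>\<tau> * (y i - a i)\<bar> < r" if "i < n" for i
  proof -
    have "\<bar>\<tau> * (y i - a i)\<bar> \<le> 1 * \<bar>y i - a i\<bar>"
      unfolding abs_mult using assms(3,4) by (intro mult_right_mono) auto
    also have "\<dots> < r" using assms(1) that by (simp add: cube_def)
    finally show ?thesis .
  qed
  then show ?thesis using assms(1,2) by (simp add: cube_def dilation_def)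
qed

lemma chart_cube:
  assumes c: "(U, \<phi>) \<in> C" and W: "openin X W" and x: "x \<in> U" "x \<in> W"
  obtains r where "r > 0" "cube n (\<phi> x) r \<subseteq> \<phi> ` (U \<inter> W)"
  using openin_contains_cube[OF openin_chart_image_Int[OF c W], of "\<phi> x"] x by blast

lemma scale_near:
  assumes c: "(U, \<phi>) \<in> C" and x: "x \<in> U" and \<tau>: "0 \<le> \<tau>" "\<tau> \<le> 1" and f: "f \<in> smooth_funs"
  shows "smooth_near x (\<lambda>q. f (inv_into U \<phi> (dilation (\<phi> x) \<tau> (\<phi> q))))"
proof -
  have a: "\<phi> x \<in> coord_space n" by (rule chart_coord_space[OF c x])
  obtain r where r: "r > 0" "cube n (\<phi> x) r \<subseteq> \<phi> ` (U \<inter> U)"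
    using chart_cube[OF c openin_chart_domain[OF c] x x] by blast
  have F: "smooth_on n (cube n (\<phi> x) r) (\<lambda>y. f (inv_into U \<phi> y))"
    by (rule smooth_on_subset[OF local_smoothD[OF smooth_funs_local[OF f openin_chart_domain[OF c]] c] r(2)])
  have "smooth_on n (cube n (\<phi> x) r) (\<lambda>y. f (inv_into U \<phi> (dilation (\<phi> x) \<tau> y)))"
  proof (rule smooth_on_compose[OF openin_cube openin_cube _ _ F])
    show "smooth_on n (cube n (\<phi> x) r) (\<lambda>y. dilation (\<phi> x) \<tau> y i)" for i
      unfolding dilation_def
      by (intro smooth_on_add smooth_on_mult smooth_on_diff smooth_on_const smooth_on_coord)
    show "dilation (\<phi> x) \<tau> ` cube n (\<phi> x) r \<subseteq> cube n (\<phi> x) r"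
      using dilation_in_cube[OF _ a \<tau>] by blast
  qed
  from smooth_near_chart[OF c x openin_cube centre_in_cube[OF a r(1)] this] show ?thesis .
qed

text \<open>
  Dilations with factor at most \<open>1\<close> shrink towards \<open>x\<close>, so what holds near \<open>x\<close> still holds near \<open>x\<close>
  after a dilation. In particular they act on germs at \<open>x\<close>.
\<close>

lemma dilation_neighbourhood:
  assumes c: "(U, \<phi>) \<in> C" and W: "openin X W" and x: "x \<in> U" "x \<in> W" and \<tau>: "0 \<le> \<tau>" "\<tau> \<le> 1"
  obtains V where "openin X V" "x \<in> V" "\<forall>q\<in>V. inv_into U \<phi> (dilation (\<phi> x) \<tau> (\<phi> q)) \<in> U \<inter> W \<and>
    \<phi> (inv_into U \<phi> (dilation (\<phi> x) \<tau> (\<phi> q))) = dilation (\<phi> x) \<tau> (\<phi> q)"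
proof -
  have a: "\<phi> x \<in> coord_space n" by (rule chart_coord_space[OF c x(1)])
  obtain r where r: "r > 0" "cube n (\<phi> x) r \<subseteq> \<phi> ` (U \<inter> W)"
    using chart_cube[OF c W x] by blast
  let ?V = "{q \<in> U. \<phi> q \<in> cube n (\<phi> x) r}"
  have "inv_into U \<phi> (dilation (\<phi> x) \<tau> (\<phi> q)) \<in> U \<inter> W \<and>
    \<phi> (inv_into U \<phi> (dilation (\<phi> x) \<tau> (\<phi> q))) = dilation (\<phi> x) \<tau> (\<phi> q)" if "q \<in> ?V" for q
  proof -
    have "dilation (\<phi> x) \<tau> (\<phi> q) \<in> \<phi> ` (U \<inter> W)"
      using dilation_in_cube[OF _ a \<tau>] that r(2) by blast
    then obtain u where "u \<in> U" "u \<in> W" "dilation (\<phi> x) \<tau> (\<phi> q) = \<phi> u" by blast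
    then show ?thesis using chart_inverse[OF c] by simp
  qed
  moreover have "openin X ?V" by (rule openin_chart_preimage[OF c openin_cube])
  moreover have "x \<in> ?V" using x(1) centre_in_cube[OF a r(1)] by simp
  ultimately show thesis using that by blast
qed

lemma dilation_centre: "dilation a \<tau> a = a"
  by (simp add: dilation_def)

lemma scale_pt_apply:
  assumes "\<xi> \<in> fibre x" "x \<in> topspace X" "f \<in> smooth_funs"
  shows "scale_pt U \<phi> \<tau> \<xi> f = ev \<xi> (\<lambda>q. f (inv_into U \<phi> (dilation (\<phi> x) \<tau> (\<phi> q))))"
  using assms by (simp add: scale_pt_def weil_proj_eq)

lemma scale_pt_fibre:
  assumes c: "(U, \<phi>) \<in> C" and \<xi>: "\<xi> \<in> fibre x" and x: "x \<in> U" and \<tau>: "0 \<le> \<tau>" "\<tau> \<le> 1"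
  shows "scale_pt U \<phi> \<tau> \<xi> \<in> fibre x"
proof -
  have xX: "x \<in> topspace X" using x chart_subset[OF c] by blast
  define d where "d q = inv_into U \<phi> (dilation (\<phi> x) \<tau> (\<phi> q))" for q
  have app: "scale_pt U \<phi> \<tau> \<xi> f = ev \<xi> (\<lambda>q. f (d q))" if "f \<in> smooth_funs" for f
    unfolding d_def by (rule scale_pt_apply[OF \<xi> xX that])
  have near: "smooth_near x (\<lambda>q. f (d q))" if "f \<in> smooth_funs" for f
    unfolding d_def by (rule scale_near[OF c x \<tau> that])
  obtain V where V: "openin X V" "x \<in> V" "\<forall>q\<in>V. d q \<in> U \<inter> U \<and> \<phi> (d q) = dilation (\<phi> x) \<tau> (\<phi> q)"
    unfolding d_def by (rule dilation_neighbourhood[OF c openin_chart_domain[OF c] x x \<tau>])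
  have dX: "d q \<in> topspace X" if "q \<in> V" for q using V(3) chart_subset[OF c] that by blast
  have dx: "d x = x" using chart_inverse[OF c x] by (simp add: d_def dilation_centre)
  have restr: "ev \<xi> (\<lambda>q. g (d q)) = ev \<xi> (\<lambda>q. (\<lambda>p\<in>topspace X. g p) (d q))"
    if "smooth_near x (\<lambda>q. g (d q))" for g
    by (rule weil_eval_cong[OF \<xi> that V(1,2)]) (simp add: dX)
  show ?thesis
    unfolding weil_fibre_def algebra_morphisms_def mem_Collect_eq
  proof (intro conjI ballI allI)
    show "scale_pt U \<phi> \<tau> \<xi> \<in> extensional smooth_funs" by (simp add: scale_pt_def)
    fix f assume f: "f \<in> smooth_funs"
    show "pr_real N (scale_pt U \<phi> \<tau> \<xi> f) = f x"
      unfolding app[OF f] pr_real_weil_eval[OF \<xi> near[OF f]] dx ..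
    fix k
    show "scale_pt U \<phi> \<tau> \<xi> (\<lambda>x\<in>topspace X. k * f x) = k *\<^sub>R scale_pt U \<phi> \<tau> \<xi> f"
      unfolding app[OF f] app[OF smooth_funs_scale[OF f]]
        restr[OF smooth_near_mult[OF smooth_near_const[OF xX] near[OF f]], symmetric]
        weil_eval_mult[OF smooth_near_const[OF xX] near[OF f] \<xi>] weil_eval_const[OF \<xi> xX]
      by (simp add: scaleR_conv_of_real)
  next
    fix f g assume f: "f \<in> smooth_funs" and g: "g \<in> smooth_funs"
    show "scale_pt U \<phi> \<tau> \<xi> (\<lambda>x\<in>topspace X. f x + g x) = scale_pt U \<phi> \<tau> \<xi> f + scale_pt U \<phi> \<tau> \<xi> g"
      unfolding app[OF f] app[OF g] app[OF smooth_funs_add[OF f g]]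
        restr[OF smooth_near_add[OF near[OF f] near[OF g]], symmetric]
      by (rule weil_eval_add[OF near[OF f] near[OF g] \<xi>])
    show "scale_pt U \<phi> \<tau> \<xi> (\<lambda>x\<in>topspace X. f x * g x) = scale_pt U \<phi> \<tau> \<xi> f * scale_pt U \<phi> \<tau> \<xi> g"
      unfolding app[OF f] app[OF g] app[OF smooth_funs_mult[OF f g]]
        restr[OF smooth_near_mult[OF near[OF f] near[OF g]], symmetric]
      by (rule weil_eval_mult[OF near[OF f] near[OF g] \<xi>])
  next
    show "scale_pt U \<phi> \<tau> \<xi> (\<lambda>x\<in>topspace X. 1) = 1"
      unfolding app[OF smooth_funs_const] restr[OF smooth_near_const[OF xX], symmetric]
      by (simp add: weil_eval_const[OF \<xi> xX])
  qed
qed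

text \<open>
  Scaling multiplies the nilpotent part of each coordinate by \<open>\<tau>\<close>, which shows at once that it depends
  continuously on \<open>\<tau>\<close> and on the point.
\<close>

lemma weil_eval_scale_pt_coord:
  assumes c: "(U, \<phi>) \<in> C" and \<xi>: "\<xi> \<in> fibre x" and x: "x \<in> U" and \<tau>: "0 \<le> \<tau>" "\<tau> \<le> 1"
  shows "ev (scale_pt U \<phi> \<tau> \<xi>) (\<lambda>q. \<phi> q i) =
    of_real (\<phi> x i) + \<tau> *\<^sub>R (ev \<xi> (\<lambda>q. \<phi> q i) - of_real (\<phi> x i))"
proof -
  have xX: "x \<in> topspace X" using x chart_subset[OF c] by blast
  have near: "smooth_near x (\<lambda>q. \<phi> q i)"
    by (rule smooth_near_chart[OF c x openin_chart_image[OF c] _ smooth_on_coord]) (use x in blast)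
  then obtain f W where f: "f \<in> smooth_funs" "openin X W" "x \<in> W" "\<forall>p\<in>W. f p = \<phi> p i"
    by (rule smooth_nearE)
  obtain V where V: "openin X V" "x \<in> V" "\<forall>q\<in>V. inv_into U \<phi> (dilation (\<phi> x) \<tau> (\<phi> q)) \<in> U \<inter> W \<and>
    \<phi> (inv_into U \<phi> (dilation (\<phi> x) \<tau> (\<phi> q))) = dilation (\<phi> x) \<tau> (\<phi> q)"
    by (rule dilation_neighbourhood[OF c f(2) x f(3) \<tau>])
  have "ev (scale_pt U \<phi> \<tau> \<xi>) (\<lambda>q. \<phi> q i) = scale_pt U \<phi> \<tau> \<xi> f"
    by (rule weil_eval_eq[OF scale_pt_fibre[OF c \<xi> x \<tau>] f])
  also have "\<dots> = ev \<xi> (\<lambda>q. f (inv_into U \<phi> (dilation (\<phi> x) \<tau> (\<phi> q))))"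
    by (rule scale_pt_apply[OF \<xi> xX f(1)])
  also have "\<dots> = ev \<xi> (\<lambda>q. (1 - \<tau>) * \<phi> x i + \<tau> * \<phi> q i)"
  proof (rule weil_eval_cong[OF \<xi> scale_near[OF c x \<tau> f(1)] V(1,2)])
    show "\<forall>q\<in>V. f (inv_into U \<phi> (dilation (\<phi> x) \<tau> (\<phi> q))) = (1 - \<tau>) * \<phi> x i + \<tau> * \<phi> q i"
    proof
      fix q assume "q \<in> V"
      then have q: "inv_into U \<phi> (dilation (\<phi> x) \<tau> (\<phi> q)) \<in> W"
        "\<phi> (inv_into U \<phi> (dilation (\<phi> x) \<tau> (\<phi> q))) = dilation (\<phi> x) \<tau> (\<phi> q)" using V(3) by auto
      have "f (inv_into U \<phi> (dilation (\<phi> x) \<tau> (\<phi> q))) = dilation (\<phi> x) \<tau> (\<phi> q) i"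
        using bspec[OF f(4) q(1)] q(2) by simp
      then show "f (inv_into U \<phi> (dilation (\<phi> x) \<tau> (\<phi> q))) = (1 - \<tau>) * \<phi> x i + \<tau> * \<phi> q i"
        by (simp add: dilation_def algebra_simps)
    qed
  qed
  also have "\<dots> = of_real ((1 - \<tau>) * \<phi> x i) + of_real \<tau> * ev \<xi> (\<lambda>q. \<phi> q i)"
    unfolding weil_eval_add[OF smooth_near_const[OF xX] smooth_near_mult[OF smooth_near_const[OF xX] near] \<xi>]
      weil_eval_mult[OF smooth_near_const[OF xX] near \<xi>] weil_eval_const[OF \<xi> xX] ..
  finally show ?thesis by (simp add: scaleR_conv_of_real algebra_simps)
qed

lemma fibre_eqI:
  assumes "\<xi> \<in> fibre x" "\<zeta> \<in> fibre x" "\<And>f. f \<in> smooth_funs \<Longrightarrow> \<xi> f = \<zeta> f"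
  shows "\<xi> = \<zeta>"
proof (rule extensionalityI)
  show "\<xi> \<in> extensional smooth_funs" "\<zeta> \<in> extensional smooth_funs"
    using assms(1,2) by (simp_all add: weil_fibre_def algebra_morphisms_def)
qed (rule assms(3))

lemma scale_pt_1:
  assumes c: "(U, \<phi>) \<in> C" and \<xi>: "\<xi> \<in> fibre x" and x: "x \<in> U"
  shows "scale_pt U \<phi> 1 \<xi> = \<xi>"
proof (rule fibre_eqI[OF scale_pt_fibre[OF c \<xi> x] \<xi>])
  fix f assume f: "f \<in> smooth_funs"
  have xX: "x \<in> topspace X" using x chart_subset[OF c] by blast
  have "ev \<xi> (\<lambda>q. f (inv_into U \<phi> (dilation (\<phi> x) 1 (\<phi> q)))) = \<xi> f"
    by (rule weil_eval_eq[OF \<xi> f openin_chart_domain[OF c] x])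
      (simp add: dilation_def chart_inverse[OF c])
  then show "scale_pt U \<phi> 1 \<xi> f = \<xi> f" by (simp add: scale_pt_apply[OF \<xi> xX f])
qed simp_all

lemma scale_pt_0:
  assumes c: "(U, \<phi>) \<in> C" and \<xi>: "\<xi> \<in> fibre x" and x: "x \<in> U"
  shows "scale_pt U \<phi> 0 \<xi> = zero_pt x"
proof -
  have xX: "x \<in> topspace X" using x chart_subset[OF c] by blast
  show ?thesis
  proof (rule fibre_eqI[OF scale_pt_fibre[OF c \<xi> x] zero_pt_fibre[OF xX]])
    fix f assume f: "f \<in> smooth_funs"
    have "ev \<xi> (\<lambda>q. f (inv_into U \<phi> (dilation (\<phi> x) 0 (\<phi> q)))) = of_real (f x)"
      using weil_eval_const[OF \<xi> xX, of "f x"] chart_inverse[OF c x] by (simp add: dilation_def)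
    then show "scale_pt U \<phi> 0 \<xi> f = zero_pt x f" by (simp add: scale_pt_apply[OF \<xi> xX f] zero_pt_def f)
  qed simp_all
qed

lemma scale_pt_zero_pt:
  assumes c: "(U, \<phi>) \<in> C" and x: "x \<in> U" and \<tau>: "0 \<le> \<tau>" "\<tau> \<le> 1"
  shows "scale_pt U \<phi> \<tau> (zero_pt x) = zero_pt x"
proof -
  have xX: "x \<in> topspace X" using x chart_subset[OF c] by blast
  note z = zero_pt_fibre[OF xX]
  show ?thesis
  proof (rule fibre_eqI[OF scale_pt_fibre[OF c z x \<tau>] z])
    fix f assume f: "f \<in> smooth_funs"
    have "ev (zero_pt x) (\<lambda>q. f (inv_into U \<phi> (dilation (\<phi> x) \<tau> (\<phi> q)))) = of_real (f x)"
      using weil_eval_zero_pt[OF xX scale_near[OF c x \<tau> f]] chart_inverse[OF c x] by (simp add: dilation_centre)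
    then show "scale_pt U \<phi> \<tau> (zero_pt x) f = zero_pt x f"
      by (simp add: scale_pt_apply[OF z xX f]) (simp add: zero_pt_def f)
  qed
qed

end

context weil_mfd
begin

text \<open>
  A homotopy along the fibres, starting at the identity, that ends in the zero section over \<open>W\<close>. It has
  to preserve base points and the zero section so that such homotopies can be composed.
\<close>

definition contraction_over :: "'p set \<Rightarrow> (real \<times> (('p \<Rightarrow> real) \<Rightarrow> 'a) \<Rightarrow> ('p \<Rightarrow> real) \<Rightarrow> 'a) \<Rightarrow> bool" where
  "contraction_over W D \<longleftrightarrow> continuous_map (prod_topology unit_top bundle_top) bundle_top D \<and>
    (\<forall>\<xi>\<in>wbundle. D (0, \<xi>) = \<xi> \<and> (\<forall>t\<in>{0..1}. proj (D (t, \<xi>)) = proj \<xi>) \<and>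
      (proj \<xi> \<in> W \<longrightarrow> D (1, \<xi>) = zero_pt (proj \<xi>))) \<and>
    (\<forall>y\<in>topspace X. \<forall>t\<in>{0..1}. D (t, zero_pt y) = zero_pt y)"

lemma proj_zero_pt: "y \<in> topspace X \<Longrightarrow> proj (zero_pt y) = y"
  by (rule weil_proj_eq[OF zero_pt_fibre])

text \<open>
  With a bump function \<open>b\<close> supported in the domain of a chart, the points over \<open>x\<close> are scaled by
  \<open>1 - t b(x)\<close>. Outside the closed support this is the identity, so it extends continuously to the
  whole bundle.
\<close>

lemma local_contraction:
  assumes x: "x \<in> topspace X"
  shows "\<exists>W D. openin X W \<and> x \<in> W \<and> contraction_over W D"
proof -
  from chart_exists[OF x] obtain U \<phi> where c: "(U, \<phi>) \<in> C" and xU: "x \<in> U" by blast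
  obtain b W K where b: "b \<in> smooth_funs" "\<forall>p\<in>topspace X. 0 \<le> b p \<and> b p \<le> 1"
    "openin X W" "x \<in> W" "W \<subseteq> U" "\<forall>p\<in>W. b p = 1"
    "closedin X K" "K \<subseteq> U" "\<forall>p\<in>topspace X - K. b p = 0"
    by (rule bump_function[OF openin_chart_domain[OF c] xU])
  define \<tau> where "\<tau> z = 1 - fst z * b (proj (snd z))" for z :: "real \<times> (('p \<Rightarrow> real) \<Rightarrow> 'a)"
  define D where "D z = (if proj (snd z) \<in> U then scale_pt U \<phi> (\<tau> z) (snd z) else snd z)" for z
  let ?Z = "prod_topology unit_top bundle_top"
  have Z: "fst z \<in> {0..1}" "snd z \<in> wbundle" if "z \<in> topspace ?Z" for z
    using that by (auto simp: topspace_bundle_top)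
  have \<tau>: "0 \<le> \<tau> z" "\<tau> z \<le> 1" if z: "z \<in> topspace ?Z" for z
  proof -
    have "0 \<le> b (proj (snd z))" "b (proj (snd z)) \<le> 1" "0 \<le> fst z" "fst z \<le> 1"
      using b(2) bundle_proj[OF Z(2)[OF z]] Z(1)[OF z] by auto
    then show "0 \<le> \<tau> z" "\<tau> z \<le> 1" by (simp_all add: \<tau>_def mult_le_one)
  qed
  have D_fibre: "D z \<in> fibre (proj (snd z))" if z: "z \<in> topspace ?Z" for z
    using scale_pt_fibre[OF c bundle_fibre[OF Z(2)[OF z]] _ \<tau>[OF z]] bundle_fibre[OF Z(2)[OF z]]
    by (simp add: D_def)
  have sndc: "continuous_map ?Z bundle_top snd" by (rule continuous_map_snd)
  have projc: "continuous_map ?Z X (\<lambda>z. proj (snd z))"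
    using continuous_map_compose[OF sndc proj_continuous] by (simp add: o_def)
  have \<tau>c: "continuous_map ?Z euclideanreal \<tau>"
  proof -
    have "continuous_map ?Z euclideanreal (\<lambda>z. b (proj (snd z)))"
      using continuous_map_compose[OF projc smooth_funs_continuous[OF b(1)]] by (simp add: o_def)
    moreover have "continuous_map ?Z euclideanreal fst"
      using continuous_map_fst[of unit_top bundle_top] by (simp add: continuous_map_in_subtopology)
    ultimately show ?thesis
      unfolding \<tau>_def by (intro continuous_map_diff continuous_map_real_mult) simp_all
  qed
  have "continuous_map ?Z bundle_top D"
    unfolding continuous_map_bundle_iff
  proof (intro conjI ballI)
    show "D z \<in> wbundle" if "z \<in> topspace ?Z" for z
      by (rule bundleI[OF D_fibre[OF that] bundle_proj[OF Z(2)[OF that]]])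
    fix f assume f: "f \<in> smooth_funs"
    show "acont ?Z (\<lambda>z. D z f)"
    proof (rule acont_local)
      fix z0 assume z0: "z0 \<in> topspace ?Z"
      show "\<exists>Q. openin ?Z Q \<and> z0 \<in> Q \<and> acont (subtopology ?Z Q) (\<lambda>z. D z f)"
      proof (cases "proj (snd z0) \<in> U")
        case True
        define O1 where "O1 = {z \<in> topspace ?Z. proj (snd z) \<in> U}"
        have O1: "openin ?Z O1"
          unfolding O1_def by (rule openin_continuous_map_preimage[OF projc openin_chart_domain[OF c]])
        let ?Y = "subtopology ?Z O1"
        have Y: "z \<in> topspace ?Z" "proj (snd z) \<in> U" if "z \<in> topspace ?Y" for z
          using that by (simp_all add: O1_def)
        have coord: "acont ?Y (\<lambda>z. ev (snd z) (\<lambda>q. \<phi> q i))" for i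
        proof (rule acont_chart_coord[OF _ _ c])
          show "snd z \<in> wbundle" "proj (snd z) \<in> U" if "z \<in> topspace ?Y" for z
            using Z(2) Y that by blast+
          show "acont ?Y (\<lambda>z. snd z g)" if "g \<in> smooth_funs" for g
            by (rule acont_subtopology[OF acont_compose[OF acont_evaluation[OF that] sndc]])
        qed
        have pr: "pr_real N (ev (snd z) (\<lambda>q. \<phi> q i)) = \<phi> (proj (snd z)) i" if z: "z \<in> topspace ?Y" for z i
        proof (rule pr_real_weil_eval[OF bundle_fibre[OF Z(2)[OF Y(1)[OF z]]]])
          show "smooth_near (proj (snd z)) (\<lambda>q. \<phi> q i)"
            by (rule smooth_near_chart[OF c Y(2)[OF z] openin_chart_image[OF c] _ smooth_on_coord])
              (use Y(2)[OF z] in blast)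
        qed
        have "acont ?Y (\<lambda>z. D z f)"
        proof (rule acont_fibre_chart[OF c _ _ _ f])
          show "D z \<in> fibre (proj (snd z))" "proj (snd z) \<in> U" if "z \<in> topspace ?Y" for z
            using D_fibre Y that by blast+
          fix i
          let ?v = "\<lambda>z. ev (snd z) (\<lambda>q. \<phi> q i)"
          have "acont ?Y (\<lambda>z. of_real (pr_real N (?v z)))"
            by (rule acont_of_real[OF acontD[OF coord linear_pr_real]])
          then have "acont ?Y (\<lambda>z. of_real (pr_real N (?v z)) + \<tau> z *\<^sub>R (?v z - of_real (pr_real N (?v z))))"
            by (intro acont_add acont_scaleR acont_diff coord continuous_map_from_subtopology[OF \<tau>c])
          then show "acont ?Y (\<lambda>z. ev (D z) (\<lambda>q. \<phi> q i))"
          proof (rule acont_cong)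
            fix z assume z: "z \<in> topspace ?Y"
            show "of_real (pr_real N (?v z)) + \<tau> z *\<^sub>R (?v z - of_real (pr_real N (?v z))) = ev (D z) (\<lambda>q. \<phi> q i)"
              using weil_eval_scale_pt_coord[OF c bundle_fibre[OF Z(2)[OF Y(1)[OF z]]] Y(2)[OF z] \<tau>[OF Y(1)[OF z]]]
                Y(2)[OF z] by (simp add: D_def pr[OF z])
          qed
        qed
        moreover have "z0 \<in> O1" using z0 True by (simp add: O1_def)
        ultimately show ?thesis using O1 by blast
      next
        case False
        define O2 where "O2 = {z \<in> topspace ?Z. proj (snd z) \<in> topspace X - K}"
        have O2: "openin ?Z O2"
          unfolding O2_def by (rule openin_continuous_map_preimage[OF projc]) (use b(7) in blast)
        have "acont (subtopology ?Z O2) (\<lambda>z. snd z f)"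
          by (rule acont_subtopology[OF acont_compose[OF acont_evaluation[OF f] sndc]])
        then have "acont (subtopology ?Z O2) (\<lambda>z. D z f)"
        proof (rule acont_cong)
          fix z assume "z \<in> topspace (subtopology ?Z O2)"
          then have z: "z \<in> topspace ?Z" "proj (snd z) \<in> topspace X - K" by (simp_all add: O2_def)
          have "\<tau> z = 1" using b(9) z(2) by (simp add: \<tau>_def)
          then show "snd z f = D z f"
            using scale_pt_1[OF c bundle_fibre[OF Z(2)[OF z(1)]]] by (simp add: D_def)
        qed
        moreover have "z0 \<in> O2"
          using z0 False b(8) bundle_proj[OF Z(2)[OF z0]] by (auto simp: O2_def)
        ultimately show ?thesis using O2 by blast
      qed
    qed
  qed
  moreover have "D (0, \<xi>) = \<xi> \<and> (\<forall>t\<in>{0..1}. proj (D (t, \<xi>)) = proj \<xi>) \<and>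
      (proj \<xi> \<in> W \<longrightarrow> D (1, \<xi>) = zero_pt (proj \<xi>))" if \<xi>: "\<xi> \<in> wbundle" for \<xi>
  proof (intro conjI ballI impI)
    show "D (0, \<xi>) = \<xi>"
      using scale_pt_1[OF c bundle_fibre[OF \<xi>]] by (simp add: D_def \<tau>_def)
    show "proj (D (t, \<xi>)) = proj \<xi>" if "t \<in> {0..1}" for t
      using weil_proj_eq[OF D_fibre[of "(t, \<xi>)"]] that \<xi> bundle_proj[OF \<xi>] by (simp add: topspace_bundle_top)
    assume W: "proj \<xi> \<in> W"
    then have "proj \<xi> \<in> U" "\<tau> (1, \<xi>) = 0" using b(5,6) by (auto simp: \<tau>_def)
    then show "D (1, \<xi>) = zero_pt (proj \<xi>)"
      using scale_pt_0[OF c bundle_fibre[OF \<xi>]] by (simp add: D_def)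
  qed
  moreover have "D (t, zero_pt y) = zero_pt y" if y: "y \<in> topspace X" and t: "t \<in> {0..1}" for y t
  proof -
    have "(t, zero_pt y) \<in> topspace ?Z"
      using t bundleI[OF zero_pt_fibre[OF y] y] by (simp add: topspace_bundle_top)
    from \<tau>[OF this] show ?thesis
      using scale_pt_zero_pt[OF c] proj_zero_pt[OF y] by (simp add: D_def)
  qed
  ultimately have "contraction_over W D" unfolding contraction_over_def by blast
  then show ?thesis using b(3,4) by blast
qed

text \<open>
  Running two contractions at the same time contracts over both sets: what the first one has moved to
  the zero section stays there, and the base points are not moved at all.
\<close>

lemma contraction_Un:
  assumes D: "contraction_over W D" and E: "contraction_over V E"
  shows "contraction_over (W \<union> V) (\<lambda>z. E (fst z, D z))"
proof -
  let ?Z = "prod_topology unit_top bundle_top"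
  have Dc: "continuous_map ?Z bundle_top D" and Ec: "continuous_map ?Z bundle_top E"
    using D E by (simp_all add: contraction_over_def)
  have "continuous_map ?Z ?Z (\<lambda>z. (fst z, D z))"
    using continuous_map_fst[of unit_top bundle_top] Dc
    by (simp add: continuous_map_pairwise o_def)
  from continuous_map_compose[OF this Ec]
  have "continuous_map ?Z bundle_top (\<lambda>z. E (fst z, D z))" by (simp add: o_def)
  moreover have "E (0, D (0, \<xi>)) = \<xi> \<and> (\<forall>t\<in>{0..1}. proj (E (t, D (t, \<xi>))) = proj \<xi>) \<and>
      (proj \<xi> \<in> W \<union> V \<longrightarrow> E (1, D (1, \<xi>)) = zero_pt (proj \<xi>))" if \<xi>: "\<xi> \<in> wbundle" for \<xi>
  proof -
    have Db: "D (t, \<xi>) \<in> wbundle" if "t \<in> {0..1}" for t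
      using continuous_map_funspace[OF Dc] that \<xi> by (auto simp: topspace_bundle_top Pi_iff)
    have D\<xi>: "D (0, \<xi>) = \<xi>" "\<forall>t\<in>{0..1}. proj (D (t, \<xi>)) = proj \<xi>"
      "proj \<xi> \<in> W \<Longrightarrow> D (1, \<xi>) = zero_pt (proj \<xi>)"
      using D \<xi> by (simp_all add: contraction_over_def)
    have E\<xi>: "E (0, \<zeta>) = \<zeta>" "\<forall>t\<in>{0..1}. proj (E (t, \<zeta>)) = proj \<zeta>"
      "proj \<zeta> \<in> V \<Longrightarrow> E (1, \<zeta>) = zero_pt (proj \<zeta>)" if "\<zeta> \<in> wbundle" for \<zeta>
      using E that by (simp_all add: contraction_over_def)
    have Ez: "E (1, zero_pt (proj \<xi>)) = zero_pt (proj \<xi>)"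
      using E bundle_proj[OF \<xi>] by (simp add: contraction_over_def)
    show ?thesis
    proof (intro conjI ballI impI)
      show "E (0, D (0, \<xi>)) = \<xi>" using D\<xi>(1) E\<xi>(1)[OF \<xi>] by simp
      show "proj (E (t, D (t, \<xi>))) = proj \<xi>" if "t \<in> {0..1}" for t
        using bspec[OF E\<xi>(2)[OF Db[OF that]] that] bspec[OF D\<xi>(2) that] by simp
      have 1: "(1::real) \<in> {0..1}" by simp
      assume "proj \<xi> \<in> W \<union> V"
      then show "E (1, D (1, \<xi>)) = zero_pt (proj \<xi>)"
      proof
        assume "proj \<xi> \<in> W"
        then show ?thesis using D\<xi>(3) Ez by simp
      next
        assume "proj \<xi> \<in> V"
        then show ?thesis using E\<xi>(3)[OF Db[OF 1]] bspec[OF D\<xi>(2) 1] by simp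
      qed
    qed
  qed
  moreover have "E (t, D (t, zero_pt y)) = zero_pt y" if "y \<in> topspace X" "t \<in> {0..1}" for y t
    using D E that by (simp add: contraction_over_def)
  ultimately show ?thesis by (simp add: contraction_over_def)
qed

lemma contraction_empty: "contraction_over {} snd"
  by (simp add: contraction_over_def continuous_map_snd)

proposition contraction_to_zero_section:
  assumes "compact_space X"
  shows "\<exists>D. contraction_over (topspace X) D"
proof -
  let ?\<U> = "{W. openin X W \<and> (\<exists>D. contraction_over W D)}"
  have op: "\<forall>W\<in>?\<U>. openin X W" by blast
  have "\<Union>?\<U> = topspace X"
  proof
    show "\<Union>?\<U> \<subseteq> topspace X" using openin_subset by blast
    show "topspace X \<subseteq> \<Union>?\<U>"
    proof
      fix x assume "x \<in> topspace X"
      from local_contraction[OF this] show "x \<in> \<Union>?\<U>" by blast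
    qed
  qed
  then obtain F where F: "finite F" "F \<subseteq> ?\<U>" "\<Union>F = topspace X"
    using assms op unfolding compact_space by meson
  have "\<exists>D. contraction_over (\<Union>F) D"
    using F(1,2)
  proof (induction F rule: finite_induct)
    case empty
    show ?case using contraction_empty by (intro exI[of _ snd]) simp
  next
    case (insert W F)
    obtain D where D: "contraction_over (\<Union>F) D" using insert by blast
    obtain E where E: "contraction_over W E" using insert.prems by blast
    from contraction_Un[OF E D] show ?case by (intro exI) simp
  qed
  then show ?thesis unfolding F(3) .
qed

end

theorem lemma3p4:
  fixes X :: "'p topology" and C :: "'p chart set" and n :: nat
    and N :: "'a::{real_algebra_1, comm_ring_1} set"
  assumes "smooth_manifold n X C" and "compact_space X" and "weil_algebra N"
  shows "(connected_space X \<longrightarrow> connected_space (weil_bundle_topology n X C N)) \<and>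
         (path_connected_space X \<longrightarrow> path_connected_space (weil_bundle_topology n X C N)) \<and>
         (simply_connected_space X \<longrightarrow> simply_connected_space (weil_bundle_topology n X C N))"
proof -
  interpret weil_mfd n X C N
    using assms(1,3) by (intro weil_mfd.intro smooth_mfd.intro weil_alg.intro)
  obtain D where D: "contraction_over (topspace X) D"
    using contraction_to_zero_section[OF assms(2)] by blast
  interpret homotopy_factor X bundle_top proj zero_pt D
  proof
    show "continuous_map bundle_top X proj" by (rule proj_continuous)
    show "continuous_map X bundle_top zero_pt" by (rule zero_pt_continuous)
    show "continuous_map (prod_topology unit_top bundle_top) bundle_top D"
      using D by (simp add: contraction_over_def)
    show "D (0, \<xi>) = \<xi>" "D (1, \<xi>) = zero_pt (proj \<xi>)" if "\<xi> \<in> topspace bundle_top" for \<xi>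
      using D that bundle_proj by (simp_all add: contraction_over_def topspace_bundle_top)
  qed
  show ?thesis
    using connected_factor path_connected_factor simply_connected_factor by blast
qed

end
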